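(* Let $n\ge 1$, $q\in(0,1)$, $(a_i)_{i\in\mathbb{Z}}$ positive reals, $b_i=a_i(1-q)$, and let $P_Y(X;t)$ be the transition probability of the $n$-particle $q$-TAZRP with conductances $(a_i)$. For all $X,Y\in\mathbb{W}^n$ and all $t>0$, $$P_Y(X;t)=\frac{1}{W(X)}\sum_{\sigma\in S_n}\Lambda_Y(X;t;\sigma),$$ where $$\Lambda_Y(X;t;\sigma)=\left(\prod_{k=1}^n\frac{-1}{b_{x_k}}\right)\frac{1}{(2\pi i)^n}\oint_{C_1}dw_1\cdots\oint_{C_n}dw_n\;A_\sigma(w_1,\dots,w_n)\prod_{j=1}^n\left[\,{\prod_{k=y_{\sigma(j)}}^{x_j}}'\left(\frac{b_k}{b_k-w_{\sigma(j)}}\right)e^{-w_jt}\right].$$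
   Context: State space: $\mathbb{W}^n=\{(i_1,\dots,i_n)\in\mathbb{Z}^n: i_1\ge i_2\ge\cdots\ge i_n\}$. Write $X=(x_1,\dots,x_n)$, $Y=(y_1,\dots,y_n)$. Process ($q$-TAZRP with inhomogeneous jump rates): $q\in(0,1)$ is fixed; each site $i\in\mathbb{Z}$ has a conductance $a_i>0$, and $b_i=a_i(1-q)$. The process is the (minimal) continuous-time Markov chain on $\mathbb{W}^n$ with the following dynamics. If $x_{k-1}>x_k=x_{k+1}=\dots=x_{k+j-1}=m>x_{k+j}$ (a stack of height $j$ at site $m$, with the inequalities involving indices $0$ or $n+1$ omitted), then the particle $x_k$ at the top of the stack jumps to $m+1$ at rate $a_m(1-q^j)=b_m(1+q+\dots+q^{j-1})$, i.e. the state changes from $X$ to $X$ with $x_k$ replaced by $x_k+1$; the other particles of the stack cannot move. No other transitions occur. $P_Y(X;t)$ is the probability that the process is in state $X$ at time $t$ given that it is in state $Y$ at time $0$. $W(X)$: if $X=(s_1,\dots,s_1,s_2,\dots,s_2,\dots,s_m,\dots,s_m)$ with $s_1>s_2>\dots>s_m$ and $s_i$ repeated $k_i$ times, then $W(X)=\prod_{i=1}^m [k_i]_q!$, where $[k]_q!=\prod_{j=1}^k\frac{1-q^j}{1-q}$. $A_\sigma$: for integers $\alpha<\beta$ let $S_{(\beta,\alpha)}=-\dfrac{qw_\beta-w_\alpha}{qw_\alpha-w_\beta}$. For $\sigma\in S_n$, a pair $(\beta,\alpha)$ is an inversion of $\sigma$ if $\alpha<\beta$ and $\sigma^{-1}(\alpha)>\sigma^{-1}(\beta)$.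 Then $A_\sigma(w_1,\dots,w_n)=\prod_{(\beta,\alpha)\text{ inversion of }\sigma}S_{(\beta,\alpha)}$, with $A_{\mathrm{id}}=1$. Primed product: ${\prod_{k=m}^{n}}'f(k)$ equals $\prod_{k=m}^n f(k)$ if $n\ge m$, equals $1$ if $n=m-1$, and equals $\prod_{k=n+1}^{m-1}\frac{1}{f(k)}$ if $n<m-1$. Contours: all $C_j$ are the same counter-clockwise circle $\{|z|=R\}$ with $R$ large enough to enclose all the poles $b_k$ of the integrand (e.g. $R>b_k$ for all $k$ between the smallest and the largest of the $x_i,y_i$). Thus with respect to $w_j$ the poles $b_k$ and $qw_i$ ($i<j$) are enclosed by $C_j$ and the poles $q^{-1}w_l$ ($l>j$) are not. *)

theory Defs
  imports "HOL-Probability.Probability" "HOL-Complex_Analysis.Complex_Analysis"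
    "HOL-Combinatorics.Permutations"
begin

section \<open>Minimal continuous-time Markov chains\<close>

definition exit_rate :: "'s set \<Rightarrow> ('s \<Rightarrow> 's \<Rightarrow> real) \<Rightarrow> 's \<Rightarrow> real" where
  "exit_rate E r x = (\<Sum>\<^sub>\<infinity>y\<in>E - {x}. r x y)"

text \<open>
  Jump chain / holding time description of the minimal chain on the countable set \<open>E\<close> with
  jump rates \<open>r\<close> (off-diagonal entries of the Q-matrix) and without absorbing states, started
  at \<open>y\<close>: the jump chain \<open>Z\<close> is a Markov chain with transition probabilities
  \<open>r u v / exit_rate E r u\<close>, and given \<open>Z\<close> the holding times \<open>S\<close> are independent, \<open>S m\<close> being
  exponential with parameter \<open>exit_rate E r (Z m)\<close>. This is expressed through the
  finite-dimensional distributions of \<open>(Z, S)\<close>, and determines the law of \<open>(Z, S)\<close>.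
\<close>

definition jump_hold_chain ::
  "'w measure \<Rightarrow> 's set \<Rightarrow> ('s \<Rightarrow> 's \<Rightarrow> real) \<Rightarrow> 's \<Rightarrow>
    (nat \<Rightarrow> 'w \<Rightarrow> 's) \<Rightarrow> (nat \<Rightarrow> 'w \<Rightarrow> real) \<Rightarrow> bool" where
  "jump_hold_chain M E r y Z S \<longleftrightarrow>
     prob_space M \<and>
     (\<forall>m. Z m \<in> measurable M (count_space E)) \<and>
     (\<forall>m. S m \<in> borel_measurable M) \<and>
     (\<forall>m. \<forall>z \<in> {..m} \<rightarrow> E. \<forall>B \<in> {..m} \<rightarrow> sets borel.
        measure M {\<omega> \<in> space M. \<forall>i\<le>m. Z i \<omega> = z i \<and> S i \<omega> \<in> B i} =
          (if z 0 = y then 1 else 0) *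
          (\<Prod>i<m. if z (Suc i) = z i then 0 else r (z i) (z (Suc i)) / exit_rate E r (z i)) *
          (\<Prod>i\<le>m. measure (density lborel (exponential_density (exit_rate E r (z i)))) (B i)))"

text \<open>
  The event that the chain is in state \<open>x\<close> at time \<open>t\<close>. After the explosion time
  \<open>\<Sum>i. S i \<omega>\<close> the minimal chain is in no state of \<open>E\<close>.
\<close>

definition in_state_at ::
  "'w measure \<Rightarrow> (nat \<Rightarrow> 'w \<Rightarrow> 's) \<Rightarrow> (nat \<Rightarrow> 'w \<Rightarrow> real) \<Rightarrow> real \<Rightarrow> 's \<Rightarrow> 'w set" where
  "in_state_at M Z S t x =
     {\<omega> \<in> space M. \<exists>m. (\<Sum>i<m. S i \<omega>) \<le> t \<and> t < (\<Sum>i<Suc m. S i \<omega>) \<and> Z m \<omega> = x}"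


section \<open>The \<open>q\<close>-TAZRP\<close>

definition Weyl :: "nat \<Rightarrow> (nat \<Rightarrow> int) set" where
  "Weyl n = {X \<in> {1..n} \<rightarrow>\<^sub>E UNIV. \<forall>i\<in>{1..n}. \<forall>j\<in>{1..n}. i \<le> j \<longrightarrow> X j \<le> X i}"

definition site_count :: "nat \<Rightarrow> (nat \<Rightarrow> int) \<Rightarrow> int \<Rightarrow> nat" where
  "site_count n X s = card {k\<in>{1..n}. X k = s}"

text \<open>
  The particle with the smallest index in a stack is on its top. Distinct \<open>k\<close> give distinct
  targets \<open>X(k := X k + 1)\<close>, so at most one summand is nonzero.
\<close>

definition tazrp_rate ::
  "real \<Rightarrow> (int \<Rightarrow> real) \<Rightarrow> nat \<Rightarrow> (nat \<Rightarrow> int) \<Rightarrow> (nat \<Rightarrow> int) \<Rightarrow> real" where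
  "tazrp_rate q a n X X' =
     (\<Sum>k\<in>{1..n}. if (k = 1 \<or> X (k - 1) > X k) \<and> X' = X(k := X k + 1)
                   then a (X k) * (1 - q ^ site_count n X (X k)) else 0)"

text \<open>
  For \<open>n \<ge> 1\<close>, \<open>0 < q < 1\<close> and positive conductances \<open>a\<close>, the first particle can always jump,
  so there are no absorbing states.
\<close>

definition is_tazrp ::
  "'w measure \<Rightarrow> real \<Rightarrow> (int \<Rightarrow> real) \<Rightarrow> nat \<Rightarrow> (nat \<Rightarrow> int) \<Rightarrow>
    (nat \<Rightarrow> 'w \<Rightarrow> nat \<Rightarrow> int) \<Rightarrow> (nat \<Rightarrow> 'w \<Rightarrow> real) \<Rightarrow> bool" where
  "is_tazrp M q a n Y Z S \<longleftrightarrow> jump_hold_chain M (Weyl n) (tazrp_rate q a n) Y Z S"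


section \<open>The contour integral formula\<close>

definition b_of :: "real \<Rightarrow> (int \<Rightarrow> real) \<Rightarrow> int \<Rightarrow> real" where
  "b_of q a i = a i * (1 - q)"

definition qfact :: "real \<Rightarrow> nat \<Rightarrow> real" where
  "qfact q k = (\<Prod>j=1..k. (1 - q ^ j) / (1 - q))"

definition Wt :: "real \<Rightarrow> nat \<Rightarrow> (nat \<Rightarrow> int) \<Rightarrow> real" where
  "Wt q n X = (\<Prod>s\<in>X ` {1..n}. qfact q (site_count n X s))"

definition S_factor :: "real \<Rightarrow> (nat \<Rightarrow> complex) \<Rightarrow> nat \<Rightarrow> nat \<Rightarrow> complex" where
  "S_factor q w \<beta> \<alpha> =
     - ((of_real q * w \<beta> - w \<alpha>) / (of_real q * w \<alpha> - w \<beta>))"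

text \<open>Inversions record values, not positions: the larger value \<open>\<beta>\<close> stands left of \<open>\<alpha>\<close>.\<close>

definition inversions :: "nat \<Rightarrow> (nat \<Rightarrow> nat) \<Rightarrow> (nat \<times> nat) set" where
  "inversions n \<sigma> =
     {(\<beta>, \<alpha>). \<alpha> \<in> {1..n} \<and> \<beta> \<in> {1..n} \<and> \<alpha> < \<beta> \<and> inv \<sigma> \<alpha> > inv \<sigma> \<beta>}"

definition A_coeff :: "real \<Rightarrow> nat \<Rightarrow> (nat \<Rightarrow> nat) \<Rightarrow> (nat \<Rightarrow> complex) \<Rightarrow> complex" where
  "A_coeff q n \<sigma> w = (\<Prod>(\<beta>, \<alpha>)\<in>inversions n \<sigma>. S_factor q w \<beta> \<alpha>)"

definition primed_prod :: "int \<Rightarrow> int \<Rightarrow> (int \<Rightarrow> complex) \<Rightarrow> complex" where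
  "primed_prod m n f =
     (if n \<ge> m then \<Prod>k=m..n. f k
      else if n = m - 1 then 1
      else \<Prod>k=n+1..m-1. 1 / f k)"

text \<open>
  \<open>iterated_contour_integral \<gamma> [j\<^sub>1, \<dots>, j\<^sub>r] F w\<close> integrates \<open>F\<close> over \<open>w j\<^sub>1, \<dots>, w j\<^sub>r\<close>, the
  integral over \<open>w j\<^sub>1\<close> being the outermost; \<open>w\<close> supplies the remaining coordinates.
\<close>

primrec iterated_contour_integral ::
  "(real \<Rightarrow> complex) \<Rightarrow> nat list \<Rightarrow> ((nat \<Rightarrow> complex) \<Rightarrow> complex) \<Rightarrow> (nat \<Rightarrow> complex) \<Rightarrow> complex"
where
  "iterated_contour_integral \<gamma> [] F w = F w"
| "iterated_contour_integral \<gamma> (j # js) F w =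
     contour_integral \<gamma> (\<lambda>z. iterated_contour_integral \<gamma> js F (w(j := z)))"

text \<open>\<open>R\<close> is the radius of the common contour.\<close>

definition \<Lambda> ::
  "real \<Rightarrow> (int \<Rightarrow> real) \<Rightarrow> nat \<Rightarrow> real \<Rightarrow> (nat \<Rightarrow> int) \<Rightarrow> (nat \<Rightarrow> int) \<Rightarrow> real \<Rightarrow>
    (nat \<Rightarrow> nat) \<Rightarrow> complex" where
  "\<Lambda> q a n R Y X t \<sigma> =
     (\<Prod>k=1..n. - 1 / of_real (b_of q a (X k))) *
     (1 / (2 * of_real pi * \<i>) ^ n) *
     iterated_contour_integral (circlepath 0 R) [1..<Suc n]
       (\<lambda>w. A_coeff q n \<sigma> w *
          (\<Prod>j=1..n.
             primed_prod (Y (\<sigma> j)) (X j)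
               (\<lambda>k. of_real (b_of q a k) / (of_real (b_of q a k) - w (\<sigma> j))) *
             exp (- w j * of_real t)))
       (\<lambda>_. 0)"

end

theory Submission
  imports Defs
begin

text \<open>
  For fixed \<open>X\<close> the contour integral formula is shown to solve the backward equation in \<open>Y\<close>, in which
  \<open>W(X)\<close> is a mere constant. In the backward direction the formula satisfies the free evolution equation:
  for each \<open>k\<close>, inserting \<open>- w\<^sub>k\<close> into the integrand yields \<open>b(y\<^sub>k) (u(Y + e\<^sub>k) - u(Y))\<close>. The boundary condition is that
  inserting \<open>w\<^bsub>k+1\<^esub> - q w\<^sub>k\<close> gives \<open>0\<close> when \<open>y\<^sub>k = y\<^bsub>k+1\<^esub>\<close>; summed over a stack of height \<open>j\<close>, the
  weights \<open>1, q, \<dots>, q\<^bsup>j-1\<^esup>\<close> add up to the true jump rate. The summand of \<open>\<sigma>\<close> vanishes if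
  \<open>y\<^sub>m > x\<^bsub>\<sigma>\<^sup>-\<^sup>1(m)\<^esub>\<close> for some \<open>m\<close> (no pole inside the contour of the smallest such variable), and at time
  \<open>0\<close> also if \<open>y\<^sub>m < x\<^bsub>\<sigma>\<^sup>-\<^sup>1(m)\<^esub>\<close> for some \<open>m\<close> (no pole outside the contour of the largest such variable). So at
  time \<open>0\<close> only \<open>Y = X\<close> and the stabilizer of \<open>X\<close> survive, where \<open>\<sigma>\<close> contributes
  \<open>q\<^bsup>inv(\<sigma>)\<^esup>\<close>; these sum to \<open>W(X)\<close>. As every jump raises \<open>\<Sum>i. x\<^sub>i\<close> by one, only finitely many jump paths lead
  from \<open>Y\<close> to \<open>X\<close>, and the backward equations for them have a unique solution.
\<close>

section \<open>Iterated integrals over a polycircle\<close>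

text \<open>Two features shape the argument. The boundary condition is not a pointwise identity:
  \<open>(w (Suc k) - q * w k) * \<Phi> Y w\<close> is merely antisymmetric in the two variables,
  and only after summing over all \<sigma>. It disappears by exchanging the two variables under the
  integral, which is legitimate because all contours are the same circle and the integrand is
  continuous there; nested contours would not allow it. On equal contours the factor of an inversion
  \<open>(\<beta>, \<alpha>)\<close> has its pole in \<open>w \<beta>\<close> inside the circle, at
  \<open>q * w \<alpha>\<close>, and its pole in \<open>w \<alpha>\<close> outside, at
  \<open>w \<beta> / q\<close>. A variable can therefore be evaluated through the interior only if
  it is never the larger entry of an inversion, and through the exterior only if it is never the
  smaller one. This dictates the extremal choices of the variable in the vanishing statements.
  Exterior evaluation is confined to time 0, since \<open>exp (- w * t)\<close> has an essential
  singularity at infinity for other times; vanishing for large \<open>Y\<close>, which is needed at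
  all times, relies on the interior alone.\<close>

definition polycircle :: "real \<Rightarrow> nat set \<Rightarrow> (nat \<Rightarrow> complex) set" where
  "polycircle R K = {w. \<forall>j\<in>K. norm (w j) = R}"

abbreviation circ_int :: "real \<Rightarrow> nat list \<Rightarrow> ((nat \<Rightarrow> complex) \<Rightarrow> complex) \<Rightarrow> (nat \<Rightarrow> complex) \<Rightarrow> complex"
  where "circ_int R \<equiv> iterated_contour_integral (circlepath 0 R)"

lemma polycircle_empty [simp]: "polycircle R {} = UNIV"
  by (simp add: polycircle_def)

lemma polycircle_upd:
  assumes "w \<in> polycircle R K" "norm z = R"
  shows "w(j := z) \<in> polycircle R (insert j K)"
  using assms by (auto simp: polycircle_def)

lemma polycircle_coord_continuous [continuous_intros]: "continuous_on A (\<lambda>w :: nat \<Rightarrow> complex. w j)"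
  by (rule continuous_on_subset[OF continuous_on_product_coordinates]) simp

text \<open>A polycircle is not compact, because the coordinates outside \<open>K\<close> are free.
  As \<open>F\<close> ignores them, they can be set to 0, which leaves a compact product of circles
  and points.\<close>

lemma compact_polycircle_bounded:
  fixes F :: "(nat \<Rightarrow> complex) \<Rightarrow> complex"
  assumes "continuous_on (polycircle R K) F" "\<And>w. F (\<lambda>j. if j \<in> K then w j else 0) = F w"
  shows "\<exists>B. \<forall>w\<in>polycircle R K. norm (F w) \<le> B"
proof -
  define T where "T = (\<Pi>\<^sub>E j\<in>UNIV. if j \<in> K then sphere (0::complex) R else {0})"
  have "compact T"
    unfolding T_def compactin_euclidean_iff[symmetric] euclidean_product_topology[symmetric]
    by (auto simp: compactin_PiE)
  moreover have "T \<subseteq> polycircle R K"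
    by (auto simp: T_def polycircle_def PiE_iff split: if_splits)
  ultimately have "bounded (F ` T)"
    by (intro compact_imp_bounded compact_continuous_image continuous_on_subset[OF assms(1)])
  then obtain B where B: "\<And>w. w \<in> T \<Longrightarrow> norm (F w) \<le> B"
    by (auto simp: bounded_iff)
  have "norm (F w) \<le> B" if "w \<in> polycircle R K" for w
  proof -
    have "(\<lambda>j. if j \<in> K then w j else 0) \<in> T"
      using that by (auto simp: T_def polycircle_def)
    from B[OF this] show ?thesis
      by (simp add: assms(2))
  qed
  then show ?thesis by blast
qed

text \<open>\<open>K\<close> collects the coordinates already placed on the circle; the induction on
  \<open>js\<close> moves each integration variable from the list into \<open>K\<close>. The other
  inductions over \<open>js\<close> with a set \<open>K\<close> follow this pattern.\<close>

lemma circ_int_cong: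
  assumes "R > 0" "\<And>w. w \<in> polycircle R (K \<union> set js) \<Longrightarrow> F w = G w" "w \<in> polycircle R K"
  shows "circ_int R js F w = circ_int R js G w"
  using assms(2,3)
proof (induction js arbitrary: w K)
  case (Cons j js)
  have "circ_int R js F (w(j := z)) = circ_int R js G (w(j := z))" if "norm z = R" for z
    by (rule Cons.IH[of "insert j K"]) (use Cons.prems that in \<open>auto simp: polycircle_def\<close>)
  then show ?case
    using \<open>R > 0\<close> by (auto intro!: contour_integral_eq)
qed simp

lemma continuous_on_fun_upd:
  "continuous_on UNIV (\<lambda>(w :: nat \<Rightarrow> complex, z). w(j := z))"
proof (intro continuous_on_coordinatewise_then_product)
  fix i
  show "continuous_on UNIV (\<lambda>p :: (nat \<Rightarrow> complex) \<times> complex. (case p of (w, z) \<Rightarrow> w(j := z)) i)"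
  proof (cases "i = j")
    case False
    have "continuous_on UNIV (\<lambda>p :: (nat \<Rightarrow> complex) \<times> complex. fst p i)"
      by (rule continuous_on_product_then_coordinatewise) (intro continuous_intros)
    then show ?thesis using False by (simp add: case_prod_unfold)
  qed (simp add: case_prod_unfold continuous_on_snd)
qed

lemma continuous_on_slice:
  assumes "R > 0" "continuous_on (polycircle R (insert j K)) F"
  shows "continuous_on (polycircle R K \<times> sphere 0 R) (\<lambda>(w, z). F (w(j := z)))"
proof -
  have "continuous_on (polycircle R K \<times> sphere 0 R) (F \<circ> (\<lambda>(w, z). w(j := z)))"
  proof (rule continuous_on_compose)
    show "continuous_on (polycircle R K \<times> sphere 0 R) (\<lambda>(w, z :: complex). w(j := z))"
      using continuous_on_fun_upd continuous_on_subset by blast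
    show "continuous_on ((\<lambda>(w, z). w(j := z)) ` (polycircle R K \<times> sphere 0 R)) F"
      by (rule continuous_on_subset[OF assms(2)]) (auto intro: polycircle_upd)
  qed
  then show ?thesis by (simp add: o_def case_prod_unfold)
qed

lemma continuous_on_slice1:
  assumes "R > 0" "continuous_on (polycircle R (insert j K)) F" "w \<in> polycircle R K"
  shows "continuous_on (sphere 0 R) (\<lambda>z. F (w(j := z)))"
proof -
  have "continuous_on (sphere 0 R) ((\<lambda>(w, z). F (w(j := z))) \<circ> (\<lambda>z. (w, z)))"
    by (rule continuous_on_compose)
       (use assms in \<open>auto intro!: continuous_intros continuous_on_subset[OF continuous_on_slice]\<close>)
  then show ?thesis by (simp add: o_def)
qed

text \<open>Parametrising the circle reduces this to an integral over a compact interval that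
  depends continuously on a parameter; the parameter space itself need not be compact.\<close>

lemma continuous_on_circ_int:
  assumes "R > 0" "continuous_on (polycircle R (K \<union> set js)) F"
  shows "continuous_on (polycircle R K) (circ_int R js F)"
  using assms(2)
proof (induction js arbitrary: K)
  case (Cons j js)
  have "continuous_on (polycircle R (insert j K)) (circ_int R js F)"
    using Cons.IH[of "insert j K"] Cons.prems by simp
  note c = continuous_on_slice[OF \<open>R > 0\<close> this]
  define g where "g = circlepath 0 R"
  have "continuous_on (polycircle R K \<times> cbox 0 1)
     (\<lambda>(w, x). circ_int R js F (w(j := g x)) * (2 * pi * \<i> * R * exp (2 * of_real pi * \<i> * x)))"
  proof -
    have g: "g x \<in> sphere 0 R" if "x \<in> cbox 0 1" for x
      using that \<open>R > 0\<close> by (auto simp: g_def circlepath norm_mult)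
    have "continuous_on (polycircle R K \<times> cbox 0 1)
      ((\<lambda>(w, z). circ_int R js F (w(j := z))) \<circ> (\<lambda>(w, x). (w, g x)))"
    proof (rule continuous_on_compose)
      show "continuous_on (polycircle R K \<times> cbox 0 1) (\<lambda>(w, x). (w, g x))"
        unfolding case_prod_unfold g_def circlepath by (intro continuous_intros)
      show "continuous_on ((\<lambda>(w, x). (w, g x)) ` (polycircle R K \<times> cbox 0 1)) (\<lambda>(w, z). circ_int R js F (w(j := z)))"
        using g by (auto intro!: continuous_on_subset[OF c])
    qed
    then show ?thesis
      by (auto simp: o_def case_prod_unfold intro!: continuous_intros)
  qed
  from integral_continuous_on_param[OF this]
  show ?case
    by (simp add: contour_integral_integral vector_derivative_circlepath g_def)
qed simp

lemma circ_int_add: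
  assumes "R > 0" "continuous_on (polycircle R (K \<union> set js)) F" "continuous_on (polycircle R (K \<union> set js)) G"
    and "w \<in> polycircle R K"
  shows "circ_int R js (\<lambda>w. F w + G w) w = circ_int R js F w + circ_int R js G w"
  using assms(2-4)
proof (induction js arbitrary: K w)
  case (Cons j js)
  have eq: "circ_int R js (\<lambda>w. F w + G w) (w(j := z)) = circ_int R js F (w(j := z)) + circ_int R js G (w(j := z))"
    if "norm z = R" for z
    by (rule Cons.IH[of "insert j K"]) (use Cons.prems that in \<open>auto simp: polycircle_def\<close>)
  have c: "continuous_on (sphere 0 R) (\<lambda>z. circ_int R js H (w(j := z)))"
    if "continuous_on (polycircle R (K \<union> set (j # js))) H" for H
    by (rule continuous_on_slice1[OF \<open>R > 0\<close> continuous_on_circ_int]) (use that \<open>R > 0\<close> Cons.prems in auto)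
  have "circ_int R (j # js) (\<lambda>w. F w + G w) w =
    contour_integral (circlepath 0 R) (\<lambda>z. circ_int R js F (w(j := z)) + circ_int R js G (w(j := z)))"
    using eq \<open>R > 0\<close> by (auto intro!: contour_integral_eq)
  also have "\<dots> = circ_int R (j # js) F w + circ_int R (j # js) G w"
    using c Cons.prems \<open>R > 0\<close> by (auto intro!: contour_integral_add contour_integrable_continuous_circlepath)
  finally show ?case .
qed simp

lemma circ_int_cmult:
  assumes "R > 0" "continuous_on (polycircle R (K \<union> set js)) F" and "w \<in> polycircle R K"
  shows "circ_int R js (\<lambda>w. c * F w) w = c * circ_int R js F w"
  using assms(2-)
proof (induction js arbitrary: K w)
  case (Cons j js)
  have eq: "circ_int R js (\<lambda>w. c * F w) (w(j := z)) = c * circ_int R js F (w(j := z))"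
    if "norm z = R" for z
    by (rule Cons.IH[of "insert j K"]) (use Cons.prems that in \<open>auto simp: polycircle_def\<close>)
  have "continuous_on (sphere 0 R) (\<lambda>z. circ_int R js F (w(j := z)))"
    by (rule continuous_on_slice1[OF \<open>R > 0\<close> continuous_on_circ_int]) (use \<open>R > 0\<close> Cons.prems in auto)
  then have "contour_integral (circlepath 0 R) (\<lambda>z. c * circ_int R js F (w(j := z))) = c * circ_int R (j # js) F w"
    using \<open>R > 0\<close> by (auto intro!: contour_integral_lmul contour_integrable_continuous_circlepath)
  moreover have "circ_int R (j # js) (\<lambda>w. c * F w) w =
    contour_integral (circlepath 0 R) (\<lambda>z. c * circ_int R js F (w(j := z)))"
    using eq \<open>R > 0\<close> by (auto intro!: contour_integral_eq)
  ultimately show ?case by simp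
qed simp

lemma circ_int_0: "circ_int R js (\<lambda>w. 0) w = 0"
  by (induction js arbitrary: w) auto

lemma circ_int_sum:
  assumes "R > 0" "finite A" "\<And>a. a \<in> A \<Longrightarrow> continuous_on (polycircle R (K \<union> set js)) (F a)"
    and "w \<in> polycircle R K"
  shows "circ_int R js (\<lambda>w. \<Sum>a\<in>A. F a w) w = (\<Sum>a\<in>A. circ_int R js (F a) w)"
  using assms(2,3)
proof (induction A rule: finite_induct)
  case (insert a A)
  have "circ_int R js (\<lambda>w. F a w + (\<Sum>a\<in>A. F a w)) w = circ_int R js (F a) w + circ_int R js (\<lambda>w. \<Sum>a\<in>A. F a w) w"
    by (rule circ_int_add[OF \<open>R > 0\<close>]) (use insert assms in \<open>auto intro!: continuous_intros\<close>)
  then show ?case using insert by simp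
qed (simp add: circ_int_0)

lemma circ_int_bound:
  assumes "R > 0" "continuous_on (polycircle R (K \<union> set js)) F" and "w \<in> polycircle R K"
    and "\<And>w. w \<in> polycircle R (K \<union> set js) \<Longrightarrow> norm (F w) \<le> B" "B \<ge> 0"
  shows "norm (circ_int R js F w) \<le> B * (2 * pi * R) ^ length js"
  using assms(2-4)
proof (induction js arbitrary: K w)
  case (Cons j js)
  have "norm (circ_int R js F (w(j := z))) \<le> B * (2 * pi * R) ^ length js" if "norm z = R" for z
    by (rule Cons.IH[of "insert j K"]) (use Cons.prems that in \<open>auto simp: polycircle_def\<close>)
  moreover have "continuous_on (sphere 0 R) (\<lambda>z. circ_int R js F (w(j := z)))"
    by (rule continuous_on_slice1[OF \<open>R > 0\<close> continuous_on_circ_int]) (use \<open>R > 0\<close> Cons.prems in auto)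
  then have "((\<lambda>z. circ_int R js F (w(j := z))) has_contour_integral circ_int R (j # js) F w) (circlepath 0 R)"
    using \<open>R > 0\<close> by (auto intro!: has_contour_integral_integral contour_integrable_continuous_circlepath)
  ultimately have "norm (circ_int R (j # js) F w) \<le> B * (2 * pi * R) ^ length js * (2 * pi * R)"
    using \<open>R > 0\<close> \<open>B \<ge> 0\<close> by (intro has_contour_integral_bound_circlepath) auto
  then show ?case by (simp add: mult_ac)
qed simp

section \<open>Reordering and renaming the integration variables\<close>

lemma circ_int_append: "circ_int R (js @ ks) F = circ_int R js (circ_int R ks F)"
proof
  show "circ_int R (js @ ks) F w = circ_int R js (circ_int R ks F) w" for w
    by (induction js arbitrary: w) simp_all
qed

lemma circ_int_swap:
  assumes "R > 0" "i \<noteq> j" "continuous_on (polycircle R (insert i (insert j K))) F" "w \<in> polycircle R K"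
  shows "circ_int R [i, j] F w = circ_int R [j, i] F w"
proof -
  have c: "continuous_on (sphere 0 R \<times> sphere 0 R) (\<lambda>(y1, y2). F (w(i := y1, j := y2)))"
  proof -
    have "continuous_on (sphere 0 R \<times> sphere 0 R) (F \<circ> ((\<lambda>(w, z). w(j := z)) \<circ> (\<lambda>(y1, y2). (w(i := y1), y2))))"
    proof (intro continuous_on_compose)
      have "continuous_on (sphere 0 R \<times> sphere 0 R) ((\<lambda>(w, z). w(i := z)) \<circ> (\<lambda>p :: complex \<times> complex. (w, fst p)))"
        by (intro continuous_on_compose continuous_on_subset[OF continuous_on_fun_upd] continuous_intros) auto
      then show "continuous_on (sphere 0 R \<times> sphere 0 R) (\<lambda>(y1, y2 :: complex). (w(i := y1), y2))"
        by (auto simp: case_prod_unfold o_def intro!: continuous_intros)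
      show "continuous_on ((\<lambda>(y1, y2). (w(i := y1), y2)) ` (sphere 0 R \<times> sphere 0 R)) (\<lambda>(w, z). w(j := z))"
        by (rule continuous_on_subset[OF continuous_on_fun_upd]) auto
      show "continuous_on (((\<lambda>(w, z). w(j := z)) \<circ> (\<lambda>(y1, y2). (w(i := y1), y2))) ` (sphere 0 R \<times> sphere 0 R)) F"
        by (rule continuous_on_subset[OF assms(3)]) (use assms(4) in \<open>auto simp: polycircle_def\<close>)
    qed
    then show ?thesis by (simp add: o_def case_prod_unfold)
  qed
  have "contour_integral (circlepath 0 R) (\<lambda>y1. contour_integral (circlepath 0 R) (\<lambda>y2. F (w(i := y1, j := y2)))) =
     contour_integral (circlepath 0 R) (\<lambda>y2. contour_integral (circlepath 0 R) (\<lambda>y1. F (w(i := y1, j := y2))))"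
    by (rule contour_integral_swap)
       (use c \<open>R > 0\<close> in \<open>auto simp: vector_derivative_circlepath intro!: continuous_intros\<close>)
  moreover have "w(j := y2, i := y1) = w(i := y1, j := y2)" for y1 y2
    using \<open>i \<noteq> j\<close> by (rule fun_upd_twist[symmetric])
  ultimately show ?thesis
    by (simp only: iterated_contour_integral.simps)
qed

lemma circ_int_move_last:
  assumes "R > 0" "distinct (j # js)" "continuous_on (polycircle R (K \<union> set (j # js))) F" "w \<in> polycircle R K"
  shows "circ_int R (j # js) F w = circ_int R (js @ [j]) F w"
  using assms(2-4)
proof (induction js arbitrary: K w)
  case (Cons i js)
  have c: "continuous_on (polycircle R (insert j (insert i K))) (circ_int R js F)"
    by (rule continuous_on_circ_int[OF \<open>R > 0\<close>]) (use Cons.prems in \<open>auto simp: insert_commute\<close>)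
  have "circ_int R (j # i # js) F w = circ_int R [j, i] (circ_int R js F) w"
    by simp
  also have "\<dots> = circ_int R [i, j] (circ_int R js F) w"
    by (rule circ_int_swap[OF \<open>R > 0\<close> _ c]) (use Cons.prems in auto)
  also have "\<dots> = circ_int R [i] (circ_int R (j # js) F) w"
    by simp
  also have "\<dots> = circ_int R [i] (circ_int R (js @ [j]) F) w"
  proof (rule circ_int_cong[OF \<open>R > 0\<close> _ Cons.prems(3)])
    fix w assume "w \<in> polycircle R (K \<union> set [i])"
    then show "circ_int R (j # js) F w = circ_int R (js @ [j]) F w"
      by (intro Cons.IH[of "insert i K"]) (use Cons.prems in \<open>auto simp: insert_commute\<close>)
  qed
  also have "\<dots> = circ_int R ((i # js) @ [j]) F w"
    by simp
  finally have X: "circ_int R (j # i # js) F w = circ_int R ((i # js) @ [j]) F w" .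
  show ?case by (fact X)
qed (simp only: append_Nil)

lemma circ_int_extract:
  assumes "R > 0" "distinct (js @ j # ks)" "continuous_on (polycircle R (K \<union> set (js @ j # ks))) F" "w \<in> polycircle R K"
  shows "circ_int R (js @ j # ks) F w = circ_int R (js @ ks @ [j]) F w"
proof -
  have "circ_int R js (circ_int R (j # ks) F) w = circ_int R js (circ_int R (ks @ [j]) F) w"
  proof (rule circ_int_cong[OF \<open>R > 0\<close> _ assms(4)])
    fix w assume w: "w \<in> polycircle R (K \<union> set js)"
    show "circ_int R (j # ks) F w = circ_int R (ks @ [j]) F w"
      by (rule circ_int_move_last[OF \<open>R > 0\<close> _ _ w]) (use assms in \<open>auto simp: Un_assoc\<close>)
  qed
  then show ?thesis unfolding circ_int_append .
qed

text \<open>Fubini makes any variable the innermost one, so that Cauchy's theorem can be applied to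
  whichever coordinate has no poles on one side of the contour.\<close>

lemma circ_int_eq_0:
  assumes "R > 0" "distinct js" "j \<in> set js" "continuous_on (polycircle R (set js)) F"
    and "\<And>w. w \<in> polycircle R (set js - {j}) \<Longrightarrow> contour_integral (circlepath 0 R) (\<lambda>z. F (w(j := z))) = 0"
  shows "circ_int R js F w = 0"
proof -
  obtain as bs where js: "js = as @ j # bs"
    using split_list[OF assms(3)] by metis
  have "circ_int R js F w = circ_int R ((as @ bs) @ [j]) F w"
    unfolding js append_assoc
    by (rule circ_int_extract[OF \<open>R > 0\<close>, where K = "{}"]) (use assms js in auto)
  also have "\<dots> = circ_int R (as @ bs) (\<lambda>w. circ_int R [j] F w) w"
    unfolding circ_int_append ..
  also have "\<dots> = circ_int R (as @ bs) (\<lambda>w. 0) w"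
  proof (rule circ_int_cong[OF \<open>R > 0\<close>, of "{}"])
    fix w assume "w \<in> polycircle R ({} \<union> set (as @ bs))"
    moreover have "set js - {j} = set (as @ bs)"
      using js assms(2) by auto
    ultimately show "circ_int R [j] F w = 0"
      using assms(5) by auto
  qed auto
  finally show ?thesis by (simp add: circ_int_0)
qed

text \<open>A pure renaming of variables: it holds for every integrand but permutes the order of
  integration. Continuity enters only when that order is restored.\<close>

lemma circ_int_transpose:
  "circ_int R js (\<lambda>w. F (w \<circ> Transposition.transpose i j)) w =
   circ_int R (map (Transposition.transpose i j) js) F (w \<circ> Transposition.transpose i j)"
proof (induction js arbitrary: w)
  case (Cons k js)
  have "(w(k := z)) \<circ> Transposition.transpose i j = (w \<circ> Transposition.transpose i j)(Transposition.transpose i j k := z)" for z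
    by (auto simp: fun_eq_iff transpose_def)
  then show ?case
    by (simp only: iterated_contour_integral.simps list.map Cons.IH)
qed simp

text \<open>The contours coincide, so exchanging two neighbouring variables amounts to exchanging
  two neighbouring integrals, and Fubini undoes this.\<close>

lemma circ_int_transpose_adjacent:
  assumes "R > 0" "i \<in> {1..<n}" "continuous_on (polycircle R {1..n}) F"
  shows "circ_int R [1..<Suc n] (\<lambda>w. F (w \<circ> Transposition.transpose i (Suc i))) w =
    circ_int R [1..<Suc n] F (w \<circ> Transposition.transpose i (Suc i))"
proof -
  let ?s = "Transposition.transpose i (Suc i)"
  have js: "[1..<Suc n] = [1..<i] @ [i, Suc i] @ [Suc (Suc i)..<Suc n]"
    by (intro nth_equalityI) (use assms in \<open>auto simp: nth_append nth_Cons less_Suc_eq split: nat.splits\<close>)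
  have map_js: "map ?s [1..<Suc n] = [1..<i] @ [Suc i, i] @ [Suc (Suc i)..<Suc n]"
    unfolding js by (auto simp: Transposition.transpose_def intro!: map_idI)
  have "circ_int R [1..<Suc n] (\<lambda>w. F (w \<circ> ?s)) w = circ_int R (map ?s [1..<Suc n]) F (w \<circ> ?s)"
    by (rule circ_int_transpose)
  also have "\<dots> = circ_int R [1..<i] (circ_int R [Suc i, i] (circ_int R [Suc (Suc i)..<Suc n] F)) (w \<circ> ?s)"
    unfolding map_js by (simp only: circ_int_append)
  also have "\<dots> = circ_int R [1..<i] (circ_int R [i, Suc i] (circ_int R [Suc (Suc i)..<Suc n] F)) (w \<circ> ?s)"
  proof (rule circ_int_cong[OF \<open>R > 0\<close>, of "{}"])
    fix w assume w: "w \<in> polycircle R ({} \<union> set [1..<i])"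
    have "insert (Suc i) (insert i {1..<i}) \<union> set [Suc (Suc i)..<Suc n] = {1..n}"
      using assms(2) by auto
    then have "continuous_on (polycircle R (insert (Suc i) (insert i {1..<i}))) (circ_int R [Suc (Suc i)..<Suc n] F)"
      using continuous_on_circ_int[OF \<open>R > 0\<close>, of "insert (Suc i) (insert i {1..<i})" "[Suc (Suc i)..<Suc n]" F] assms(3)
      by simp
    then show "circ_int R [Suc i, i] (circ_int R [Suc (Suc i)..<Suc n] F) w =
       circ_int R [i, Suc i] (circ_int R [Suc (Suc i)..<Suc n] F) w"
      by (intro circ_int_swap[OF \<open>R > 0\<close>]) (use w in auto)
  qed auto
  also have "\<dots> = circ_int R [1..<Suc n] F (w \<circ> ?s)"
    unfolding js by (simp only: circ_int_append)
  finally show ?thesis .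
qed

section \<open>Evaluating a contour integral through the exterior or the interior of the
  circle\<close>

lemma contour_integral_circlepath_exterior:
  fixes f g :: "complex \<Rightarrow> complex"
  assumes "R > 0" "g holomorphic_on cball 0 (1/R)" "\<And>z. norm z = R \<Longrightarrow> f z = g (1/z) / z"
  shows "contour_integral (circlepath 0 R) f = 2 * of_real pi * \<i> * g 0"
proof -
  \<comment> \<open>Substituting \<open>u = 1/z\<close> gives \<open>dz/z = - du/u\<close>, and
    inversion also reverses the orientation of the circle. The two signs cancel, and Cauchy's
    formula at \<open>u = 0\<close> yields the contribution of infinity.\<close>
  have "((\<lambda>u. g u / (u - 0)) has_contour_integral (2 * of_real pi * \<i> * g 0)) (circlepath 0 (1/R))"
    by (rule Cauchy_integral_circlepath_simple) (use assms in auto)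
  then have 1: "((\<lambda>x. 2 * of_real pi * \<i> * g (circlepath 0 (1/R) x)) has_integral (2 * of_real pi * \<i> * g 0)) {0..1}"
    unfolding has_contour_integral_def
  proof (rule has_integral_eq[rotated])
    fix x :: real assume "x \<in> {0..1}"
    then have "0 \<le> x" "x \<le> 1" by auto
    from vector_derivative_circlepath01[OF this, of 0 "1/R"]
    show "g (circlepath 0 (1/R) x) / (circlepath 0 (1/R) x - 0) * vector_derivative (circlepath 0 (1/R)) (at x within {0..1}) =
      2 * of_real pi * \<i> * g (circlepath 0 (1/R) x)"
      using \<open>R > 0\<close> by (simp add: circlepath)
  qed
  \<comment> \<open>Running backwards through the circle of radius \<open>1/R\<close> matches it
    point by point with \<open>1/z\<close> on the circle of radius \<open>R\<close>.\<close>
  have 2: "((\<lambda>x. 2 * of_real pi * \<i> * g (circlepath 0 (1/R) (1 - x))) has_integral (2 * of_real pi * \<i> * g 0)) {0..1}"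
    using has_integral_affinity[OF 1[unfolded box_real[symmetric]], of "-1" 1]
    by (simp add: image_affinity_atLeastAtMost_diff)
  have "(f has_contour_integral (2 * of_real pi * \<i> * g 0)) (circlepath 0 R)"
    unfolding has_contour_integral_def
  proof (rule has_integral_eq[OF _ 2])
    fix x :: real assume x: "x \<in> {0..1}"
    define e where "e = exp (2 * of_real pi * \<i> * of_real x)"
    have "e \<noteq> 0" "norm e = 1"
      by (auto simp: e_def)
    have 1: "circlepath 0 R x = of_real R * e"
      by (simp add: circlepath e_def)
    have "exp (2 * of_real pi * \<i> * of_real (1 - x)) = 1 / e"
      by (simp add: e_def right_diff_distrib exp_diff exp_two_pi_i)
    then have 2: "circlepath 0 (1/R) (1 - x) = 1 / (of_real R * e)"
      by (simp only: circlepath) simp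
    have 3: "vector_derivative (circlepath 0 R) (at x within {0..1}) = 2 * of_real pi * \<i> * R * e"
      using vector_derivative_circlepath01[of x 0 R] x by (simp add: e_def)
    have 4: "f (of_real R * e) = g (1 / (of_real R * e)) / (of_real R * e)"
      by (rule assms(3)) (use \<open>R > 0\<close> \<open>norm e = 1\<close> in \<open>simp add: norm_mult\<close>)
    show "2 * of_real pi * \<i> * g (circlepath 0 (1/R) (1 - x)) = f (circlepath 0 R x) * vector_derivative (circlepath 0 R) (at x within {0..1})"
      unfolding 1 2 3 4 using \<open>R > 0\<close> \<open>e \<noteq> 0\<close> by simp
  qed
  then show ?thesis by (rule contour_integral_unique)
qed

lemma contour_integral_circlepath_interior:
  assumes "R > 0" "f holomorphic_on cball 0 R"
  shows "contour_integral (circlepath 0 R) f = 0"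
proof -
  have "f holomorphic_on cball 0 R"
    by (simp add: assms)
  \<comment> \<open>Cauchy's integral theorem in the form of Cauchy's formula at the centre:
    \<open>f z * z\<close> vanishes at 0.\<close>
  then have "(\<lambda>z. f z * z) holomorphic_on cball 0 R"
    by (intro holomorphic_intros)
  from Cauchy_integral_circlepath_simple[OF this, of 0] \<open>R > 0\<close>
  have "((\<lambda>u. f u * u / u) has_contour_integral 0) (circlepath 0 R)"
    by simp
  then have "(f has_contour_integral 0) (circlepath 0 R)"
    by (rule has_contour_integral_eq) (use \<open>R > 0\<close> in auto)
  then show ?thesis by (rule contour_integral_unique)
qed

section \<open>The time derivative of an iterated integral\<close>

lemma has_vector_derivative_quadratic:
  fixes f :: "real \<Rightarrow> 'a::real_normed_vector"
  assumes "\<And>h. \<bar>h\<bar> \<le> 1 \<Longrightarrow> norm (f (t + h) - f t - h *\<^sub>R d) \<le> C * h\<^sup>2"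
  shows "(f has_vector_derivative d) (at t)"
  unfolding has_vector_derivative_def
proof (rule has_derivativeI_sandwich[of 1])
  fix s assume s: "s \<noteq> t" "dist s t < 1"
  then have "norm (f s - f t - (s - t) *\<^sub>R d) \<le> C * (s - t)\<^sup>2"
    using assms[of "s - t"] by (simp add: dist_real_def)
  also have "C * (s - t)\<^sup>2 = C * \<bar>s - t\<bar> * \<bar>s - t\<bar>"
    by (simp add: power2_eq_square)
  finally show "norm (f s - f t - (s - t) *\<^sub>R d) / norm (s - t) \<le> C * \<bar>s - t\<bar>"
    using s by (simp add: pos_divide_le_eq)
next
  have "((\<lambda>s. C * \<bar>s - t\<bar>) \<longlongrightarrow> C * \<bar>t - t\<bar>) (at t)"
    by (intro tendsto_intros)
  then show "((\<lambda>s. C * \<bar>s - t\<bar>) \<longlongrightarrow> 0) (at t)" by simp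
qed (auto intro: bounded_linear_scaleR_left)

text \<open>Rather than interchanging derivative and integrals one by one, the first-order Taylor
  remainder of \<open>exp\<close> is bounded uniformly on the polycircle, where the norm of
  \<open>s\<close> is at most \<open>L\<close>, and this bound is integrated.\<close>

lemma circ_int_exp_derivative:
  assumes "R > 0" and F: "continuous_on (polycircle R (set js)) F"
    and B: "\<And>w. w \<in> polycircle R (set js) \<Longrightarrow> norm (F w) \<le> B"
  defines "s \<equiv> \<lambda>w. \<Sum>j\<in>set js. w j :: complex"
  shows "((\<lambda>t. circ_int R js (\<lambda>w. F w * exp (- s w * of_real t)) w0) has_vector_derivative
    circ_int R js (\<lambda>w. - s w * (F w * exp (- s w * of_real t))) w0) (at t)"
proof -
  define L where "L = real (card (set js)) * R"
  have L: "norm (s w) \<le> L" if "w \<in> polycircle R (set js)" for w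
    unfolding s_def L_def using that by (intro sum_norm_bound) (auto simp: polycircle_def)
  have s: "continuous_on (polycircle R (set js)) s"
    unfolding s_def by (intro continuous_intros)
  have cont: "continuous_on (polycircle R ({} \<union> set js)) (\<lambda>w. F w * exp (- s w * of_real t))" for t
    using F s by (auto intro!: continuous_intros)
  have cont': "continuous_on (polycircle R ({} \<union> set js)) (\<lambda>w. - s w * (F w * exp (- s w * of_real t)))" for t
    using F s by (auto intro!: continuous_intros)
  have w0: "w0 \<in> polycircle R {}" by simp
  show ?thesis
  proof (rule has_vector_derivative_quadratic)
    fix h :: real assume h: "\<bar>h\<bar> \<le> 1"
    let ?G = "\<lambda>t w. F w * exp (- s w * of_real t)" and ?G' = "\<lambda>w. - s w * (F w * exp (- s w * of_real t))"
    have "circ_int R js (\<lambda>w. ?G (t + h) w + ((- 1) * ?G t w + (- of_real h) * ?G' w)) w0 =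
       circ_int R js (?G (t + h)) w0 + circ_int R js (\<lambda>w. (- 1) * ?G t w + (- of_real h) * ?G' w) w0"
      by (rule circ_int_add[OF \<open>R > 0\<close> cont _ w0]) (intro continuous_intros cont cont')
    also have "circ_int R js (\<lambda>w. (- 1) * ?G t w + (- of_real h) * ?G' w) w0 =
       circ_int R js (\<lambda>w. (- 1) * ?G t w) w0 + circ_int R js (\<lambda>w. (- of_real h) * ?G' w) w0"
      by (rule circ_int_add[OF \<open>R > 0\<close> _ _ w0]) (intro continuous_intros cont cont')+
    also have "circ_int R js (\<lambda>w. (- 1) * ?G t w) w0 = - 1 * circ_int R js (?G t) w0"
      by (rule circ_int_cmult[OF \<open>R > 0\<close> cont w0])
    also have "circ_int R js (\<lambda>w. (- of_real h) * ?G' w) w0 = - of_real h * circ_int R js ?G' w0"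
      by (rule circ_int_cmult[OF \<open>R > 0\<close> cont' w0])
    finally have eq: "circ_int R js (?G (t + h)) w0 - circ_int R js (?G t) w0 - h *\<^sub>R circ_int R js ?G' w0 =
      circ_int R js (\<lambda>w. ?G (t + h) w + ((- 1) * ?G t w + (- of_real h) * ?G' w)) w0"
      by (simp add: scaleR_conv_of_real)
    \<comment> \<open>\<open>B\<close> bounds \<open>F\<close>,
      \<open>exp (L * \<bar>t\<bar>)\<close> bounds the exponential at time \<open>t\<close>, and
      \<open>exp L * L\<^sup>2\<close> bounds the Taylor remainder per \<open>h\<^sup>2\<close>
      because \<open>\<bar>h\<bar> \<le> 1\<close>. The absolute value makes the constant
      nonnegative, as \<open>circ_int_bound\<close> requires.\<close>
    let ?C = "\<bar>B\<bar> * (exp (L * \<bar>t\<bar>) * (exp L * L\<^sup>2))"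
    have "norm (circ_int R js (\<lambda>w. ?G (t + h) w + ((- 1) * ?G t w + (- of_real h) * ?G' w)) w0) \<le>
      (?C * h\<^sup>2) * (2 * pi * R) ^ length js"
    proof (rule circ_int_bound[OF \<open>R > 0\<close> _ w0])
      fix w assume "w \<in> polycircle R ({} \<union> set js)"
      then have w: "w \<in> polycircle R (set js)" by simp
      define x where "x = - s w * of_real h"
      have nx: "norm x \<le> L * \<bar>h\<bar>"
        using L[OF w] by (simp add: x_def norm_mult mult_right_mono)
      have L0: "L \<ge> 0" using L[OF w] norm_ge_zero order_trans by blast
      have "norm (exp x - 1 - x) \<le> exp \<bar>Re x\<bar> * norm x ^ 2"
        using Taylor_exp[of x 1] by (simp add: numeral_2_eq_2 algebra_simps)
      also have "\<dots> \<le> exp L * (L * \<bar>h\<bar>) ^ 2"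
      proof (intro mult_mono power_mono nx)
        have "\<bar>Re x\<bar> \<le> L * \<bar>h\<bar>" using abs_Re_le_cmod[of x] nx by simp
        also have "\<dots> \<le> L * 1" using h L0 by (intro mult_left_mono) auto
        finally show "exp \<bar>Re x\<bar> \<le> exp L" by simp
      qed auto
      finally have 1: "norm (exp x - 1 - x) \<le> exp L * L\<^sup>2 * h\<^sup>2" by (simp add: power_mult_distrib)
      have "Re (- s w * of_real t) \<le> norm (- s w * of_real t)" by (rule complex_Re_le_cmod)
      also have "\<dots> \<le> L * \<bar>t\<bar>" using L[OF w] by (simp add: norm_mult mult_right_mono)
      finally have 2: "norm (exp (- s w * of_real t)) \<le> exp (L * \<bar>t\<bar>)" by simp
      have "exp (- s w * of_real (t + h)) = exp (- s w * of_real t) * exp x"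
        by (simp add: x_def algebra_simps flip: exp_add)
      then have "?G (t + h) w + ((- 1) * ?G t w + (- of_real h) * ?G' w) = F w * (exp (- s w * of_real t) * (exp x - 1 - x))"
        by (simp add: x_def algebra_simps)
      also have "norm \<dots> \<le> \<bar>B\<bar> * (exp (L * \<bar>t\<bar>) * (exp L * L\<^sup>2 * h\<^sup>2))"
        unfolding norm_mult using B[OF w] 1 2 by (intro mult_mono) auto
      finally show "norm (?G (t + h) w + ((- 1) * ?G t w + (- of_real h) * ?G' w)) \<le> ?C * h\<^sup>2"
        by (simp add: mult_ac)
    qed (use F s in \<open>auto intro!: continuous_intros\<close>)
    then show "norm (circ_int R js (?G (t + h)) w0 - circ_int R js (?G t) w0 - h *\<^sub>R circ_int R js ?G' w0) \<le>
      (?C * (2 * pi * R) ^ length js) * h\<^sup>2"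
      unfolding eq by (simp add: mult_ac)
  qed
qed

section \<open>Chains whose jumps raise a grading by one\<close>

text \<open>The probability that consecutive independent exponential clocks with the given rates have
  all rung by time \<open>t\<close> except for the last one.\<close>

fun hold :: "real list \<Rightarrow> real \<Rightarrow> real" where
  "hold [] t = 0"
| "hold [l] t = exp (- l * t)"
| "hold (l # l' # ls) t = l * exp (- l * t) * integral {0..t} (\<lambda>s. exp (l * s) * hold (l' # ls) s)"

text \<open>\<open>hold\<close> is the variation-of-constants solution of
  \<open>h' = - l * h + l * hold (l' # ls)\<close> with value 0 at time 0. The two claims are
  intertwined: the derivative needs continuity for the shorter list, and continuity for the longer
  list follows from the derivative.\<close>

lemma hold_has_derivative:
  "continuous_on {0..T} (hold ls)"
  "t \<in> {0..T} \<Longrightarrow> (hold (l # l' # ls) has_real_derivative (- l * hold (l # l' # ls) t + l * hold (l' # ls) t)) (at t within {0..T})"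
proof -
  have D: "(hold (l # l' # ls) has_real_derivative (- l * hold (l # l' # ls) t + l * hold (l' # ls) t)) (at t within {0..T})"
    if c: "continuous_on {0..T} (hold (l' # ls))" and t: "t \<in> {0..T}" for l l' ls t
  proof -
    have "continuous_on {0..T} (\<lambda>s. exp (l * s) * hold (l' # ls) s)"
      by (intro continuous_intros c)
    note d = integral_has_real_derivative[OF this t]
    have "((\<lambda>t. l * exp (- l * t) * integral {0..t} (\<lambda>s. exp (l * s) * hold (l' # ls) s)) has_real_derivative
       (l * exp (- l * t) * (- l)) * integral {0..t} (\<lambda>s. exp (l * s) * hold (l' # ls) s) +
       (exp (l * t) * hold (l' # ls) t) * (l * exp (- l * t))) (at t within {0..T})"
      by (rule DERIV_mult[OF _ d]) (auto intro!: derivative_eq_intros)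
    moreover have "exp (l * t) * h * (l * exp (- l * t)) = l * h" for h
      by (simp add: exp_minus)
    moreover have "l * exp (- l * t) * - l * h = - l * (l * exp (- l * t) * h)" for h
      by simp
    ultimately show ?thesis
      unfolding hold.simps(3)
      by (simp only:)
  qed
  show c: "continuous_on {0..T} (hold ls)" for ls
  proof (induction ls rule: hold.induct[where P = "\<lambda>ls t. continuous_on {0..T} (hold ls)"])
    case (3 l l' ls t)
    then show ?case
      by (intro DERIV_continuous_on[OF D]) auto
  qed (auto intro!: continuous_intros)
  show "t \<in> {0..T} \<Longrightarrow> (hold (l # l' # ls) has_real_derivative (- l * hold (l # l' # ls) t + l * hold (l' # ls) t)) (at t within {0..T})"
    by (rule D[OF c])
qed

lemma hold_nonneg: "\<forall>l\<in>set ls. l > 0 \<Longrightarrow> t \<ge> 0 \<Longrightarrow> hold ls t \<ge> 0"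
proof (induction ls t rule: hold.induct)
  case (3 l l' ls t)
  have "continuous_on {0..t} (\<lambda>s. exp (l * s) * hold (l' # ls) s)"
    by (intro continuous_intros hold_has_derivative)
  then have "integral {0..t} (\<lambda>s. exp (l * s) * hold (l' # ls) s) \<ge> 0"
    using 3 by (intro integral_nonneg integrable_continuous_real) auto
  then show ?case
    using 3 by (simp add: mult_nonneg_nonneg)
qed auto

lemma hold_measurable: "(\<lambda>t. indicator {0..} t * hold ls t) \<in> borel_measurable borel"
proof -
  have "continuous_on {0..} (hold ls)"
  proof (rule continuous_on_eq_continuous_within[THEN iffD2], rule ballI)
    fix t :: real assume t: "t \<in> {0..}"
    have "continuous (at t within {0..t+1}) (hold ls)"
      using hold_has_derivative(1)[of "t+1" ls] t by (auto simp: continuous_on_eq_continuous_within)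
    moreover have "at t within {0..} = at t within {0..t+1}"
      by (rule at_within_nhd[of _ "{..<t+1}"]) auto
    ultimately show "continuous (at t within {0..}) (hold ls)"
      by simp
  qed
  then show ?thesis
    using borel_measurable_continuous_on_indicator[of "{0..}" "hold ls"] by simp
qed

lemma emeasure_exponential_greaterThan:
  assumes "l > 0" "t \<ge> 0"
  shows "emeasure (density lborel (exponential_density l)) {t<..} = ennreal (exp (- l * t))"
proof -
  interpret prob_space "density lborel (exponential_density l)"
    by (rule prob_space_exponential_density) fact
  have "emeasure (density lborel (exponential_density l)) {..t} = ennreal (1 - exp (- l * t))"
    using assms by (simp add: emeasure_erlang_density erlang_CDF_0)
  then have "prob {..t} = 1 - exp (- l * t)"
    using assms by (simp add: measure_def)
  moreover have "prob (space (density lborel (exponential_density l)) - {..t}) = 1 - prob {..t}"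
    by (rule prob_compl) simp
  moreover have "space (density lborel (exponential_density l)) - {..t} = {t<..}"
    by auto
  ultimately show ?thesis
    by (simp add: emeasure_eq_measure)
qed

text \<open>Backward induction on the first clock \<open>i\<close>: given that it rings at
  \<open>y\<close>, the remaining clocks must satisfy the event \<open>D (Suc i) (t - y)\<close>.
  Integrating over \<open>y\<close> gives the convolution that defines \<open>hold\<close>. The
  indicator covers the negative times \<open>t - y\<close> that arise on the way.\<close>

lemma emeasure_PiM_exponential_hold:
  fixes l :: "nat \<Rightarrow> real"
  assumes l: "\<And>i. l i > 0" and "i \<le> m"
  defines "\<mu> \<equiv> \<lambda>i. density lborel (exponential_density (l i))"
  defines "D \<equiv> \<lambda>i t. {s \<in> space (PiM {i..m} (\<lambda>_. borel :: real measure)). (\<Sum>j=i..<m. s j) \<le> t \<and> t < (\<Sum>j=i..m. s j)}"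
  shows "emeasure (PiM {i..m} \<mu>) (D i t) = ennreal (indicator {0..} t * hold (map l [i..<Suc m]) t)"
  using \<open>i \<le> m\<close>
proof (induction i arbitrary: t rule: inc_induct)
  interpret \<mu>: product_prob_space \<mu>
    by (rule product_prob_spaceI) (auto simp: \<mu>_def intro!: prob_space_exponential_density l)
  have sets_PiM[measurable_cong]: "sets (PiM I \<mu>) = sets (PiM I (\<lambda>_. borel))" for I
    by (intro sets_PiM_cong) (auto simp: \<mu>_def)
  have [measurable_cong]: "sets (\<mu> i) = sets borel" for i by (simp add: \<mu>_def)
  have [measurable]: "D i t \<in> sets (PiM {i..m} \<mu>)" for i t
    unfolding D_def sets_PiM by measurable
  case base
  have D: "indicator (D m t) x = (if t \<ge> 0 then indicator {t<..} (x m) else 0 :: ennreal)"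
    if "x \<in> space (PiM {m} \<mu>)" for x
    using that by (auto simp: D_def space_PiM \<mu>_def indicator_def)
  have "emeasure (PiM {m..m} \<mu>) (D m t) = (\<integral>\<^sup>+x. indicator (D m t) x \<partial>PiM {m..m} \<mu>)"
    by (rule nn_integral_indicator[symmetric]) measurable
  also have "\<dots> = (\<integral>\<^sup>+x. (if t \<ge> 0 then indicator {t<..} (x m) else 0) \<partial>PiM {m} \<mu>)"
    unfolding atLeastAtMost_singleton by (intro nn_integral_cong D)
  also have "\<dots> = (\<integral>\<^sup>+x. (if t \<ge> 0 then indicator {t<..} x else 0) \<partial>\<mu> m)"
    by (rule \<mu>.product_nn_integral_singleton) simp
  also have "\<dots> = ennreal (indicator {0..} t * hold (map l [m..<Suc m]) t)"
    using emeasure_exponential_greaterThan[OF l, of t m]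
    by (cases "t \<ge> 0") (simp_all add: \<mu>_def)
  finally show ?case .
next
  interpret \<mu>: product_prob_space \<mu>
    by (rule product_prob_spaceI) (auto simp: \<mu>_def intro!: prob_space_exponential_density l)
  have sets_PiM[measurable_cong]: "sets (PiM I \<mu>) = sets (PiM I (\<lambda>_. borel))" for I
    by (intro sets_PiM_cong) (auto simp: \<mu>_def)
  have [measurable_cong]: "sets (\<mu> i) = sets borel" for i by (simp add: \<mu>_def)
  have Dm[measurable]: "D i t \<in> sets (PiM {i..m} \<mu>)" for i t
    unfolding D_def sets_PiM by measurable
  case (step i)
  define ls where "ls = map l [Suc i..<Suc m]"
  obtain l' ls' where ls: "ls = l' # ls'"
    using step by (cases ls) (auto simp: ls_def)
  have ins: "insert i {Suc i..m} = {i..m}" and up: "[i..<Suc m] = i # [Suc i..<Suc m]"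
    using step by (auto simp: upt_rec)
  have pos: "\<forall>l\<in>set ls. l > 0" using l by (auto simp: ls_def)
  have *: "indicator (D i t) (x(i := y)) = (indicator (D (Suc i) (t - y)) x :: ennreal)"
    if "x \<in> space (PiM {Suc i..m} \<mu>)" for x y
  proof -
    have "(\<Sum>j=i..<m. (x(i := y)) j) = y + (\<Sum>j=Suc i..<m. x j)"
      using step by (simp add: sum.atLeast_Suc_lessThan)
    moreover have "(\<Sum>j=i..m. (x(i := y)) j) = y + (\<Sum>j=Suc i..m. x j)"
      using step by (simp add: sum.atLeast_Suc_atMost)
    moreover have "x(i := y) \<in> space (PiM {i..m} (\<lambda>_. borel :: real measure))" "x \<in> space (PiM {Suc i..m} (\<lambda>_. borel :: real measure))"
      using that step by (auto simp: space_PiM \<mu>_def PiE_iff extensional_def)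
    ultimately show ?thesis
      by (auto simp: D_def indicator_def algebra_simps)
  qed
  have "emeasure (PiM {i..m} \<mu>) (D i t) = (\<integral>\<^sup>+x. indicator (D i t) x \<partial>PiM (insert i {Suc i..m}) \<mu>)"
    by (simp add: ins)
  also have "\<dots> = (\<integral>\<^sup>+y. (\<integral>\<^sup>+x. indicator (D i t) (x(i := y)) \<partial>PiM {Suc i..m} \<mu>) \<partial>\<mu> i)"
    by (rule \<mu>.product_nn_integral_insert_rev) (auto simp: ins)
  also have "\<dots> = (\<integral>\<^sup>+y. (\<integral>\<^sup>+x. indicator (D (Suc i) (t - y)) x \<partial>PiM {Suc i..m} \<mu>) \<partial>\<mu> i)"
    by (intro nn_integral_cong *)
  also have "\<dots> = (\<integral>\<^sup>+y. ennreal (indicator {0..} (t - y) * hold ls (t - y)) \<partial>\<mu> i)"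
    by (simp add: step.IH ls_def)
  also have "\<dots> = (\<integral>\<^sup>+y. ennreal (exponential_density (l i) y) * ennreal (indicator {0..} (t - y) * hold ls (t - y)) \<partial>lborel)"
    unfolding \<mu>_def using hold_measurable[of ls] by (subst nn_integral_density) auto
  \<comment> \<open>The substitution \<open>s = t - y\<close> turns the convolution into the
    integral in the recursion for \<open>hold\<close>.\<close>
  also have "\<dots> = (\<integral>\<^sup>+s. ennreal (exponential_density (l i) (t - s)) * ennreal (indicator {0..} s * hold ls s) \<partial>lborel)"
    using nn_integral_real_affine[of "\<lambda>y. ennreal (exponential_density (l i) y) * ennreal (indicator {0..} (t - y) * hold ls (t - y))" "-1" t]
      hold_measurable[of ls] by auto
  also have "\<dots> = (\<integral>\<^sup>+s. indicator {0..t} s * (l i * exp (- l i * t) * (exp (l i * s) * hold ls s)) \<partial>lborel)"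
  proof (intro nn_integral_cong)
    fix s
    have "ennreal (exponential_density (l i) (t - s)) * ennreal (indicator {0..} s * hold ls s) =
       ennreal (exponential_density (l i) (t - s) * (indicator {0..} s * hold ls s))"
      using l[of i] by (intro ennreal_mult[symmetric]) (auto simp: indicator_def hold_nonneg[OF pos])
    also have "exponential_density (l i) (t - s) * (indicator {0..} s * hold ls s) =
      indicator {0..t} s * (l i * exp (- l i * t) * (exp (l i * s) * hold ls s))"
      by (auto simp: exponential_density_def indicator_def left_diff_distrib exp_diff exp_minus field_simps)
    finally show "ennreal (exponential_density (l i) (t - s)) * ennreal (indicator {0..} s * hold ls s) =
       ennreal (indicator {0..t} s * (l i * exp (- l i * t) * (exp (l i * s) * hold ls s)))" .
  qed
  also have "\<dots> = ennreal (integral {0..t} (\<lambda>s. l i * exp (- l i * t) * (exp (l i * s) * hold ls s)))"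
  proof (rule nn_integral_has_integral_lebesgue)
    show "((\<lambda>s. l i * exp (- l i * t) * (exp (l i * s) * hold ls s)) has_integral
       integral {0..t} (\<lambda>s. l i * exp (- l i * t) * (exp (l i * s) * hold ls s))) {0..t}"
      by (intro integrable_integral integrable_continuous_real continuous_intros hold_has_derivative)
    show "0 \<le> l i * exp (- l i * t) * (exp (l i * s) * hold ls s)" if "s \<in> {0..t}" for s
      using that l[of i] hold_nonneg[OF pos, of s] by simp
  qed
  also have "\<dots> = ennreal (indicator {0..} t * hold (map l [i..<Suc m]) t)"
    unfolding up list.map ls_def[symmetric] ls hold.simps by (auto simp: indicator_def)
  finally show ?case .
qed

section \<open>Finite jump paths and their weights\<close>

fun paths :: "('s \<Rightarrow> 's set) \<Rightarrow> nat \<Rightarrow> 's \<Rightarrow> 's list set" where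
  "paths succ 0 y = {[y]}"
| "paths succ (Suc m) y = (\<Union>y'\<in>succ y. (#) y ` paths succ m y')"

fun path_weight :: "('s \<Rightarrow> 's \<Rightarrow> real) \<Rightarrow> 's list \<Rightarrow> real" where
  "path_weight p (y # y' # zs) = p y y' * path_weight p (y' # zs)"
| "path_weight p zs = 1"

lemma paths_hd: "zs \<in> paths succ m y \<Longrightarrow> length zs = Suc m \<and> zs ! 0 = y \<and> zs \<noteq> []"
  by (induction m arbitrary: y zs) auto

lemma sum_paths_Suc:
  fixes y :: 'a
  assumes "finite (succ y)" "\<And>y'. y' \<in> succ y \<Longrightarrow> finite (paths succ m y')"
  shows "(\<Sum>zs\<in>paths succ (Suc m) y. g zs) = (\<Sum>y'\<in>succ y. \<Sum>zs\<in>paths succ m y'. g (y # zs))"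
proof -
  have "(\<Sum>zs\<in>paths succ (Suc m) y. g zs) = (\<Sum>y'\<in>succ y. \<Sum>zs\<in>(#) y ` paths succ m y'. g zs)"
    unfolding paths.simps
  proof (rule sum.UNION_disjoint)
    show "\<forall>y'\<in>succ y. \<forall>y''\<in>succ y. y' \<noteq> y'' \<longrightarrow> (#) y ` paths succ m y' \<inter> (#) y ` paths succ m y'' = {}"
    proof (intro ballI impI)
      fix y' y'' :: 'a assume "y' \<noteq> y''"
      then have "paths succ m y' \<inter> paths succ m y'' = {}"
        using paths_hd[of _ succ m y'] paths_hd[of _ succ m y''] by blast
      then show "(#) y ` paths succ m y' \<inter> (#) y ` paths succ m y'' = {}" by auto
    qed
  qed (use assms in auto)
  also have "\<dots> = (\<Sum>y'\<in>succ y. \<Sum>zs\<in>paths succ m y'. g (y # zs))"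
    by (rule sum.cong) (simp_all add: sum.reindex inj_on_def)
  finally show ?thesis .
qed

lemma path_weight_nth:
  "length zs = Suc m \<Longrightarrow> path_weight p zs = (\<Prod>i<m. p (zs ! i) (zs ! Suc i))"
proof (induction p zs arbitrary: m rule: path_weight.induct)
  case (1 p y y' zs)
  then obtain m' where m: "m = Suc m'" by (cases m) auto
  with 1 show ?case by (simp add: prod.lessThan_Suc_shift del: prod.lessThan_Suc)
qed auto

text \<open>\<open>succ y\<close> consists of the states reachable from \<open>y\<close> by one
  jump; it is finite, and nonempty so that exit rates are positive. Since \<open>f\<close> grows by
  exactly one per jump, the two end states determine the number of jumps between them, so the law at
  a fixed time is a finite sum over paths.\<close>

locale graded_chain =
  fixes M :: "'w measure" and E :: "'s set" and r :: "'s \<Rightarrow> 's \<Rightarrow> real" and y0 :: 's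
    and Z :: "nat \<Rightarrow> 'w \<Rightarrow> 's" and S :: "nat \<Rightarrow> 'w \<Rightarrow> real"
    and succ :: "'s \<Rightarrow> 's set" and f :: "'s \<Rightarrow> int"
  assumes chain: "jump_hold_chain M E r y0 Z S" and y0: "y0 \<in> E"
    and succ: "y \<in> E \<Longrightarrow> finite (succ y)" "y \<in> E \<Longrightarrow> succ y \<noteq> {}" "y \<in> E \<Longrightarrow> succ y \<subseteq> E"
    and r_pos: "y \<in> E \<Longrightarrow> y' \<in> succ y \<Longrightarrow> r y y' > 0"
    and r_zero: "y \<in> E \<Longrightarrow> y' \<in> E - {y} - succ y \<Longrightarrow> r y y' = 0"
    and f_succ: "y \<in> E \<Longrightarrow> y' \<in> succ y \<Longrightarrow> f y' = f y + 1"
begin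

sublocale prob_space M
  using chain by (simp add: jump_hold_chain_def)

abbreviation rt :: "'s \<Rightarrow> real" where "rt \<equiv> exit_rate E r"

lemma succ_in_E: "y \<in> E \<Longrightarrow> y' \<in> succ y \<Longrightarrow> y' \<in> E"
  using succ(3) by blast

lemma exit_rate_eq: assumes "y \<in> E" shows "rt y = (\<Sum>y'\<in>succ y. r y y')"
proof -
  have "y \<notin> succ y" using f_succ[OF assms] by fastforce
  then have "rt y = infsum (r y) (succ y)"
    unfolding exit_rate_def
    by (intro infsum_cong_neutral) (use assms succ(3) r_zero in auto)
  then show ?thesis using succ(1)[OF assms] by simp
qed

lemma exit_rate_pos: "y \<in> E \<Longrightarrow> rt y > 0"
  unfolding exit_rate_eq by (intro sum_pos succ r_pos)

definition jump_prob :: "'s \<Rightarrow> 's \<Rightarrow> real" where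
  "jump_prob y y' = (if y' = y then 0 else r y y' / rt y)"

lemma jump_prob_succ: "y \<in> E \<Longrightarrow> y' \<in> succ y \<Longrightarrow> jump_prob y y' = r y y' / rt y"
  using f_succ[of y y'] by (auto simp: jump_prob_def)

lemma finite_paths: "y \<in> E \<Longrightarrow> finite (paths succ m y)"
  by (induction m arbitrary: y) (auto simp: succ(1) intro!: finite_imageI dest: succ_in_E)

lemma paths_in_E: "y \<in> E \<Longrightarrow> zs \<in> paths succ m y \<Longrightarrow> set zs \<subseteq> E"
  by (induction m arbitrary: y zs) (use succ_in_E in fastforce)+

lemma paths_last: "y \<in> E \<Longrightarrow> zs \<in> paths succ m y \<Longrightarrow> f (last zs) = f y + int m"
proof (induction m arbitrary: y zs)
  case (Suc m)
  then obtain y' zs' where *: "y' \<in> succ y" "zs' \<in> paths succ m y'" "zs = y # zs'" by auto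
  then show ?case
    using Suc.IH[OF succ_in_E[OF Suc.prems(1) *(1)] *(2)] f_succ[OF Suc.prems(1) *(1)] paths_hd[OF *(2)]
    by simp
qed simp

lemma sum_path_weight: "y \<in> E \<Longrightarrow> (\<Sum>zs\<in>paths succ m y. path_weight jump_prob zs) = 1"
proof (induction m arbitrary: y)
  case (Suc m)
  have "path_weight jump_prob (y # zs) = jump_prob y y' * path_weight jump_prob zs"
    if "zs \<in> paths succ m y'" for zs y'
    using paths_hd[OF that] by (cases zs) auto
  then have "(\<Sum>zs\<in>paths succ (Suc m) y. path_weight jump_prob zs) =
    (\<Sum>y'\<in>succ y. jump_prob y y' * (\<Sum>zs\<in>paths succ m y'. path_weight jump_prob zs))"
    using succ_in_E[OF Suc.prems] finite_paths
    by (subst sum_paths_Suc[where succ = succ and y = y, OF succ(1)[OF Suc.prems]]) (auto simp: sum_distrib_left)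
  also have "\<dots> = (\<Sum>y'\<in>succ y. r y y' / rt y)"
  proof (intro sum.cong refl)
    fix y' assume "y' \<in> succ y"
    with Suc.IH[OF succ_in_E[OF Suc.prems this]]
    show "jump_prob y y' * (\<Sum>zs\<in>paths succ m y'. path_weight jump_prob zs) = r y y' / rt y"
      using Suc.prems by (simp add: jump_prob_succ)
  qed
  also have "\<dots> = 1"
    using exit_rate_pos[OF Suc.prems] exit_rate_eq[OF Suc.prems] by (simp add: sum_divide_distrib[symmetric])
  finally show ?case .
qed simp

lemma Z_measurable [measurable]: "Z m \<in> measurable M (count_space E)"
  and S_measurable [measurable]: "S m \<in> borel_measurable M"
  using chain by (auto simp: jump_hold_chain_def)

lemma Z_eq_sets [measurable]: "{\<omega> \<in> space M. Z m \<omega> = z} \<in> sets M"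
proof -
  have "{\<omega> \<in> space M. Z m \<omega> = z} = Z m -` ({z} \<inter> E) \<inter> space M"
    using measurable_space[OF Z_measurable[of m]] by auto
  also have "\<dots> \<in> sets M"
    by (rule measurable_sets[OF Z_measurable]) auto
  finally show ?thesis .
qed

text \<open>The defining property of the chain speaks of products of Borel sets only, whereas the
  event of having made exactly \<open>m\<close> jumps by time \<open>t\<close> concerns partial
  sums. The law of the holding times on the event that the jump chain follows \<open>z\<close> is
  identified with a multiple of a product measure, because both agree on products.\<close>

lemma emeasure_path:
  assumes z: "\<And>i. i \<le> m \<Longrightarrow> z i \<in> E" "z 0 = y0"
    and D: "D \<in> sets (PiM {0..m} (\<lambda>_. borel))"
  defines "\<mu> \<equiv> \<lambda>i. density lborel (exponential_density (rt (z i)))"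
  shows "emeasure M {\<omega> \<in> space M. (\<forall>i\<le>m. Z i \<omega> = z i) \<and> (\<lambda>i\<in>{0..m}. S i \<omega>) \<in> D} =
    ennreal (\<Prod>i<m. jump_prob (z i) (z (Suc i))) * emeasure (PiM {0..m} \<mu>) D"
proof -
  define c where "c = (\<Prod>i<m. jump_prob (z i) (z (Suc i)))"
  define A where "A = {\<omega> \<in> space M. \<forall>i\<le>m. Z i \<omega> = z i}"
  define T where "T = (\<lambda>\<omega>. \<lambda>i\<in>{0..m}. S i \<omega>)"
  define N where "N = distr (density M (indicator A)) (PiM {0..m} (\<lambda>_. borel)) T"
  have A[measurable]: "A \<in> sets M" unfolding A_def by measurable
  have T[measurable]: "T \<in> measurable M (PiM {0..m} (\<lambda>_. borel))" unfolding T_def by measurable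
  have mu: "prob_space (\<mu> i)" if "i \<le> m" for i
    unfolding \<mu>_def by (intro prob_space_exponential_density exit_rate_pos z that)
  have sets_PiM[measurable_cong]: "sets (PiM {0..m} \<mu>) = sets (PiM {0..m} (\<lambda>_. borel))"
    by (intro sets_PiM_cong) (auto simp: \<mu>_def)
  have "jump_prob (z i) (z (Suc i)) \<ge> 0" if "i < m" for i
    using that z exit_rate_pos[of "z i"] r_pos[of "z i" "z (Suc i)"] r_zero[of "z i" "z (Suc i)"]
    by (cases "z (Suc i) \<in> succ (z i)") (auto simp: jump_prob_def less_imp_le)
  then have c: "c \<ge> 0" unfolding c_def by (intro prod_nonneg) auto
  have N: "emeasure N D = emeasure M {\<omega> \<in> space M. (\<forall>i\<le>m. Z i \<omega> = z i) \<and> (\<lambda>i\<in>{0..m}. S i \<omega>) \<in> D}"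
    if "D \<in> sets (PiM {0..m} (\<lambda>_. borel))" for D
  proof -
    have "emeasure N D = emeasure (density M (indicator A)) (T -` D \<inter> space M)"
      unfolding N_def using that by (subst emeasure_distr) auto
    also have "\<dots> = emeasure M (A \<inter> (T -` D \<inter> space M))"
      using that T by (subst emeasure_density) (auto simp: indicator_inter_arith[symmetric] intro!: measurable_sets)
    also have "A \<inter> (T -` D \<inter> space M) = {\<omega> \<in> space M. (\<forall>i\<le>m. Z i \<omega> = z i) \<and> (\<lambda>i\<in>{0..m}. S i \<omega>) \<in> D}"
      by (auto simp: A_def T_def)
    finally show ?thesis .
  qed
  have "N = scale_measure (ennreal c) (PiM {0..m} \<mu>)"
  proof (rule measure_eqI_PiM_finite[where I = "{0..m}" and M = \<mu> and A = "\<lambda>_. space (PiM {0..m} \<mu>)"])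
    fix B assume B: "\<And>i. i \<in> {0..m} \<Longrightarrow> B i \<in> sets (\<mu> i)"
    have B': "B i \<in> sets borel" if "i \<le> m" for i using B[of i] that by (simp add: \<mu>_def)
    have "emeasure N (Pi\<^sub>E {0..m} B) = emeasure M {\<omega> \<in> space M. \<forall>i\<le>m. Z i \<omega> = z i \<and> S i \<omega> \<in> B i}"
      using B' by (subst N) (auto intro!: sets_PiM_I_finite arg_cong[where f = "emeasure M"])
    also have "\<dots> = ennreal (measure M {\<omega> \<in> space M. \<forall>i\<le>m. Z i \<omega> = z i \<and> S i \<omega> \<in> B i})"
      by (rule emeasure_eq_measure)
    also have "measure M {\<omega> \<in> space M. \<forall>i\<le>m. Z i \<omega> = z i \<and> S i \<omega> \<in> B i} =
       1 * c * (\<Prod>i\<le>m. measure (\<mu> i) (B i))"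
      unfolding c_def jump_prob_def \<mu>_def
      using chain[unfolded jump_hold_chain_def, THEN conjunct2, THEN conjunct2, THEN conjunct2, rule_format, of z m B] z B'
      by simp
    also have "ennreal (1 * c * (\<Prod>i\<le>m. measure (\<mu> i) (B i))) = ennreal c * (\<Prod>i\<le>m. emeasure (\<mu> i) (B i))"
    proof -
      have "(\<Prod>i\<le>m. emeasure (\<mu> i) (B i)) = (\<Prod>i\<le>m. ennreal (measure (\<mu> i) (B i)))"
        by (intro prod.cong refl) (metis atMost_iff mu finite_measure.emeasure_eq_measure prob_space.finite_measure)
      then show ?thesis using c by (simp add: prod_ennreal ennreal_mult prod_nonneg)
    qed
    also have "\<dots> = emeasure (scale_measure (ennreal c) (PiM {0..m} \<mu>)) (Pi\<^sub>E {0..m} B)"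
    proof -
      have "Pi\<^sub>E {0..m} B \<in> sets (PiM {0..m} \<mu>)" using B by (intro sets_PiM_I_finite) auto
      moreover have "emeasure (PiM {0..m} \<mu>) (Pi\<^sub>E {0..m} B) = (\<Prod>i\<in>{0..m}. emeasure (\<mu> i) (B i))"
        (is "?l = ?r")
      proof -
        \<comment> \<open>The states \<open>z i\<close> with \<open>i > m\<close> are arbitrary, so
          rate 1 is used there to obtain a probability measure at every index.\<close>
        define \<mu>' where "\<mu>' i = (if i \<le> m then \<mu> i else density lborel (exponential_density 1))" for i
        interpret \<mu>': product_prob_space \<mu>'
          by (rule product_prob_spaceI) (auto simp: \<mu>'_def intro!: mu prob_space_exponential_density)
        have "PiM {0..m} \<mu> = PiM {0..m} \<mu>'" by (intro PiM_cong) (auto simp: \<mu>'_def)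
        then have "?l = (\<Prod>i\<in>{0..m}. emeasure (\<mu>' i) (B i))"
          using B by (simp, subst \<mu>'.emeasure_PiM) (auto simp: \<mu>'_def)
        then show ?thesis by (simp add: \<mu>'_def)
      qed
      ultimately show ?thesis by (simp add: atLeast0AtMost)
    qed
    finally show "emeasure N (Pi\<^sub>E {0..m} B) = emeasure (scale_measure (ennreal c) (PiM {0..m} \<mu>)) (Pi\<^sub>E {0..m} B)" .
  next
    show "range (\<lambda>_. space (PiM {0..m} \<mu>)) \<subseteq> prod_algebra {0..m} \<mu>"
      by (auto simp: space_PiM intro!: prod_algebraI_finite)
    have "finite_measure N"
      unfolding N_def by (rule finite_measure.finite_measure_distr)
        (auto intro!: finite_measureI simp: emeasure_density)
    then show "emeasure N (space (PiM {0..m} \<mu>)) \<noteq> \<infinity>" for i :: nat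
      by (simp add: finite_measure.emeasure_finite)
  qed (auto simp: N_def sets_PiM)
  then show ?thesis
    using N[OF D] D sets_PiM by (simp add: c_def)
qed

definition jumps_at :: "nat \<Rightarrow> real \<Rightarrow> 'w set" where
  "jumps_at m t = {\<omega> \<in> space M. (\<Sum>i<m. S i \<omega>) \<le> t \<and> t < (\<Sum>i<Suc m. S i \<omega>)}"

lemma prob_path:
  assumes zs: "zs \<in> paths succ m y0" and "t \<ge> 0"
  shows "prob {\<omega> \<in> jumps_at m t. map (\<lambda>i. Z i \<omega>) [0..<Suc m] = zs} =
    path_weight jump_prob zs * hold (map rt zs) t"
  and "prob {\<omega> \<in> space M. map (\<lambda>i. Z i \<omega>) [0..<Suc m] = zs} = path_weight jump_prob zs"
proof -
  have len: "length zs = Suc m" and hd: "zs ! 0 = y0" using paths_hd[OF zs] by auto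
  have E: "zs ! i \<in> E" if "i \<le> m" for i
    using paths_in_E[OF y0 zs] len that by (metis less_Suc_eq_le nth_mem subsetD)
  have eq: "map (\<lambda>i. Z i \<omega>) [0..<Suc m] = zs \<longleftrightarrow> (\<forall>i\<le>m. Z i \<omega> = zs ! i)" for \<omega>
    using len by (auto simp: list_eq_iff_nth_eq less_Suc_eq_le simp del: upt_Suc)
  have w: "(\<Prod>i<m. jump_prob (zs ! i) (zs ! Suc i)) = path_weight jump_prob zs"
    using path_weight_nth[OF len] by simp
  have "prob {\<omega> \<in> space M. \<forall>i\<le>m. Z i \<omega> = zs ! i \<and> S i \<omega> \<in> UNIV} =
      (if zs ! 0 = y0 then 1 else 0) *
      (\<Prod>i<m. if zs ! (Suc i) = zs ! i then 0 else r (zs ! i) (zs ! (Suc i)) / exit_rate E r (zs ! i)) *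
      (\<Prod>i\<le>m. measure (density lborel (exponential_density (exit_rate E r (zs ! i)))) UNIV)"
    by (rule chain[unfolded jump_hold_chain_def, THEN conjunct2, THEN conjunct2, THEN conjunct2, rule_format, of "(!) zs" m "\<lambda>_. UNIV"])
       (use E in auto)
  moreover have "(\<Prod>i\<le>m. measure (density lborel (exponential_density (exit_rate E r (zs ! i)))) UNIV) = 1"
    using prob_space.prob_space[OF prob_space_exponential_density[OF exit_rate_pos[OF E]]] by (intro prod.neutral) auto
  ultimately show w2: "prob {\<omega> \<in> space M. map (\<lambda>i. Z i \<omega>) [0..<Suc m] = zs} = path_weight jump_prob zs"
    unfolding eq w[symmetric] jump_prob_def using hd by simp
  \<comment> \<open>Beyond the end of the path the rate is set to 1, as the computation of the clock
    event expects positive rates at all indices.\<close>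
  define l where "l i = (if i \<le> m then rt (zs ! i) else 1)" for i
  define D where "D = {s \<in> space (PiM {0..m} (\<lambda>_. borel :: real measure)). (\<Sum>j=0..<m. s j) \<le> t \<and> t < (\<Sum>j=0..m. s j)}"
  have D[measurable]: "D \<in> sets (PiM {0..m} (\<lambda>_. borel))" unfolding D_def by measurable
  have Deq: "{\<omega> \<in> space M. (\<forall>i\<le>m. Z i \<omega> = zs ! i) \<and> (\<lambda>i\<in>{0..m}. S i \<omega>) \<in> D} =
    {\<omega> \<in> jumps_at m t. map (\<lambda>i. Z i \<omega>) [0..<Suc m] = zs}"
    unfolding eq by (auto simp: D_def jumps_at_def space_PiM atLeast0LessThan atLeast0AtMost lessThan_Suc_atMost)
  have "map l [0..<Suc m] = map rt zs"
    using len by (intro nth_equalityI) (auto simp: l_def simp del: upt_Suc)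
  moreover have "PiM {0..m} (\<lambda>i. density lborel (exponential_density (rt (zs ! i)))) =
    PiM {0..m} (\<lambda>i. density lborel (exponential_density (l i)))"
    by (intro PiM_cong) (auto simp: l_def)
  moreover have "l i > 0" for i using exit_rate_pos[OF E] by (auto simp: l_def)
  ultimately have "emeasure M {\<omega> \<in> jumps_at m t. map (\<lambda>i. Z i \<omega>) [0..<Suc m] = zs} =
    ennreal (path_weight jump_prob zs) * ennreal (hold (map rt zs) t)"
    using emeasure_path[of m "(!) zs" D, OF E hd D] emeasure_PiM_exponential_hold[of l 0 m t] \<open>t \<ge> 0\<close>
    unfolding Deq w by (simp add: D_def)
  moreover have "path_weight jump_prob zs \<ge> 0" using w2 by (metis measure_nonneg)
  moreover have "hold (map rt zs) t \<ge> 0"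
    using paths_in_E[OF y0 zs] exit_rate_pos \<open>t \<ge> 0\<close> by (intro hold_nonneg) auto
  ultimately show "prob {\<omega> \<in> jumps_at m t. map (\<lambda>i. Z i \<omega>) [0..<Suc m] = zs} =
    path_weight jump_prob zs * hold (map rt zs) t"
    by (simp add: measure_def flip: ennreal_mult)
qed

lemma map_Z_sets: "{\<omega> \<in> space M. map (\<lambda>i. Z i \<omega>) [0..<m] = zs} \<in> sets M"
proof -
  have "{\<omega> \<in> space M. map (\<lambda>i. Z i \<omega>) [0..<m] = zs} = {\<omega> \<in> space M. length zs = m \<and> (\<forall>i<m. Z i \<omega> = zs ! i)}"
    by (auto simp: list_eq_iff_nth_eq)
  also have "\<dots> \<in> sets M" by measurable
  finally show ?thesis .
qed

text \<open>Forbidden jumps are not excluded one at a time: the finitely many allowed paths already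
  have total probability 1.\<close>

lemma AE_paths: "AE \<omega> in M. map (\<lambda>i. Z i \<omega>) [0..<Suc m] \<in> paths succ m y0"
proof -
  let ?P = "paths succ m y0" and ?W = "\<lambda>\<omega>. map (\<lambda>i. Z i \<omega>) [0..<Suc m]"
  have "prob (\<Union>zs\<in>?P. {\<omega> \<in> space M. ?W \<omega> = zs}) = (\<Sum>zs\<in>?P. prob {\<omega> \<in> space M. ?W \<omega> = zs})"
    by (rule finite_measure_finite_Union)
       (use finite_paths[OF y0] map_Z_sets in \<open>auto simp: disjoint_family_on_def simp del: upt_Suc\<close>)
  also have "\<dots> = 1"
    using sum_path_weight[OF y0] prob_path(2)[of _ m 0] by simp
  finally have "prob (\<Union>zs\<in>?P. {\<omega> \<in> space M. ?W \<omega> = zs}) = 1" .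
  moreover have "(\<Union>zs\<in>?P. {\<omega> \<in> space M. ?W \<omega> = zs}) \<in> sets M"
    using finite_paths[OF y0] map_Z_sets by (intro sets.finite_UN) (auto simp del: upt_Suc)
  ultimately have "AE \<omega> in M. \<omega> \<in> (\<Union>zs\<in>?P. {\<omega> \<in> space M. ?W \<omega> = zs})"
    using prob_eq_1 by blast
  then show ?thesis by eventually_elim auto
qed

lemma AE_level: "AE \<omega> in M. \<forall>m. f (Z m \<omega>) = f y0 + int m"
  unfolding AE_all_countable
proof
  fix m
  show "AE \<omega> in M. f (Z m \<omega>) = f y0 + int m"
    using AE_paths[of m] by eventually_elim (use paths_last[OF y0] in fastforce)
qed

lemma jumps_at_sets [measurable]: "jumps_at m t \<in> sets M"
  unfolding jumps_at_def by measurable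

lemma in_state_at_eq:
  "in_state_at M Z S t x = (\<Union>m. jumps_at m t \<inter> {\<omega> \<in> space M. Z m \<omega> = x})"
  by (auto simp: in_state_at_def jumps_at_def)

lemma in_state_at_sets [measurable]: "in_state_at M Z S t x \<in> sets M"
  unfolding in_state_at_eq by measurable

lemma prob_in_state_at_below:
  assumes "f x < f y0"
  shows "prob (in_state_at M Z S t x) = 0"
proof -
  have "prob (in_state_at M Z S t x) = prob {}"
    by (rule finite_measure_eq_AE)
       (use AE_level in \<open>eventually_elim, use assms in \<open>auto simp: in_state_at_eq\<close>\<close>)
  then show ?thesis by simp
qed

text \<open>Almost surely the grading after \<open>k\<close> jumps is \<open>f y0 + k\<close>, so
  being in \<open>x\<close> forces exactly \<open>m\<close> jumps, and the event splits into the
  finitely many paths that end in \<open>x\<close>.\<close>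

lemma prob_in_state_at:
  assumes "f x = f y0 + int m" "t \<ge> 0"
  shows "prob (in_state_at M Z S t x) =
    (\<Sum>zs\<in>paths succ m y0. if last zs = x then path_weight jump_prob zs * hold (map rt zs) t else 0)"
proof -
  let ?P = "{zs \<in> paths succ m y0. last zs = x}" and ?W = "\<lambda>\<omega>. map (\<lambda>i. Z i \<omega>) [0..<Suc m]"
  have [measurable]: "{\<omega> \<in> jumps_at m t. ?W \<omega> = zs} \<in> sets M" for zs
  proof -
    have "{\<omega> \<in> jumps_at m t. ?W \<omega> = zs} = jumps_at m t \<inter> {\<omega> \<in> space M. ?W \<omega> = zs}"
      by (auto simp: jumps_at_def)
    then show ?thesis using map_Z_sets[of "Suc m" zs] jumps_at_sets[of m t] by (simp del: upt_Suc)
  qed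
  have "prob (in_state_at M Z S t x) = prob (\<Union>zs\<in>?P. {\<omega> \<in> jumps_at m t. ?W \<omega> = zs})"
  proof (rule finite_measure_eq_AE)
    show "AE \<omega> in M. (\<omega> \<in> in_state_at M Z S t x) = (\<omega> \<in> (\<Union>zs\<in>?P. {\<omega> \<in> jumps_at m t. ?W \<omega> = zs}))"
      using AE_level AE_paths[of m]
    proof eventually_elim
      case (elim \<omega>)
      have "Z k \<omega> = x \<Longrightarrow> k = m" for k
        using elim(1)[rule_format, of k] assms(1) by auto
      then show ?case
        using elim(2) by (auto simp: in_state_at_eq jumps_at_def)
    qed
  next
    show "(\<Union>zs\<in>?P. {\<omega> \<in> jumps_at m t. ?W \<omega> = zs}) \<in> sets M"
      using finite_paths[OF y0] by (intro sets.finite_UN) (auto simp del: upt_Suc)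
  qed simp
  also have "\<dots> = (\<Sum>zs\<in>?P. prob {\<omega> \<in> jumps_at m t. ?W \<omega> = zs})"
    by (rule finite_measure_finite_Union)
       (use finite_paths[OF y0] in \<open>auto simp: disjoint_family_on_def simp del: upt_Suc\<close>)
  also have "\<dots> = (\<Sum>zs\<in>?P. path_weight jump_prob zs * hold (map rt zs) t)"
    using prob_path(1) \<open>t \<ge> 0\<close> by (intro sum.cong refl) auto
  also have "\<dots> = (\<Sum>zs\<in>paths succ m y0. if last zs = x then path_weight jump_prob zs * hold (map rt zs) t else 0)"
    by (rule sum.inter_filter) (rule finite_paths[OF y0])
  finally show ?thesis .
qed

text \<open>Since every jump raises the grading \<open>f\<close> by one, the backward equations form a triangular system.\<close>

lemma backward_equation_unique:
  fixes u :: "'s \<Rightarrow> real \<Rightarrow> complex"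
  assumes "y \<in> E" "P y" "f x = f y + int m" "t \<ge> 0"
    and P: "\<And>y y'. y \<in> E \<Longrightarrow> P y \<Longrightarrow> y' \<in> succ y \<Longrightarrow> P y'"
    and zero: "\<And>y t. y \<in> E \<Longrightarrow> P y \<Longrightarrow> f y > f x \<Longrightarrow> u y t = 0"
    and init: "\<And>y. y \<in> E \<Longrightarrow> P y \<Longrightarrow> u y 0 = (if y = x then 1 else 0)"
    and deriv: "\<And>y t. y \<in> E \<Longrightarrow> P y \<Longrightarrow>
      (u y has_vector_derivative (\<Sum>y'\<in>succ y. of_real (r y y') * (u y' t - u y t))) (at t)"
  shows "u y t = of_real (\<Sum>zs\<in>paths succ m y. if last zs = x then path_weight jump_prob zs * hold (map rt zs) t else 0)"
  using assms(1-4)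
proof (induction m arbitrary: y t)
  \<comment> \<open>One equation of the triangular system: \<open>g\<close> is the inflow from the
    successors, already known to match \<open>u\<close>, and \<open>h\<close> solves the same linear
    equation with the same initial value.\<close>
  have uniq: "u y t = of_real (h t)"
    if y: "y \<in> E" "P y" and t: "t \<ge> 0" and h0: "h 0 = (if y = x then 1 else 0)"
      and h: "\<And>s. s \<in> {0..t} \<Longrightarrow> (h has_real_derivative g s - rt y * h s) (at s within {0..t})"
      and g: "\<And>s. s \<in> {0..t} \<Longrightarrow> of_real (g s) = (\<Sum>y'\<in>succ y. of_real (r y y') * u y' s)"
    for h g :: "real \<Rightarrow> real" and y t
  proof -
    \<comment> \<open>The integrating factor \<open>exp (rt y * s)\<close> gives the difference of
      the two solutions a vanishing derivative.\<close>
    define d where "d s = exp (rt y * s) *\<^sub>R (u y s - of_real (h s))" for s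
    have "(d has_vector_derivative 0) (at s within {0..t})" if s: "s \<in> {0..t}" for s
    proof -
      have "(\<Sum>y'\<in>succ y. of_real (r y y') * (u y' s - u y s)) = of_real (g s) - of_real (rt y) * u y s"
        using y s by (simp add: g exit_rate_eq right_diff_distrib sum_subtractf sum_distrib_right)
      with deriv[OF y, of s] have 1: "(u y has_vector_derivative (of_real (g s) - of_real (rt y) * u y s)) (at s within {0..t})"
        by (simp add: has_vector_derivative_at_within)
      have 2: "((\<lambda>s. complex_of_real (h s)) has_vector_derivative of_real (g s - rt y * h s)) (at s within {0..t})"
        using h[OF s] by (intro has_vector_derivative_of_real) (simp add: has_real_derivative_iff_has_vector_derivative)
      have 3: "((\<lambda>s. exp (rt y * s)) has_real_derivative (rt y * exp (rt y * s))) (at s within {0..t})"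
        by (auto intro!: derivative_eq_intros)
      show ?thesis
        unfolding d_def
        by (rule has_vector_derivative_eq_rhs[OF has_vector_derivative_scaleR[OF 3 has_vector_derivative_diff[OF 1 2]]])
           (simp add: scaleR_conv_of_real algebra_simps)
    qed
    then obtain c where "\<And>s. s \<in> {0..t} \<Longrightarrow> d s = c"
      using has_vector_derivative_zero_constant[of "{0..t}" d] by auto
    then have "d t = d 0" using t by simp
    moreover have "d 0 = 0" using h0 init[OF y] by (auto simp: d_def)
    ultimately show ?thesis by (simp add: d_def)
  qed
  define c where "c zs = (if last zs = x then path_weight jump_prob zs else 0)" for zs
  have if_c: "(if last zs = x then path_weight jump_prob zs * h else 0) = c zs * h" for zs h
    by (simp add: c_def)
  {
    case 0
    have "u y t = of_real ((if y = x then 1 else 0) * exp (- rt y * t))"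
    proof (rule uniq[of _ _ _ "\<lambda>_. 0"])
      \<comment> \<open>At the grade of \<open>x\<close> all successors lie strictly above it, where
        \<open>u\<close> vanishes, so there is no inflow and only exponential decay remains.\<close>
      show "of_real 0 = (\<Sum>y'\<in>succ y. of_real (r y y') * u y' s)" for s
        using 0 f_succ[of y] succ(3)[of y] P[of y] by (simp add: zero subset_eq)
    qed (use 0 in \<open>auto intro!: derivative_eq_intros\<close>)
    then show ?case by simp
  next
    case (Suc m)
    note y = Suc.prems(1,2)
    define H where "H m y s = (\<Sum>zs\<in>paths succ m y. c zs * hold (map rt zs) s)" for m y s
    have fin: "finite (succ y)" and finp: "\<And>y'. y' \<in> succ y \<Longrightarrow> finite (paths succ m y')"
      using succ(1) succ_in_E y finite_paths by auto
    have c: "c (y # zs) = jump_prob y y' * c zs" if "zs \<in> paths succ m y'" for zs y'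
      using paths_hd[OF that] by (cases zs) (auto simp: c_def)
    have H: "H (Suc m) y s = (\<Sum>y'\<in>succ y. \<Sum>zs\<in>paths succ m y'. jump_prob y y' * c zs * hold (rt y # map rt zs) s)" for s
      unfolding H_def by (subst sum_paths_Suc[OF fin finp]) (auto simp: c intro!: sum.cong)
    have "u y t = of_real (H (Suc m) y t)"
    proof (rule uniq[of _ _ _ "\<lambda>s. \<Sum>y'\<in>succ y. r y y' * H m y' s"])
      \<comment> \<open>At time 0 a path with at least one jump has probability 0: the integral in
        \<open>hold\<close> extends over a single point. The initial value of \<open>u\<close>
        agrees, because \<open>y\<close> has a smaller grade than \<open>x\<close>.\<close>
      have "hold (rt y # map rt zs) 0 = 0" if "zs \<in> paths succ m y'" for zs y'
        using paths_hd[OF that] by (cases zs) auto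
      moreover have "y \<noteq> x" using Suc.prems by auto
      ultimately show "H (Suc m) y 0 = (if y = x then 1 else 0)"
        unfolding H by (simp add: sum.neutral)
    next
      fix s assume s: "s \<in> {0..t}"
      have "((\<lambda>s. jump_prob y y' * c zs * hold (rt y # map rt zs) s) has_real_derivative
         jump_prob y y' * c zs * (- rt y * hold (rt y # map rt zs) s + rt y * hold (map rt zs) s)) (at s within {0..t})"
        if "zs \<in> paths succ m y'" for y' zs
      proof (rule DERIV_cmult)
        obtain z zs' where "zs = z # zs'" using \<open>zs \<in> paths succ m y'\<close>[THEN paths_hd] by (cases zs) auto
        then show "(hold (rt y # map rt zs) has_real_derivative
          - rt y * hold (rt y # map rt zs) s + rt y * hold (map rt zs) s) (at s within {0..t})"
          using hold_has_derivative(2)[OF s, of "rt y" "rt z" "map rt zs'"] by (simp only: list.map)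
      qed
      then have "((\<lambda>s. H (Suc m) y s) has_real_derivative (\<Sum>y'\<in>succ y. \<Sum>zs\<in>paths succ m y'.
         jump_prob y y' * c zs * (- rt y * hold (rt y # map rt zs) s + rt y * hold (map rt zs) s))) (at s within {0..t})"
        unfolding H by (intro DERIV_sum)
      also have "(\<Sum>y'\<in>succ y. \<Sum>zs\<in>paths succ m y'.
         jump_prob y y' * c zs * (- rt y * hold (rt y # map rt zs) s + rt y * hold (map rt zs) s)) =
         (\<Sum>y'\<in>succ y. \<Sum>zs\<in>paths succ m y'. jump_prob y y' * rt y * (c zs * hold (map rt zs) s) -
           rt y * (jump_prob y y' * c zs * hold (rt y # map rt zs) s))"
      proof -
        have "j * a * (- l * h + l * h') = j * l * (a * h') - l * (j * a * h)" for j a l h h' :: real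
          by (simp add: algebra_simps)
        then show ?thesis by (simp only:)
      qed
      also have "\<dots> = (\<Sum>y'\<in>succ y. jump_prob y y' * rt y * H m y' s) - rt y * H (Suc m) y s"
        unfolding H unfolding H_def sum_subtractf sum_distrib_left ..
      also have "(\<Sum>y'\<in>succ y. jump_prob y y' * rt y * H m y' s) = (\<Sum>y'\<in>succ y. r y y' * H m y' s)"
        using exit_rate_pos[OF y(1)] y by (intro sum.cong refl) (simp add: jump_prob_succ)
      finally show "(H (Suc m) y has_real_derivative (\<Sum>y'\<in>succ y. r y y' * H m y' s) - rt y * H (Suc m) y s) (at s within {0..t})" .
      have "u y' s = of_real (H m y' s)" if "y' \<in> succ y" for y'
        using Suc.IH[of y' s] y that succ(3)[of y] P[of y y'] f_succ[of y y'] Suc.prems(3) s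
        unfolding H_def if_c by (auto simp: subset_eq)
      then show "of_real (\<Sum>y'\<in>succ y. r y y' * H m y' s) = (\<Sum>y'\<in>succ y. of_real (r y y') * u y' s)"
        by simp
    qed (use Suc.prems in auto)
    then show ?case unfolding if_c H_def .
  }
qed

theorem prob_in_state_at_unique:
  fixes u :: "'s \<Rightarrow> real \<Rightarrow> complex"
  assumes "P y0" "t \<ge> 0"
    and "\<And>y y'. y \<in> E \<Longrightarrow> P y \<Longrightarrow> y' \<in> succ y \<Longrightarrow> P y'"
    and zero: "\<And>y t. y \<in> E \<Longrightarrow> P y \<Longrightarrow> f y > f x \<Longrightarrow> u y t = 0"
    and "\<And>y. y \<in> E \<Longrightarrow> P y \<Longrightarrow> u y 0 = (if y = x then 1 else 0)"
    and "\<And>y t. y \<in> E \<Longrightarrow> P y \<Longrightarrow>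
      (u y has_vector_derivative (\<Sum>y'\<in>succ y. of_real (r y y') * (u y' t - u y t))) (at t)"
  shows "of_real (prob (in_state_at M Z S t x)) = u y0 t"
proof (cases "f x < f y0")
  case True
  then show ?thesis using zero[OF y0] assms(1) prob_in_state_at_below by simp
next
  case False
  then obtain m where m: "f x = f y0 + int m"
    using zle_iff_zadd[of "f y0" "f x"] by auto
  show ?thesis
    unfolding prob_in_state_at[OF m \<open>t \<ge> 0\<close>]
    by (rule backward_equation_unique[where u = u and P = P, OF y0 assms(1) m assms(2-6), symmetric])
qed

end

section \<open>Pole structure of the integrand\<close>

text \<open>The middle case of the definition is the empty product over \<open>n+1..m-1\<close>, so
  it merges with the last one.\<close>

lemma primed_prod_alt:
  "primed_prod m n f = (if m \<le> n then \<Prod>k=m..n. f k else \<Prod>k=n+1..m-1. 1 / f k)"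
  by (auto simp: primed_prod_def)

text \<open>As a function of \<open>z\<close> this has poles at \<open>b y, ..., b x\<close> if
  \<open>y \<le> x\<close>, and is a polynomial otherwise.\<close>

definition site_prod :: "(int \<Rightarrow> real) \<Rightarrow> int \<Rightarrow> int \<Rightarrow> complex \<Rightarrow> complex" where
  "site_prod b y x z = primed_prod y x (\<lambda>k. of_real (b k) / (of_real (b k) - z))"

text \<open>Raising \<open>y\<close> removes a factor \<open>b y / (b y - z)\<close> as long as
  \<open>y \<le> x\<close> and adds its inverse afterwards. The primed product is made so that both
  regimes satisfy one and the same relation.\<close>

lemma site_prod_shift:
  assumes "b y > 0" "y \<le> x \<Longrightarrow> of_real (b y) \<noteq> z"
  shows "of_real (b y) * site_prod b (y + 1) x z = site_prod b y x z * (of_real (b y) - z)"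
proof (cases "y \<le> x")
  case True
  then have "site_prod b y x z = of_real (b y) / (of_real (b y) - z) * site_prod b (y + 1) x z"
  proof (cases "y = x")
    case False
    with True have "{y..x} = insert y {y+1..x}" by auto
    then show ?thesis using True False by (simp add: site_prod_def primed_prod_alt)
  qed (simp add: site_prod_def primed_prod_alt)
  then show ?thesis using assms True by simp
next
  case False
  then have "{x+1..y} = insert y {x+1..y-1}" by auto
  then have "site_prod b (y + 1) x z = (of_real (b y) - z) / of_real (b y) * site_prod b y x z"
    using False by (simp add: site_prod_def primed_prod_alt)
  then show ?thesis using assms by simp
qed

lemma of_real_neq_on_circle: "norm z = R \<Longrightarrow> b > 0 \<Longrightarrow> b < R \<Longrightarrow> complex_of_real b - z \<noteq> 0"
  by auto

lemma continuous_on_site_prod [continuous_intros]: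
  assumes "continuous_on A h" "\<And>w. w \<in> A \<Longrightarrow> norm (h w) = R"
    and "\<And>k. b k > 0" "\<And>k. y \<le> k \<Longrightarrow> k \<le> x \<Longrightarrow> b k < R"
  shows "continuous_on A (\<lambda>w. site_prod b y x (h w))"
proof (cases "y \<le> x")
  case True
  show ?thesis
    unfolding site_prod_def primed_prod_alt if_P[OF True]
  proof (intro continuous_intros assms(1) ballI)
    fix k w assume "k \<in> {y..x}" "w \<in> A"
    then show "complex_of_real (b k) - h w \<noteq> 0"
      using of_real_neq_on_circle[of "h w" R "b k"] assms by auto
  qed
next
  case False
  \<comment> \<open>With division by zero equal to zero this is unconditional: at
    \<open>z = b k\<close> both sides are 0. The inverted factors are thus polynomials in
    \<open>h w\<close>, without any condition on poles.\<close>
  have "1 / (of_real (b k) / (of_real (b k) - h w)) = (of_real (b k) - h w) * (1 / of_real (b k))" for k w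
    by simp
  then show ?thesis
    unfolding site_prod_def primed_prod_alt if_not_P[OF False]
    by (simp only:) (intro continuous_intros assms(1))
qed

lemma holomorphic_on_site_prod:
  assumes "x < y"
  shows "site_prod b y x holomorphic_on A"
proof -
  have "1 / (of_real (b k) / (of_real (b k) - z)) = (of_real (b k) - z) * (1 / of_real (b k))" for k and z :: complex
    by simp
  then have "site_prod b y x = (\<lambda>z. \<Prod>k=x+1..y-1. (of_real (b k) - z) * (1 / of_real (b k)))"
    using assms by (simp add: site_prod_def primed_prod_alt fun_eq_iff)
  then show ?thesis by (simp only:) (intro holomorphic_intros)
qed

text \<open>Multiplication by \<open>q\<close> maps the closed disc strictly inside the circle. Only
  \<open>v\<close> has to lie on the circle; \<open>u\<close> may run through the whole disc, as it
  does when Cauchy's theorem is applied to that variable.\<close>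

lemma S_factor_denominator:
  assumes "0 < q" "q < 1" "R > 0" "norm u \<le> R" "norm v = R"
  shows "of_real q * u - v \<noteq> (0 :: complex)"
proof
  assume "of_real q * u - v = 0"
  then have "v = of_real q * u" by simp
  then have "norm v = q * norm u" using assms(1) by (simp add: norm_mult)
  also have "\<dots> \<le> q * R" using assms by simp
  also have "\<dots> < R" using assms by simp
  finally show False using assms by simp
qed

lemma continuous_on_S_factor:
  assumes "0 < q" "q < 1" "R > 0" "\<alpha> \<in> K" "\<beta> \<in> K"
  shows "continuous_on (polycircle R K) (\<lambda>w. S_factor q w \<beta> \<alpha>)"
  unfolding S_factor_def
  by (intro continuous_intros) (use S_factor_denominator[OF assms(1-3)] assms in \<open>auto simp: polycircle_def\<close>)

text \<open>The set \<open>I\<close> of pairs and the set \<open>K\<close> of variables are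
  parameters, so that integrating out one variable leaves an expression of the same form.\<close>

definition bethe_prod ::
  "real \<Rightarrow> (int \<Rightarrow> real) \<Rightarrow> (nat \<times> nat) set \<Rightarrow> nat set \<Rightarrow> (nat \<Rightarrow> int) \<Rightarrow> (nat \<Rightarrow> int) \<Rightarrow> (nat \<Rightarrow> complex) \<Rightarrow> complex" where
  "bethe_prod q b I K y x w = (\<Prod>(\<beta>, \<alpha>)\<in>I. S_factor q w \<beta> \<alpha>) * (\<Prod>m\<in>K. site_prod b (y m) (x m) (w m))"

lemma finite_pairs: "I \<subseteq> {(\<beta>, \<alpha>). \<alpha> \<in> K \<and> \<beta> \<in> K \<and> \<alpha> < \<beta>} \<Longrightarrow> finite K \<Longrightarrow> finite I"
  by (rule finite_subset[of _ "K \<times> K"]) auto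

lemma continuous_on_bethe_prod:
  assumes "0 < q" "q < 1" "R > 0" "\<And>k. b k > 0"
    and "\<And>m k. m \<in> K \<Longrightarrow> y m \<le> k \<Longrightarrow> k \<le> x m \<Longrightarrow> b k < R"
    and "I \<subseteq> {(\<beta>, \<alpha>). \<alpha> \<in> K \<and> \<beta> \<in> K \<and> \<alpha> < \<beta>}" "K \<subseteq> L"
  shows "continuous_on (polycircle R L) (bethe_prod q b I K y x)"
  unfolding bethe_prod_def case_prod_unfold
proof (intro continuous_on_mult continuous_on_prod)
  fix p assume "p \<in> I"
  then show "continuous_on (polycircle R L) (\<lambda>w. S_factor q w (fst p) (snd p))"
    by (intro continuous_on_S_factor) (use assms in force)+
next
  fix m assume "m \<in> K"
  then show "continuous_on (polycircle R L) (\<lambda>w. site_prod b (y m) (x m) (w m))"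
    by (intro continuous_on_site_prod[where R = R] continuous_intros) (use assms in \<open>auto simp: polycircle_def\<close>)
qed

text \<open>As \<open>p\<close> is never the larger entry of a pair, \<open>w p\<close> meets only
  denominators \<open>q * w p - w \<beta>\<close>, which have no zero in the disc, and
  \<open>x p < y p\<close> makes its site product a polynomial.\<close>

lemma bethe_prod_interior:
  assumes q: "0 < q" "q < 1" and "R > 0" and "finite K"
    and I: "I \<subseteq> {(\<beta>, \<alpha>). \<alpha> \<in> K \<and> \<beta> \<in> K \<and> \<alpha> < \<beta>}"
    and "p \<in> K" "x p < y p" and no: "\<And>\<alpha>. (p, \<alpha>) \<notin> I" and w: "w \<in> polycircle R (K - {p})"
  shows "(\<lambda>z. bethe_prod q b I K y x (w(p := z))) holomorphic_on cball 0 R"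
  unfolding bethe_prod_def case_prod_unfold
proof (intro holomorphic_on_mult holomorphic_on_prod)
  fix e assume e: "e \<in> I"
  obtain \<beta> \<alpha> where e_eq: "e = (\<beta>, \<alpha>)" by (cases e)
  have *: "\<alpha> \<in> K" "\<beta> \<in> K" "\<alpha> < \<beta>" "\<beta> \<noteq> p" using e e_eq I no by auto
  show "(\<lambda>z. S_factor q (w(p := z)) (fst e) (snd e)) holomorphic_on cball 0 R"
  proof (cases "\<alpha> = p")
    case True
    have "of_real q * z - w \<beta> \<noteq> 0" if "z \<in> cball 0 R" for z
      by (rule S_factor_denominator[OF q \<open>R > 0\<close>]) (use that w * in \<open>auto simp: polycircle_def\<close>)
    then show ?thesis using True * unfolding S_factor_def e_eq
      by (auto intro!: holomorphic_intros)
  qed (use * in \<open>auto simp: S_factor_def e_eq\<close>)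
next
  fix m assume "m \<in> K"
  show "(\<lambda>z. site_prod b (y m) (x m) ((w(p := z)) m)) holomorphic_on cball 0 R"
    using holomorphic_on_site_prod[of "x p" "y p" b "cball 0 R"] \<open>x p < y p\<close> by (cases "m = p") auto
qed

text \<open>At \<open>w\<^sub>p = \<infinity>\<close> each factor \<open>S\<^bsub>(p,\<alpha>)\<^esub>\<close> tends to \<open>q\<close>, and a site product with \<open>N\<close> factors decays like \<open>w\<^sub>p\<^bsup>-N\<^esup>\<close>.\<close>

lemma bethe_prod_exterior:
  assumes q: "0 < q" "q < 1" and "R > 0" and b: "\<And>k. b k > 0" and K: "finite K" "p \<in> K"
    and "y p \<le> x p" and bR: "\<And>k. y p \<le> k \<Longrightarrow> k \<le> x p \<Longrightarrow> b k < R"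
    and I: "I \<subseteq> {(\<beta>, \<alpha>). \<alpha> \<in> K \<and> \<beta> \<in> K \<and> \<alpha> < \<beta>}"
    and no: "\<And>\<beta>. (\<beta>, p) \<notin> I" and w: "w \<in> polycircle R (K - {p})"
  shows "contour_integral (circlepath 0 R) (\<lambda>z. bethe_prod q b I K y x (w(p := z))) =
    (if y p = x p then - 2 * of_real pi * \<i> * of_real (b (y p)) * of_real q ^ card {e \<in> I. fst e = p} *
       bethe_prod q b {e \<in> I. fst e \<noteq> p} (K - {p}) y x w else 0)"
proof -
  let ?I1 = "{e \<in> I. fst e = p}" and ?I2 = "{e \<in> I. fst e \<noteq> p}"
  have fin: "finite I" using finite_pairs[OF I K(1)] .
  define c where "c = bethe_prod q b ?I2 (K - {p}) y x w"
  \<comment> \<open>\<open>A\<close> and \<open>B\<close> are the factors containing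
    \<open>w p\<close>, rewritten in \<open>u = 1 / w p\<close>. The site \<open>y p\<close> gives
    up one factor \<open>u\<close>, which becomes the \<open>1 / z\<close> demanded by the exterior
    formula.\<close>
  define A where "A u = (\<Prod>e\<in>?I1. - ((of_real q - w (snd e) * u) / (of_real q * w (snd e) * u - 1)))" for u :: complex
  define B where "B u = of_real (b (y p)) / (of_real (b (y p)) * u - 1) *
    (\<Prod>k\<in>{y p<..x p}. of_real (b k) * u / (of_real (b k) * u - 1))" for u :: complex
  define g where "g u = c * A u * B u" for u
  have small: "of_real s * u - 1 \<noteq> (0 :: complex)" if "norm u \<le> 1 / R" "0 < s" "s < R" for s u
  proof
    assume "of_real s * u - 1 = 0"
    then have "norm (of_real s * u) = 1" by simp
    moreover have "norm (of_real s * u) \<le> s * (1 / R)"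
      using that by (simp only: norm_mult norm_of_real abs_of_pos) (intro mult_left_mono, auto)
    ultimately show False using that \<open>R > 0\<close> by (simp add: field_simps)
  qed
  have smallw: "of_real q * w (snd e) * u - 1 \<noteq> 0" if "norm u \<le> 1 / R" "e \<in> ?I1" for e u
  proof
    assume "of_real q * w (snd e) * u - 1 = 0"
    then have "norm (of_real q * w (snd e) * u) = 1" by simp
    moreover have "norm (w (snd e)) = R" using that I no w by (auto simp: polycircle_def)
    then have "norm (of_real q * w (snd e) * u) = q * (R * norm u)"
      using q by (simp add: norm_mult)
    moreover have "R * norm u \<le> 1" using that \<open>R > 0\<close> by (simp add: field_simps)
    then have "q * (R * norm u) \<le> q * 1" using q by (intro mult_left_mono) auto
    ultimately show False using q by simp
  qed
  have f: "bethe_prod q b I K y x (w(p := z)) = g (1 / z) / z" if z: "norm z = R" for z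
  proof -
    have z0: "z \<noteq> 0" using z \<open>R > 0\<close> by auto
    have "(\<Prod>(\<beta>, \<alpha>)\<in>I. S_factor q (w(p := z)) \<beta> \<alpha>) =
      (\<Prod>e\<in>?I1. S_factor q (w(p := z)) (fst e) (snd e)) * (\<Prod>e\<in>?I2. S_factor q (w(p := z)) (fst e) (snd e))"
      unfolding case_prod_unfold by (subst prod.union_disjoint[symmetric]) (use fin in \<open>auto intro: prod.cong\<close>)
    also have "(\<Prod>e\<in>?I2. S_factor q (w(p := z)) (fst e) (snd e)) = (\<Prod>(\<beta>, \<alpha>)\<in>?I2. S_factor q w \<beta> \<alpha>)"
      unfolding case_prod_unfold using no by (intro prod.cong refl) (auto simp: S_factor_def)
    also have "(\<Prod>e\<in>?I1. S_factor q (w(p := z)) (fst e) (snd e)) = A (1 / z)"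
      unfolding A_def
    proof (intro prod.cong refl)
      fix e assume e: "e \<in> ?I1"
      then have "snd e \<noteq> p" using no by (metis (mono_tags, lifting) mem_Collect_eq prod.collapse)
      then have "S_factor q (w(p := z)) (fst e) (snd e) = - ((of_real q * z - w (snd e)) / (of_real q * w (snd e) - z))"
        using e by (simp add: S_factor_def)
      also have "of_real q * z - w (snd e) = z * (of_real q - w (snd e) * (1 / z))"
        using z0 by (simp add: field_simps)
      also have "of_real q * w (snd e) - z = z * (of_real q * w (snd e) * (1 / z) - 1)"
        using z0 by (simp add: field_simps)
      finally show "S_factor q (w(p := z)) (fst e) (snd e) =
        - ((of_real q - w (snd e) * (1 / z)) / (of_real q * w (snd e) * (1 / z) - 1))"
        unfolding mult_divide_mult_cancel_left[OF z0] .
    qed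
    finally have 1: "(\<Prod>(\<beta>, \<alpha>)\<in>I. S_factor q (w(p := z)) \<beta> \<alpha>) = A (1 / z) * (\<Prod>(\<beta>, \<alpha>)\<in>?I2. S_factor q w \<beta> \<alpha>)" .
    have "(\<Prod>m\<in>K. site_prod b (y m) (x m) ((w(p := z)) m)) =
      site_prod b (y p) (x p) z * (\<Prod>m\<in>K - {p}. site_prod b (y m) (x m) (w m))"
      using K by (simp add: prod.remove)
    also have "site_prod b (y p) (x p) z = B (1 / z) / z"
    proof -
      have *: "of_real (b k) / (of_real (b k) - z) = of_real (b k) * (1 / z) / (of_real (b k) * (1 / z) - 1)" for k
      proof -
        have "of_real (b k) - z = z * (of_real (b k) * (1 / z) - 1)" using z0 by (simp add: field_simps)
        then show ?thesis using z0 by simp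
      qed
      have "{y p..x p} = insert (y p) {y p<..x p}" using \<open>y p \<le> x p\<close> by auto
      then have "site_prod b (y p) (x p) z = (\<Prod>k\<in>insert (y p) {y p<..x p}. of_real (b k) * (1 / z) / (of_real (b k) * (1 / z) - 1))"
        using \<open>y p \<le> x p\<close> by (simp only: site_prod_def primed_prod_alt if_P *)
      then show ?thesis by (simp add: B_def)
    qed
    finally show ?thesis
      unfolding bethe_prod_def 1 g_def c_def by simp
  qed
  have "g holomorphic_on cball 0 (1 / R)"
    unfolding g_def A_def B_def
    by (intro holomorphic_intros) (use small smallw b bR \<open>y p \<le> x p\<close> in auto)
  from contour_integral_circlepath_exterior[OF \<open>R > 0\<close> this f]
  have "contour_integral (circlepath 0 R) (\<lambda>z. bethe_prod q b I K y x (w(p := z))) = 2 * of_real pi * \<i> * g 0" .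
  \<comment> \<open>At \<open>u = 0\<close> every factor of \<open>A\<close> equals \<open>q\<close>
    and the leading factor of \<open>B\<close> equals \<open>- b (y p)\<close>, while each further
    site contributes a factor 0.\<close>
  also have "g 0 = (if y p = x p then - of_real (b (y p)) * of_real q ^ card ?I1 * c else 0)"
  proof (cases "y p = x p")
    case False
    then have "x p \<in> {y p<..x p}" using \<open>y p \<le> x p\<close> by auto
    then have "B 0 = 0" by (auto simp: B_def)
    then show ?thesis using False by (simp add: g_def)
  qed (simp add: g_def A_def B_def)
  finally show ?thesis unfolding c_def by (rule trans) simp
qed

text \<open>The largest index is never the smaller entry of a pair, so the innermost integral can be
  evaluated through the exterior. It leaves a power of \<open>q\<close>, one for each pair headed by
  that index, times an integrand of the same form in one variable less.\<close>

lemma circ_int_bethe_prod_stationary: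
  assumes q: "0 < q" "q < 1" and "R > 0" and b: "\<And>k. b k > 0"
    and bR: "\<And>m. m \<in> {1..n} \<Longrightarrow> b (y m) < R"
    and I: "I \<subseteq> {(\<beta>, \<alpha>). \<alpha> \<in> {1..n} \<and> \<beta> \<in> {1..n} \<and> \<alpha> < \<beta>}"
  shows "circ_int R [1..<Suc n] (bethe_prod q b I {1..n} y y) w =
    (- 2 * of_real pi * \<i>) ^ n * (\<Prod>m=1..n. of_real (b (y m))) * of_real q ^ card I"
  using bR I
proof (induction n arbitrary: I w)
  case 0
  then have "I = {}" by auto
  then show ?case by (simp add: bethe_prod_def)
next
  case (Suc n)
  let ?I1 = "{e \<in> I. fst e = Suc n}" and ?I2 = "{e \<in> I. fst e \<noteq> Suc n}"
  define c where "c = - 2 * of_real pi * \<i> * of_real (b (y (Suc n))) * of_real q ^ card ?I1"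
  have fin: "finite I" using finite_pairs[OF Suc.prems(2)] by simp
  have K: "{1..Suc n} - {Suc n} = {1..n}" by auto
  have I2: "?I2 \<subseteq> {(\<beta>, \<alpha>). \<alpha> \<in> {1..n} \<and> \<beta> \<in> {1..n} \<and> \<alpha> < \<beta>}" using Suc.prems(2) by force
  have cont: "continuous_on (polycircle R ({} \<union> set [1..<Suc n])) (bethe_prod q b ?I2 {1..n} y y)"
    by (intro continuous_on_bethe_prod q \<open>R > 0\<close> b I2) (use Suc.prems in auto)
  have "circ_int R [1..<Suc (Suc n)] (bethe_prod q b I {1..Suc n} y y) w =
    circ_int R ([1..<Suc n] @ [Suc n]) (bethe_prod q b I {1..Suc n} y y) w"
    by simp
  also have "\<dots> = circ_int R [1..<Suc n] (\<lambda>w. c * bethe_prod q b ?I2 {1..n} y y w) w"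
    unfolding circ_int_append
  proof (rule circ_int_cong[OF \<open>R > 0\<close>, of "{}"])
    fix w assume w: "w \<in> polycircle R ({} \<union> set [1..<Suc n])"
    have "{} \<union> set [1..<Suc n] = {1..Suc n} - {Suc n}" by auto
    with w have "w \<in> polycircle R ({1..Suc n} - {Suc n})" by (simp only:)
    then show "circ_int R [Suc n] (bethe_prod q b I {1..Suc n} y y) w = c * bethe_prod q b ?I2 {1..n} y y w"
      using bethe_prod_exterior[OF q \<open>R > 0\<close> b, where K = "{1..Suc n}" and p = "Suc n" and y = y and x = y and I = I and w = w] Suc.prems
      unfolding c_def K by fastforce
  qed simp
  also have "\<dots> = c * circ_int R [1..<Suc n] (bethe_prod q b ?I2 {1..n} y y) w"
    by (rule circ_int_cmult[OF \<open>R > 0\<close> cont]) simp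
  also have "\<dots> = c * ((- 2 * of_real pi * \<i>) ^ n * (\<Prod>m=1..n. of_real (b (y m))) * of_real q ^ card ?I2)"
    by (subst Suc.IH[OF _ I2]) (use Suc.prems in auto)
  also have "\<dots> = (- 2 * of_real pi * \<i>) ^ Suc n * (\<Prod>m=1..Suc n. of_real (b (y m))) * of_real q ^ (card ?I1 + card ?I2)"
    by (simp add: c_def power_add prod.cl_ivl_Suc)
  also have "card ?I1 + card ?I2 = card I"
    using fin by (subst card_Un_disjoint[symmetric]) (auto intro: arg_cong[where f = card])
  finally show ?case .
qed

section \<open>The sum of \<open>q\<^bsup>inv(\<sigma>)\<^esup>\<close> over a stabilizer\<close>

text \<open>For \<tau> fixing \<open>N\<close>, the word of \<open>\<tau> \<circ> cyc N j\<close>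
  arises from that of \<tau> on \<open>{1..N-1}\<close> by inserting the value \<open>N\<close> at
  position \<open>j\<close>.\<close>

definition cyc :: "nat \<Rightarrow> nat \<Rightarrow> nat \<Rightarrow> nat" where
  "cyc N j i = (if i = j then N else if j < i \<and> i \<le> N then i - 1 else i)"

definition icyc :: "nat \<Rightarrow> nat \<Rightarrow> nat \<Rightarrow> nat" where
  "icyc N j i = (if i = N then j else if j \<le> i \<and> i < N then i + 1 else i)"

lemma cyc_icyc: "j \<le> N \<Longrightarrow> cyc N j (icyc N j i) = i" "j \<le> N \<Longrightarrow> icyc N j (cyc N j i) = i"
  by (auto simp: cyc_def icyc_def)

lemma cyc_permutes: "j \<in> {1..N} \<Longrightarrow> cyc N j permutes {1..N}"
  by (rule bij_imp_permutes)
     (auto intro!: bij_betwI[of _ _ _ "icyc N j"] simp: cyc_icyc, auto simp: cyc_def icyc_def)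

lemma inv_cyc: "j \<le> N \<Longrightarrow> inv (cyc N j) = icyc N j"
  by (rule inv_unique_comp) (auto simp: fun_eq_iff cyc_icyc)

lemma icyc_permutes: "j \<in> {1..N} \<Longrightarrow> icyc N j permutes {1..N}"
  using permutes_inv[OF cyc_permutes, of j N] by (simp add: inv_cyc)

lemma finite_inversions: "finite (inversions n \<sigma>)"
  by (rule finite_subset[of _ "{1..n} \<times> {1..n}"]) (auto simp: inversions_def)

text \<open>The inserted value is the largest, so it forms an inversion with exactly the
  \<open>Suc n - j\<close> entries to its right; the relative order of all other entries is
  unchanged.\<close>

lemma card_inversions_comp_cyc:
  assumes "\<tau> permutes {1..n}" "j \<in> {1..Suc n}"
  shows "card (inversions (Suc n) (\<tau> \<circ> cyc (Suc n) j)) = card (inversions n \<tau>) + (Suc n - j)"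
proof -
  let ?N = "Suc n" and ?\<sigma> = "\<tau> \<circ> cyc (Suc n) j"
  have \<tau>': "\<tau> permutes {1..?N}" using permutes_subset[OF assms(1)] by auto
  have inv: "inv ?\<sigma> i = icyc ?N j (inv \<tau> i)" for i
    using assms(2) permutes_bij[OF \<tau>'] permutes_bij[OF cyc_permutes[OF assms(2)]]
    by (simp add: o_inv_distrib inv_cyc)
  have inv\<tau>: "inv \<tau> permutes {1..n}" using permutes_inv[OF assms(1)] .
  have invN: "inv \<tau> ?N = ?N" using permutes_not_in[OF inv\<tau>] by simp
  have inv_in: "inv \<tau> i \<in> {1..n}" if "i \<in> {1..n}" for i using permutes_in_image[OF inv\<tau>] that by blast
  have mono: "icyc ?N j a < icyc ?N j b \<longleftrightarrow> a < b" if "a \<in> {1..n}" "b \<in> {1..n}" for a b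
    using that by (auto simp: icyc_def)
  have "inversions ?N ?\<sigma> = inversions n \<tau> \<union> Pair ?N ` {\<alpha>\<in>{1..n}. inv \<tau> \<alpha> \<ge> j}"
  proof (intro set_eqI iffI)
    fix e assume e: "e \<in> inversions ?N ?\<sigma>"
    obtain \<beta> \<alpha> where e_eq: "e = (\<beta>, \<alpha>)" by (cases e)
    with e have *: "\<alpha> \<in> {1..n}" "\<beta> \<in> {1..?N}" "\<alpha> < \<beta>" "icyc ?N j (inv \<tau> \<alpha>) > icyc ?N j (inv \<tau> \<beta>)"
      by (auto simp: inversions_def inv)
    show "e \<in> inversions n \<tau> \<union> Pair ?N ` {\<alpha>\<in>{1..n}. inv \<tau> \<alpha> \<ge> j}"
    proof (cases "\<beta> = ?N")
      case True
      then have "inv \<tau> \<alpha> \<ge> j" using *(4) inv_in[OF *(1)] by (auto simp: invN icyc_def split: if_splits)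
      then show ?thesis using True * e_eq by auto
    next
      case False
      then have "\<beta> \<in> {1..n}" using * by auto
      then show ?thesis using * mono[OF inv_in inv_in, of \<beta> \<alpha>] e_eq by (auto simp: inversions_def)
    qed
  next
    fix e assume "e \<in> inversions n \<tau> \<union> Pair ?N ` {\<alpha>\<in>{1..n}. inv \<tau> \<alpha> \<ge> j}"
    then show "e \<in> inversions ?N ?\<sigma>"
    proof
      assume e: "e \<in> inversions n \<tau>"
      obtain \<beta> \<alpha> where e_eq: "e = (\<beta>, \<alpha>)" by (cases e)
      show ?thesis using e e_eq mono[OF inv_in inv_in, of \<beta> \<alpha>] by (auto simp: inversions_def inv)
    next
      assume "e \<in> Pair ?N ` {\<alpha>\<in>{1..n}. inv \<tau> \<alpha> \<ge> j}"
      then obtain \<alpha> where *: "e = (?N, \<alpha>)" "\<alpha> \<in> {1..n}" "inv \<tau> \<alpha> \<ge> j" by auto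
      then have "icyc ?N j (inv \<tau> \<alpha>) > icyc ?N j (inv \<tau> ?N)"
        using inv_in[OF *(2)] by (auto simp: invN icyc_def)
      with * show ?thesis by (auto simp: inversions_def inv)
    qed
  qed
  moreover have "card (inversions n \<tau> \<union> Pair ?N ` {\<alpha>\<in>{1..n}. inv \<tau> \<alpha> \<ge> j}) =
    card (inversions n \<tau>) + card (Pair ?N ` {\<alpha>\<in>{1..n}. inv \<tau> \<alpha> \<ge> j})"
    by (rule card_Un_disjoint) (auto simp: finite_inversions, auto simp: inversions_def)
  moreover have "card (Pair ?N ` {\<alpha>\<in>{1..n}. inv \<tau> \<alpha> \<ge> j}) = card {\<alpha>\<in>{1..n}. inv \<tau> \<alpha> \<ge> j}"
    by (rule card_image) (auto simp: inj_on_def)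
  moreover have "bij_betw (inv \<tau>) {\<alpha>\<in>{1..n}. inv \<tau> \<alpha> \<ge> j} {j..n}"
  proof (rule bij_betwI[of _ _ _ \<tau>])
    show "inv \<tau> \<in> {\<alpha> \<in> {1..n}. j \<le> inv \<tau> \<alpha>} \<rightarrow> {j..n}"
      using inv_in by auto
    show "\<tau> \<in> {j..n} \<rightarrow> {\<alpha> \<in> {1..n}. j \<le> inv \<tau> \<alpha>}"
      using permutes_in_image[OF assms(1)] assms(2) by (auto simp: permutes_inverses[OF assms(1)])
  qed (auto simp: permutes_inverses[OF assms(1)])
  then have "card {\<alpha>\<in>{1..n}. inv \<tau> \<alpha> \<ge> j} = card {j..n}" by (rule bij_betw_same_card)
  ultimately show ?thesis by simp
qed

text \<open>Monotonicity of \<open>X\<close> makes \<open>J\<close> an interval ending at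
  \<open>N\<close>, so the exponents run through \<open>0, ..., card J - 1\<close>.\<close>

lemma sum_powers_top_stack:
  fixes q :: real and X :: "nat \<Rightarrow> int"
  assumes X: "\<And>i j. 1 \<le> i \<Longrightarrow> i \<le> j \<Longrightarrow> j \<le> N \<Longrightarrow> X j \<le> X i" and "q \<noteq> 1"
  defines "J \<equiv> {j\<in>{1..N}. X j = X N}"
  shows "(\<Sum>j\<in>J. q ^ (N - j)) = (1 - q ^ card J) / (1 - q)"
proof (cases "N = 0")
  case True
  then show ?thesis by (simp add: J_def)
next
  case False
  have "N \<in> J" "finite J" using False by (auto simp: J_def)
  define m where "m = Min J"
  have "J \<noteq> {}" using \<open>N \<in> J\<close> by blast
  have m: "m \<in> J" "\<And>j. j \<in> J \<Longrightarrow> m \<le> j"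
    unfolding m_def using Min_in[OF \<open>finite J\<close> \<open>J \<noteq> {}\<close>] Min_le[OF \<open>finite J\<close>] by blast+
  have J: "J = {m..N}"
  proof (intro equalityI subsetI)
    fix j assume "j \<in> {m..N}"
    then have "X j \<le> X m" "X N \<le> X j" using m(1) X[of m j] X[of j N] by (auto simp: J_def)
    then show "j \<in> J" using m \<open>j \<in> {m..N}\<close> by (auto simp: J_def)
  qed (use m in \<open>auto simp: J_def\<close>)
  have mN: "m \<le> N" using m by (auto simp: J_def)
  have "(\<Sum>j\<in>J. q ^ (N - j)) = (\<Sum>i<Suc N - m. q ^ i)"
    unfolding J by (rule sum.reindex_bij_witness[of _ "\<lambda>i. N - i" "\<lambda>j. N - j"]) (use mN in auto)
  also have "\<dots> = (1 - q ^ card J) / (1 - q)"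
    using sum_gp_strict[of q "Suc N - m"] \<open>q \<noteq> 1\<close> by (simp add: J)
  finally show ?thesis .
qed

definition stabilizer :: "nat \<Rightarrow> (nat \<Rightarrow> int) \<Rightarrow> (nat \<Rightarrow> nat) set" where
  "stabilizer n X = {\<sigma>. \<sigma> permutes {1..n} \<and> (\<forall>i\<in>{1..n}. X (\<sigma> i) = X i)}"

lemma Wt_superset: "finite T \<Longrightarrow> X ` {1..n} \<subseteq> T \<Longrightarrow> Wt q n X = (\<Prod>s\<in>T. qfact q (site_count n X s))"
  unfolding Wt_def
proof (rule prod.mono_neutral_left)
  show "\<forall>s\<in>T - X ` {1..n}. qfact q (site_count n X s) = 1"
  proof
    fix s assume "s \<in> T - X ` {1..n}"
    then have "{k \<in> {1..n}. X k = s} = {}" by auto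
    then show "qfact q (site_count n X s) = 1" by (simp add: site_count_def qfact_def)
  qed
qed

lemma Wt_Suc:
  "Wt q (Suc n) X = Wt q n X * ((1 - q ^ site_count (Suc n) X (X (Suc n))) / (1 - q))"
proof -
  let ?N = "Suc n" and ?T = "X ` {1..Suc n}"
  have sc: "site_count ?N X s = site_count n X s + (if s = X ?N then 1 else 0)" for s
  proof -
    have "{k \<in> {1..?N}. X k = s} = {k \<in> {1..n}. X k = s} \<union> (if s = X ?N then {?N} else {})"
      by (auto simp: le_Suc_eq)
    then show ?thesis by (auto simp: site_count_def)
  qed
  have "Wt q n X = (\<Prod>s\<in>?T. qfact q (site_count n X s))"
    by (rule Wt_superset) auto
  then have 1: "Wt q n X = qfact q (site_count n X (X ?N)) * (\<Prod>s\<in>?T - {X ?N}. qfact q (site_count n X s))"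
    by (subst (asm) prod.remove[of _ "X ?N"]) auto
  have "Wt q ?N X = qfact q (site_count ?N X (X ?N)) * (\<Prod>s\<in>?T - {X ?N}. qfact q (site_count ?N X s))"
    unfolding Wt_def by (subst prod.remove[of _ "X ?N"]) auto
  also have "(\<Prod>s\<in>?T - {X ?N}. qfact q (site_count ?N X s)) = (\<Prod>s\<in>?T - {X ?N}. qfact q (site_count n X s))"
    by (intro prod.cong refl) (auto simp: sc)
  also have "qfact q (site_count ?N X (X ?N)) =
     qfact q (site_count n X (X ?N)) * ((1 - q ^ site_count ?N X (X ?N)) / (1 - q))"
    by (simp add: sc qfact_def prod.cl_ivl_Suc)
  finally show ?thesis unfolding 1 by simp
qed

text \<open>The inversion generating function of a Young subgroup is a product of
  \<open>q\<close>-factorials. Each stabilizing permutation arises exactly once by inserting the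
  largest value at a position \<open>j\<close> of its own stack; these positions contribute the
  geometric sum that is the new factor of \<open>Wt\<close>.\<close>

lemma sum_stabilizer_inversions:
  fixes q :: real
  assumes "q \<noteq> 1" "\<And>i j. 1 \<le> i \<Longrightarrow> i \<le> j \<Longrightarrow> j \<le> n \<Longrightarrow> X j \<le> X i"
  shows "(\<Sum>\<sigma>\<in>stabilizer n X. q ^ card (inversions n \<sigma>)) = Wt q n X"
  using assms(2)
proof (induction n)
  case 0
  have "stabilizer 0 X = {id}" by (auto simp: stabilizer_def)
  then show ?case by (simp add: inversions_def Wt_def)
next
  case (Suc n)
  let ?N = "Suc n"
  define J where "J = {j\<in>{1..?N}. X j = X ?N}"
  have anti: "X j \<le> X i" if "1 \<le> i" "i \<le> j" "j \<le> ?N" for i j using Suc.prems that .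
  \<comment> \<open>Only positions from \<open>j\<close> to \<open>?N\<close> are moved, and by
    monotonicity all of them lie in the last stack.\<close>
  have cycX: "X (cyc ?N j i) = X i" if "j \<in> J" "i \<in> {1..?N}" for i j
  proof -
    have c: "X k = X ?N" if "k \<in> {j..?N}" for k
    proof -
      have "1 \<le> j" "X j = X ?N" using \<open>j \<in> J\<close> by (auto simp: J_def)
      then show ?thesis using anti[of j k] anti[of k ?N] that by force
    qed
    show ?thesis
    proof (cases "j < i")
      case True
      then have "i - 1 \<in> {j..?N}" "i \<in> {j..?N}" using \<open>i \<in> {1..?N}\<close> by auto
      from this[THEN c] show ?thesis using True \<open>i \<in> {1..?N}\<close> by (simp add: cyc_def)
    next
      case False
      then show ?thesis using \<open>j \<in> J\<close> by (simp add: cyc_def J_def)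
    qed
  qed
  have icycX: "X (icyc ?N j i) = X i" if "j \<in> J" "i \<in> {1..?N}" for i j
  proof -
    have "j \<in> {1..?N}" using that by (auto simp: J_def)
    then have "icyc ?N j i \<in> {1..?N}" using permutes_in_image[OF icyc_permutes] that by blast
    from cycX[OF that(1) this] show ?thesis using \<open>j \<in> {1..?N}\<close> by (simp add: cyc_icyc)
  qed
  have "(\<Sum>\<sigma>\<in>stabilizer ?N X. q ^ card (inversions ?N \<sigma>)) =
    (\<Sum>(\<tau>, j)\<in>stabilizer n X \<times> J. q ^ (card (inversions n \<tau>) + (?N - j)))"
  proof (rule sum.reindex_bij_witness[of _ "\<lambda>(\<tau>, j). \<tau> \<circ> cyc ?N j" "\<lambda>\<sigma>. (\<sigma> \<circ> icyc ?N (inv \<sigma> ?N), inv \<sigma> ?N)"])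
    fix \<sigma> assume "\<sigma> \<in> stabilizer ?N X"
    then have \<sigma>: "\<sigma> permutes {1..?N}" and X\<sigma>: "\<And>i. i \<in> {1..?N} \<Longrightarrow> X (\<sigma> i) = X i"
      by (auto simp: stabilizer_def)
    define j where "j = inv \<sigma> ?N"
    have j: "j \<in> {1..?N}" unfolding j_def using permutes_in_image[OF permutes_inv[OF \<sigma>]] by simp
    have \<sigma>j: "\<sigma> j = ?N" by (simp add: j_def permutes_inverses[OF \<sigma>])
    have jJ: "j \<in> J" using X\<sigma>[OF j] j \<sigma>j by (auto simp: J_def)
    define \<tau> where "\<tau> = \<sigma> \<circ> icyc ?N j"
    have \<tau>: "\<tau> permutes {1..?N}" unfolding \<tau>_def by (intro permutes_compose icyc_permutes j \<sigma>)
    have "\<tau> ?N = ?N" by (simp add: \<tau>_def icyc_def \<sigma>j)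
    have "\<tau> permutes {1..n}"
      by (rule permutes_superset[OF \<tau>]) (use \<open>\<tau> ?N = ?N\<close> in \<open>auto simp: le_Suc_eq\<close>)
    moreover have "X (\<tau> i) = X i" if "i \<in> {1..n}" for i
    proof -
      have i: "i \<in> {1..?N}" using that by auto
      then have "icyc ?N j i \<in> {1..?N}" using permutes_in_image[OF icyc_permutes[OF j]] by blast
      then show ?thesis using X\<sigma> icycX[OF jJ i] by (simp add: \<tau>_def)
    qed
    ultimately have \<tau>s: "\<tau> \<in> stabilizer n X" by (auto simp: stabilizer_def)
    have \<sigma>_eq: "\<tau> \<circ> cyc ?N j = \<sigma>" using j by (auto simp: \<tau>_def fun_eq_iff cyc_icyc)
    show "(\<lambda>(\<tau>, j). \<tau> \<circ> cyc ?N j) (\<sigma> \<circ> icyc ?N (inv \<sigma> ?N), inv \<sigma> ?N) = \<sigma>"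
      using \<sigma>_eq by (simp add: \<tau>_def j_def)
    show "(\<sigma> \<circ> icyc ?N (inv \<sigma> ?N), inv \<sigma> ?N) \<in> stabilizer n X \<times> J"
      using \<tau>s jJ by (simp add: \<tau>_def j_def)
    have "card (inversions ?N \<sigma>) = card (inversions n \<tau>) + (?N - j)"
      using card_inversions_comp_cyc[OF \<open>\<tau> permutes {1..n}\<close> j] by (simp only: \<sigma>_eq)
    then show "(case (\<sigma> \<circ> icyc ?N (inv \<sigma> ?N), inv \<sigma> ?N) of (\<tau>, j) \<Rightarrow> q ^ (card (inversions n \<tau>) + (?N - j))) = q ^ card (inversions ?N \<sigma>)"
      by (simp add: \<tau>_def j_def)
  next
    fix p assume p: "p \<in> stabilizer n X \<times> J"
    obtain \<tau> j where p_eq: "p = (\<tau>, j)" by (cases p)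
    with p have \<tau>: "\<tau> permutes {1..n}" and X\<tau>: "\<And>i. i \<in> {1..n} \<Longrightarrow> X (\<tau> i) = X i" and jJ: "j \<in> J"
      by (auto simp: stabilizer_def)
    have j: "j \<in> {1..?N}" using jJ by (auto simp: J_def)
    have \<tau>': "\<tau> permutes {1..?N}" using permutes_subset[OF \<tau>] by auto
    have \<sigma>: "\<tau> \<circ> cyc ?N j permutes {1..?N}" by (intro permutes_compose cyc_permutes j \<tau>')
    have \<tau>N: "\<tau> ?N = ?N" using permutes_not_in[OF \<tau>] by simp
    have "inv (\<tau> \<circ> cyc ?N j) ?N = j"
      using permutes_inverses(2)[OF \<sigma>, of j] by (simp add: cyc_def \<tau>N)
    moreover have "\<tau> \<circ> cyc ?N j \<circ> icyc ?N j = \<tau>"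
      using j by (auto simp: fun_eq_iff cyc_icyc)
    ultimately show "(\<lambda>\<sigma>. (\<sigma> \<circ> icyc ?N (inv \<sigma> ?N), inv \<sigma> ?N)) ((\<lambda>(\<tau>, j). \<tau> \<circ> cyc ?N j) p) = p"
      by (simp add: p_eq)
    have "X (\<tau> (cyc ?N j i)) = X i" if i: "i \<in> {1..?N}" for i
    proof -
      have "cyc ?N j i \<in> {1..?N}" using permutes_in_image[OF cyc_permutes[OF j]] i by blast
      then have "X (\<tau> (cyc ?N j i)) = X (cyc ?N j i)" using X\<tau> \<tau>N by (cases "cyc ?N j i = ?N") auto
      then show ?thesis using cycX[OF jJ i] by simp
    qed
    then show "(\<lambda>(\<tau>, j). \<tau> \<circ> cyc ?N j) p \<in> stabilizer ?N X"
      using \<sigma> by (auto simp: p_eq stabilizer_def)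
  qed
  also have "\<dots> = (\<Sum>\<tau>\<in>stabilizer n X. q ^ card (inversions n \<tau>)) * (\<Sum>j\<in>J. q ^ (?N - j))"
    by (simp add: sum.cartesian_product[symmetric] power_add sum_product)
  also have "(\<Sum>\<tau>\<in>stabilizer n X. q ^ card (inversions n \<tau>)) = Wt q n X"
    using anti by (intro Suc.IH) auto
  also have "(\<Sum>j\<in>J. q ^ (?N - j)) = (1 - q ^ site_count ?N X (X ?N)) / (1 - q)"
    using sum_powers_top_stack[of ?N X q] anti \<open>q \<noteq> 1\<close> by (simp add: J_def site_count_def)
  finally show ?case by (simp add: Wt_Suc)
qed

lemma qfact_nonzero:
  assumes "0 < q" "q < 1"
  shows "qfact q k \<noteq> 0"
proof -
  have "q ^ j \<noteq> 1" if "j \<in> {1..k}" for j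
    using power_strict_decreasing[of 0 j q] assms that by simp
  then show ?thesis using assms by (auto simp: qfact_def)
qed

lemma Wt_nonzero: "0 < q \<Longrightarrow> q < 1 \<Longrightarrow> Wt q n X \<noteq> 0"
  by (simp add: Wt_def qfact_nonzero)

text \<open>A weakly decreasing configuration is determined by the multiset of its positions; after
  negation this is uniqueness of the sorted list.\<close>

lemma Weyl_permuted_eq:
  assumes "X \<in> Weyl n" "Y \<in> Weyl n" "\<sigma> permutes {1..n}" "\<And>i. i \<in> {1..n} \<Longrightarrow> Y (\<sigma> i) = X i"
  shows "X = Y"
proof -
  have sorted: "sorted (map (\<lambda>i. - U i) [1..<Suc n])" if "U \<in> Weyl n" for U
    using that by (auto simp: sorted_iff_nth_mono Weyl_def simp del: upt_Suc)
  have "mset (map (\<lambda>i. - X i) [1..<Suc n]) = image_mset (\<lambda>i. - Y i) (image_mset \<sigma> (mset_set {1..n}))"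
    using assms(4) by (auto simp: multiset.map_comp o_def atLeastLessThanSuc_atLeastAtMost simp del: upt_Suc
      intro!: image_mset_cong)
  also have "image_mset \<sigma> (mset_set {1..n}) = mset_set {1..n}"
    using image_mset_mset_set[OF permutes_inj_on[OF assms(3)], of "{1..n}"] permutes_image[OF assms(3)] by simp
  finally have "mset (map (\<lambda>i. - X i) [1..<Suc n]) = mset (map (\<lambda>i. - Y i) [1..<Suc n])"
    by (simp add: atLeastLessThanSuc_atLeastAtMost del: upt_Suc)
  from properties_for_sort[OF this sorted] have "map (\<lambda>i. - X i) [1..<Suc n] = map (\<lambda>i. - Y i) [1..<Suc n]"
    using assms(1,2) sorted sorted_sort_id by metis
  then have "\<forall>i\<in>{1..n}. X i = Y i" by (auto simp del: upt_Suc)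
  with assms(1,2) show ?thesis
    by (intro PiE_ext[of X "{1..n}" "\<lambda>_. UNIV" Y]) (auto simp: Weyl_def)
qed

section \<open>The backward equation of the \<open>q\<close>-TAZRP\<close>

text \<open>Let \<open>c k\<close> count the particles of the stack of \<open>k\<close> with index
  at least \<open>k\<close>, and \<open>e k = (1 - q ^ c k) * D k\<close>. Inside a stack
  \<open>c\<close> drops by one while \<open>D\<close> gains a factor \<open>q\<close>, so
  \<open>(1 - q) * D k = e k - e (Suc k)\<close>. Each stack telescopes to its top particle, where
  \<open>c\<close> is the full height.\<close>

lemma sum_stack_telescope:
  fixes D :: "nat \<Rightarrow> complex" and q :: real
  assumes Y: "Y \<in> Weyl n"
    and D: "\<And>k. 1 \<le> k \<Longrightarrow> k < n \<Longrightarrow> Y (Suc k) = Y k \<Longrightarrow> D (Suc k) = of_real q * D k"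
  shows "(1 - of_real q) * (\<Sum>k=1..n. D k) =
    (\<Sum>k | k \<in> {1..n} \<and> (k = 1 \<or> Y (k - 1) > Y k). (1 - of_real q ^ site_count n Y (Y k)) * D k)"
proof (cases "n = 0")
  case False
  define c where "c k = card {i\<in>{k..n}. Y i = Y k}" for k
  define e where "e k = (1 - of_real q ^ c k) * D k" for k
  \<comment> \<open>\<open>g\<close> is \<open>e\<close> restricted to the particles that are not on
    top of their stack. Subtracting it after an index shift leaves the tops.\<close>
  define g where "g k = (if 1 < k \<and> Y (k - 1) = Y k then e k else 0)" for k
  have anti: "Y j \<le> Y i" if "1 \<le> i" "i \<le> j" "j \<le> n" for i j
    using Y that by (auto simp: Weyl_def)
  have "(1 - of_real q) * D k = e k - (if k < n then g (Suc k) else 0)" if k: "k \<in> {1..n}" for k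
  proof (cases "k < n \<and> Y (Suc k) = Y k")
    case True
    then have "{i\<in>{k..n}. Y i = Y k} = insert k {i\<in>{Suc k..n}. Y i = Y (Suc k)}" using k by auto
    then have "c k = Suc (c (Suc k))" by (simp add: c_def)
    then show ?thesis using True k D[of k] by (simp add: g_def e_def algebra_simps)
  next
    case False
    have less: "Y i < Y k" if "i \<in> {k<..n}" for i
      using anti[of "Suc k" i] anti[of k "Suc k"] that k False by force
    have "i = k" if "i \<in> {k..n}" "Y i = Y k" for i
      using less[of i] that by (cases "i = k") auto
    then have "{i\<in>{k..n}. Y i = Y k} = {k}" using k by auto
    then have "c k = 1" by (simp add: c_def)
    then show ?thesis using False k by (auto simp: g_def e_def)
  qed
  then have "(1 - of_real q) * (\<Sum>k=1..n. D k) = (\<Sum>k=1..n. e k) - (\<Sum>k=1..n. if k < n then g (Suc k) else 0)"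
    by (simp add: sum_distrib_left sum_subtractf)
  also have "(\<Sum>k=1..n. if k < n then g (Suc k) else 0) = (\<Sum>k=1..<n. g (Suc k))"
    by (rule sum.mono_neutral_cong_right) auto
  also have "\<dots> = (\<Sum>k=Suc 1..<Suc n. g k)"
    by (rule sum.shift_bounds_Suc_ivl[symmetric])
  also have "\<dots> = (\<Sum>k=1..n. g k)"
    by (rule sum.mono_neutral_left) (auto simp: g_def)
  also have "(\<Sum>k=1..n. e k) - (\<Sum>k=1..n. g k) = (\<Sum>k=1..n. if k = 1 \<or> Y (k - 1) > Y k then e k else 0)"
    unfolding sum_subtractf[symmetric]
  proof (intro sum.cong refl)
    fix k assume "k \<in> {1..n}"
    then have "k = 1 \<or> Y k \<le> Y (k - 1)" using anti[of "k - 1" k] by force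
    then show "e k - g k = (if k = 1 \<or> Y (k - 1) > Y k then e k else 0)"
      using \<open>k \<in> {1..n}\<close> by (auto simp: g_def)
  qed
  also have "\<dots> = (\<Sum>k | k \<in> {1..n} \<and> (k = 1 \<or> Y (k - 1) > Y k). e k)"
    by (rule sum.inter_filter[symmetric]) simp
  also have "\<dots> = (\<Sum>k | k \<in> {1..n} \<and> (k = 1 \<or> Y (k - 1) > Y k). (1 - of_real q ^ site_count n Y (Y k)) * D k)"
  proof (intro sum.cong refl)
    fix k assume k: "k \<in> {k. k \<in> {1..n} \<and> (k = 1 \<or> Y (k - 1) > Y k)}"
    have "Y i > Y k" if "i \<in> {1..<k}" for i
      using anti[of i "k - 1"] that k by force
    then have "{i\<in>{k..n}. Y i = Y k} = {i\<in>{1..n}. Y i = Y k}" using k by force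
    then show "e k = (1 - of_real q ^ site_count n Y (Y k)) * D k"
      by (simp add: e_def c_def site_count_def)
  qed
  finally show ?thesis .
qed simp

text \<open>Composing with \<open>s\<close> exchanges the values \<open>k\<close> and
  \<open>Suc k\<close> in the word of \<sigma>. As \<open>k\<close> stands to the left, this creates
  the inversion \<open>(Suc k, k)\<close> and relabels all others; the relabelling is absorbed by
  exchanging the two variables.\<close>

lemma A_coeff_transpose:
  assumes \<sigma>: "\<sigma> permutes {1..n}" and k: "1 \<le> k" "k < n" and less: "inv \<sigma> k < inv \<sigma> (Suc k)"
  defines "s \<equiv> Transposition.transpose k (Suc k)"
  shows "A_coeff q n (s \<circ> \<sigma>) w = S_factor q w (Suc k) k * A_coeff q n \<sigma> (w \<circ> s)"
proof -
  have s_perm: "s permutes {1..n}" unfolding s_def by (rule permutes_swap_id) (use k in auto)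
  have ss: "s (s i) = i" for i by (simp add: s_def)
  have "inv s = s" by (rule inv_unique_comp) (auto simp: fun_eq_iff ss)
  then have inv: "inv (s \<circ> \<sigma>) i = inv \<sigma> (s i)" for i
    using permutes_bij[OF \<sigma>] permutes_bij[OF s_perm] by (simp add: o_inv_distrib)
  have s_in: "s i \<in> {1..n} \<longleftrightarrow> i \<in> {1..n}" for i using permutes_in_image[OF s_perm] .
  \<comment> \<open>An adjacent transposition reverses the order of just one pair of values.\<close>
  have mono: "s \<alpha> < s \<beta>" if "\<alpha> < \<beta>" "(\<beta>, \<alpha>) \<noteq> (Suc k, k)" for \<alpha> \<beta>
    using that by (auto simp: s_def Transposition.transpose_def)
  let ?f = "\<lambda>(\<beta>, \<alpha>). (s \<beta>, s \<alpha>)"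
  have s_k: "s k = Suc k" "s (Suc k) = k" by (auto simp: s_def)
  have *: "inversions n (s \<circ> \<sigma>) = insert (Suc k, k) (?f ` inversions n \<sigma>)"
  proof (intro set_eqI iffI)
    fix e assume e: "e \<in> inversions n (s \<circ> \<sigma>)"
    obtain \<beta> \<alpha> where e_eq: "e = (\<beta>, \<alpha>)" by (cases e)
    show "e \<in> insert (Suc k, k) (?f ` inversions n \<sigma>)"
    proof (cases "e = (Suc k, k)")
      case False
      then have "(s \<beta>, s \<alpha>) \<in> inversions n \<sigma>"
        using e mono[of \<alpha> \<beta>] s_in unfolding e_eq inversions_def by (auto simp: inv)
      then have "?f (s \<beta>, s \<alpha>) \<in> ?f ` inversions n \<sigma>" by (rule imageI)
      then show ?thesis by (simp add: ss e_eq)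
    qed simp
  next
    fix e assume "e \<in> insert (Suc k, k) (?f ` inversions n \<sigma>)"
    then consider "e = (Suc k, k)" | \<beta> \<alpha> where "e = (s \<beta>, s \<alpha>)" "(\<beta>, \<alpha>) \<in> inversions n \<sigma>" by auto
    then show "e \<in> inversions n (s \<circ> \<sigma>)"
    proof cases
      case 1
      then show ?thesis using k less by (auto simp: inversions_def inv s_k)
    next
      case 2
      then have "(\<beta>, \<alpha>) \<noteq> (Suc k, k)" using less by (auto simp: inversions_def)
      then show ?thesis using 2 mono[of \<alpha> \<beta>] s_in unfolding inversions_def by (auto simp: inv ss)
    qed
  qed
  have inj: "inj_on ?f (inversions n \<sigma>)" by (rule inj_on_inverseI[of _ ?f]) (auto simp: ss)
  have "(Suc k, k) \<notin> ?f ` inversions n \<sigma>"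
  proof
    assume "(Suc k, k) \<in> ?f ` inversions n \<sigma>"
    then obtain \<beta> \<alpha> where "(\<beta>, \<alpha>) \<in> inversions n \<sigma>" "s \<beta> = Suc k" "s \<alpha> = k" by auto
    then have "\<beta> = k" "\<alpha> = Suc k" using ss[of \<beta>] ss[of \<alpha>] s_k by auto
    with \<open>(\<beta>, \<alpha>) \<in> inversions n \<sigma>\<close> show False by (simp add: inversions_def)
  qed
  then have "A_coeff q n (s \<circ> \<sigma>) w = S_factor q w (Suc k) k * (\<Prod>(\<beta>, \<alpha>)\<in>?f ` inversions n \<sigma>. S_factor q w \<beta> \<alpha>)"
    unfolding A_coeff_def * by (subst prod.insert) (auto simp: finite_inversions)
  also have "(\<Prod>(\<beta>, \<alpha>)\<in>?f ` inversions n \<sigma>. S_factor q w \<beta> \<alpha>) = A_coeff q n \<sigma> (w \<circ> s)"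
    unfolding A_coeff_def by (subst prod.reindex[OF inj]) (auto simp: S_factor_def intro!: prod.cong)
  finally show ?thesis .
qed

section \<open>The formula as a function of the starting state\<close>

locale tazrp_formula =
  fixes n :: nat and q :: real and a :: "int \<Rightarrow> real" and X :: "nat \<Rightarrow> int" and R :: real
  assumes n: "n \<ge> 1" and q: "0 < q" "q < 1" and a: "\<And>i. a i > 0" and X: "X \<in> Weyl n" and R: "R > 0"
begin

abbreviation b :: "int \<Rightarrow> real" where "b \<equiv> b_of q a"

lemma b_pos: "b k > 0"
  using a q by (simp add: b_of_def)

text \<open>Every \<open>Y i\<close> is compared with every \<open>X j\<close>, because each pair is
  matched by some permutation. If \<open>X j < Y i\<close> nothing is required, in accordance with
  the site product being a polynomial there.\<close>

definition admissible :: "(nat \<Rightarrow> int) \<Rightarrow> bool" where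
  "admissible Y \<longleftrightarrow> (\<forall>i\<in>{1..n}. \<forall>j\<in>{1..n}. \<forall>k. Y i \<le> k \<longrightarrow> k \<le> X j \<longrightarrow> b k < R)"

text \<open>The product is indexed by the variable \<open>m = \<sigma> j\<close> instead of
  \<open>j\<close>. In this form \<open>Y m\<close> belongs to \<open>w m\<close> for every
  \<sigma>, and the permutation acts on the sites of \<open>X\<close> alone.\<close>

definition bethe_term :: "(nat \<Rightarrow> int) \<Rightarrow> (nat \<Rightarrow> nat) \<Rightarrow> (nat \<Rightarrow> complex) \<Rightarrow> complex" where
  "bethe_term Y \<sigma> = bethe_prod q b (inversions n \<sigma>) {1..n} Y (\<lambda>m. X (inv \<sigma> m))"

definition \<Phi> :: "(nat \<Rightarrow> int) \<Rightarrow> (nat \<Rightarrow> complex) \<Rightarrow> complex" where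
  "\<Phi> Y w = (\<Sum>\<sigma> | \<sigma> permutes {1..n}. bethe_term Y \<sigma> w)"

definition decay :: "real \<Rightarrow> (nat \<Rightarrow> complex) \<Rightarrow> complex" where
  "decay t w = exp (- (\<Sum>j=1..n. w j) * of_real t)"

abbreviation torus :: "(nat \<Rightarrow> complex) set" where "torus \<equiv> polycircle R {1..n}"

abbreviation integral_torus :: "((nat \<Rightarrow> complex) \<Rightarrow> complex) \<Rightarrow> complex" where
  "integral_torus F \<equiv> circ_int R [1..<Suc n] F (\<lambda>_. 0)"

lemma set_upt_n: "set [1..<Suc n] = {1..n}"
  by auto

lemma polycircle_upt:
  "polycircle R ({} \<union> set [1..<Suc n]) = torus" "polycircle R (set [1..<Suc n]) = torus"
  "polycircle R (set [1..<Suc n] - {p}) = polycircle R ({1..n} - {p})"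
  unfolding set_upt_n by simp_all

lemma permutes_range:
  assumes "\<sigma> permutes {1..n}" "m \<in> {1..n}"
  shows "inv \<sigma> m \<in> {1..n}"
  using permutes_in_image[OF permutes_inv[OF assms(1)], of m] assms(2) by simp

lemma inversions_subset: "inversions n \<sigma> \<subseteq> {(\<beta>, \<alpha>). \<alpha> \<in> {1..n} \<and> \<beta> \<in> {1..n} \<and> \<alpha> < \<beta>}"
  by (auto simp: inversions_def)

lemma integrand_eq:
  assumes "\<sigma> permutes {1..n}"
  shows "A_coeff q n \<sigma> w * (\<Prod>j=1..n.
     primed_prod (Y (\<sigma> j)) (X j) (\<lambda>k. of_real (b k) / (of_real (b k) - w (\<sigma> j))) * exp (- w j * of_real t)) =
     bethe_term Y \<sigma> w * decay t w"
proof -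
  have "(\<Prod>j=1..n. primed_prod (Y (\<sigma> j)) (X j) (\<lambda>k. of_real (b k) / (of_real (b k) - w (\<sigma> j)))) =
    (\<Prod>j=1..n. site_prod b (Y (\<sigma> j)) (X (inv \<sigma> (\<sigma> j))) (w (\<sigma> j)))"
    by (simp add: site_prod_def permutes_inverses[OF assms])
  also have "\<dots> = (\<Prod>m=1..n. site_prod b (Y m) (X (inv \<sigma> m)) (w m))"
    using prod.permute[OF assms, of "\<lambda>m. site_prod b (Y m) (X (inv \<sigma> m)) (w m)"] by (simp add: o_def)
  finally have 1: "(\<Prod>j=1..n. primed_prod (Y (\<sigma> j)) (X j) (\<lambda>k. of_real (b k) / (of_real (b k) - w (\<sigma> j)))) =
    (\<Prod>m=1..n. site_prod b (Y m) (X (inv \<sigma> m)) (w m))" .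
  have 2: "(\<Prod>j=1..n. exp (- w j * of_real t)) = decay t w"
    by (simp add: decay_def sum_distrib_right sum_negf flip: exp_sum)
  show ?thesis
    unfolding prod.distrib 1 2 by (simp add: bethe_term_def bethe_prod_def A_coeff_def)
qed

lemma continuous_on_bethe_term:
  assumes "admissible Y" "\<sigma> permutes {1..n}"
  shows "continuous_on torus (bethe_term Y \<sigma>)"
  unfolding bethe_term_def
proof (rule continuous_on_bethe_prod[OF q R b_pos _ inversions_subset])
  fix m k assume "m \<in> {1..n}" "Y m \<le> k" "k \<le> X (inv \<sigma> m)"
  then show "b k < R"
    using assms(1) permutes_range[OF assms(2)] unfolding admissible_def by blast
qed simp

lemma continuous_on_\<Phi>: "admissible Y \<Longrightarrow> continuous_on torus (\<Phi> Y)"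
  unfolding \<Phi>_def by (intro continuous_intros continuous_on_bethe_term) auto

lemma continuous_on_decay: "continuous_on torus (decay t)"
  unfolding decay_def by (intro continuous_intros)

lemma \<Phi>_bounded:
  assumes "admissible Y"
  shows "\<exists>B. \<forall>w\<in>torus. norm (\<Phi> Y w) \<le> B"
proof (rule compact_polycircle_bounded[OF continuous_on_\<Phi>[OF assms]])
  fix w
  have "bethe_term Y \<sigma> (\<lambda>j. if j \<in> {1..n} then w j else 0) = bethe_term Y \<sigma> w" for \<sigma>
    unfolding bethe_term_def bethe_prod_def
    by (intro arg_cong2[of _ _ _ _ "(*)"] prod.cong) (auto simp: S_factor_def inversions_def)
  then show "\<Phi> Y (\<lambda>j. if j \<in> {1..n} then w j else 0) = \<Phi> Y w"
    by (simp add: \<Phi>_def)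
qed

definition solution :: "(nat \<Rightarrow> int) \<Rightarrow> real \<Rightarrow> complex" where
  "solution Y t = integral_torus (\<lambda>w. \<Phi> Y w * decay t w)"

text \<open>The \<open>k\<close>-th summand of the time derivative of \<open>solution Y\<close>:
  differentiating \<open>decay\<close> brings down \<open>- w k\<close> for each
  \<open>k\<close>.\<close>

definition weighted :: "(nat \<Rightarrow> int) \<Rightarrow> real \<Rightarrow> nat \<Rightarrow> complex" where
  "weighted Y t k = integral_torus (\<lambda>w. - w k * (\<Phi> Y w * decay t w))"

lemma cont_w\<Phi>: "admissible Y \<Longrightarrow> continuous_on torus (\<lambda>w. - w k * (\<Phi> Y w * decay t w))"
  by (intro continuous_intros continuous_on_\<Phi> continuous_on_decay)

lemma solution_sum:
  assumes "admissible Y"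
  shows "solution Y t = (\<Sum>\<sigma> | \<sigma> permutes {1..n}. integral_torus (\<lambda>w. bethe_term Y \<sigma> w * decay t w))"
  unfolding solution_def \<Phi>_def sum_distrib_right
proof (rule circ_int_sum[OF R, of _ "{}"])
  fix \<sigma> assume "\<sigma> \<in> {\<sigma>. \<sigma> permutes {1..n}}"
  then show "continuous_on (polycircle R ({} \<union> set [1..<Suc n])) (\<lambda>w. bethe_term Y \<sigma> w * decay t w)"
    unfolding polycircle_upt by (intro continuous_on_mult continuous_on_bethe_term continuous_on_decay assms) simp
qed (simp_all add: finite_permutations)

lemma solution_deriv:
  assumes "admissible Y"
  shows "(solution Y has_vector_derivative (\<Sum>k=1..n. weighted Y t k)) (at t)"
proof -
  obtain B where B: "\<And>w. w \<in> torus \<Longrightarrow> norm (\<Phi> Y w) \<le> B"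
    using \<Phi>_bounded[OF assms] by blast
  have "(solution Y has_vector_derivative
      integral_torus (\<lambda>w. - (\<Sum>k=1..n. w k) * (\<Phi> Y w * decay t w))) (at t)"
    using circ_int_exp_derivative[of R "[1..<Suc n]" "\<Phi> Y" B, unfolded set_upt_n, OF R continuous_on_\<Phi>[OF assms] B]
    unfolding solution_def[abs_def] decay_def by simp
  also have "(\<lambda>w. - (\<Sum>k=1..n. w k) * (\<Phi> Y w * decay t w)) = (\<lambda>w. \<Sum>k=1..n. - w k * (\<Phi> Y w * decay t w))"
    by (simp add: sum_distrib_right sum_negf)
  also have "integral_torus \<dots> = (\<Sum>k=1..n. weighted Y t k)"
    unfolding weighted_def
  proof (rule circ_int_sum[OF R, of _ "{}"])
    show "continuous_on (polycircle R ({} \<union> set [1..<Suc n])) (\<lambda>w. - w k * (\<Phi> Y w * decay t w))" for k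
      unfolding polycircle_upt by (rule cont_w\<Phi>[OF assms])
  qed simp_all
  finally show ?thesis .
qed

lemma admissible_step:
  assumes "admissible Y"
  shows "admissible (Y(k := Y k + 1))"
  unfolding admissible_def
proof (intro ballI allI impI)
  fix i j l assume "i \<in> {1..n}" "j \<in> {1..n}" "(Y(k := Y k + 1)) i \<le> l" "l \<le> X j"
  moreover from this have "Y i \<le> l" by (cases "i = k") auto
  ultimately show "b l < R" using assms unfolding admissible_def by blast
qed

text \<open>\<open>Y k\<close> enters through the variable \<open>w k\<close> only, and the
  resulting factor does not depend on \<sigma>, so the relation passes to the sum \<Phi>.\<close>

lemma bethe_term_step:
  assumes "admissible Y" "k \<in> {1..n}" "\<sigma> permutes {1..n}" "w \<in> torus"
  shows "of_real (b (Y k)) * bethe_term (Y(k := Y k + 1)) \<sigma> w = bethe_term Y \<sigma> w * (of_real (b (Y k)) - w k)"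
proof -
  have "of_real (b (Y k)) * site_prod b (Y k + 1) (X (inv \<sigma> k)) (w k) =
    site_prod b (Y k) (X (inv \<sigma> k)) (w k) * (of_real (b (Y k)) - w k)"
  proof (rule site_prod_shift[OF b_pos])
    assume "Y k \<le> X (inv \<sigma> k)"
    then have "b (Y k) < R"
      using assms(1,2) permutes_range[OF assms(3,2)] unfolding admissible_def by blast
    moreover have "norm (w k) = R" using assms by (auto simp: polycircle_def)
    ultimately show "of_real (b (Y k)) \<noteq> w k" using of_real_neq_on_circle[OF _ b_pos] by auto
  qed
  moreover have "(\<Prod>m\<in>{1..n} - {k}. site_prod b ((Y(k := Y k + 1)) m) (X (inv \<sigma> m)) (w m)) =
    (\<Prod>m\<in>{1..n} - {k}. site_prod b (Y m) (X (inv \<sigma> m)) (w m))"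
    by (intro prod.cong) auto
  ultimately show ?thesis
    unfolding bethe_term_def bethe_prod_def using assms(2) by (simp add: prod.remove)
qed

lemma weighted_eq:
  assumes "admissible Y" "k \<in> {1..n}"
  shows "weighted Y t k = of_real (b (Y k)) * (solution (Y(k := Y k + 1)) t - solution Y t)"
proof -
  let ?Y' = "Y(k := Y k + 1)" and ?b = "complex_of_real (b (Y k))"
  have c: "continuous_on (polycircle R ({} \<union> set [1..<Suc n])) (\<lambda>w. \<Phi> Z w * decay t w)" if "admissible Z" for Z
    unfolding polycircle_upt using that by (intro continuous_intros continuous_on_\<Phi> continuous_on_decay)
  have w0: "(\<lambda>_. 0) \<in> polycircle R {}" by simp
  have "weighted Y t k = integral_torus (\<lambda>w. ?b * (\<Phi> ?Y' w * decay t w) + (- ?b) * (\<Phi> Y w * decay t w))"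
    unfolding weighted_def
  proof (rule circ_int_cong[OF R _ w0])
    fix w assume "w \<in> polycircle R ({} \<union> set [1..<Suc n])"
    then have w: "w \<in> torus" unfolding polycircle_upt .
    have "?b * \<Phi> ?Y' w = \<Phi> Y w * (?b - w k)"
      unfolding \<Phi>_def sum_distrib_left sum_distrib_right
      by (intro sum.cong refl) (use bethe_term_step[OF assms _ w] in auto)
    then have "?b * \<Phi> ?Y' w * decay t w = \<Phi> Y w * (?b - w k) * decay t w" by simp
    then show "- w k * (\<Phi> Y w * decay t w) = ?b * (\<Phi> ?Y' w * decay t w) + (- ?b) * (\<Phi> Y w * decay t w)"
      by (simp add: algebra_simps)
  qed
  also have "\<dots> = integral_torus (\<lambda>w. ?b * (\<Phi> ?Y' w * decay t w)) + integral_torus (\<lambda>w. (- ?b) * (\<Phi> Y w * decay t w))"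
    by (rule circ_int_add[OF R _ _ w0]) (intro continuous_intros c assms(1) admissible_step)+
  also have "\<dots> = ?b * solution ?Y' t + (- ?b) * solution Y t"
    unfolding solution_def by (intro arg_cong2[of _ _ _ _ "(+)"] circ_int_cmult[OF R _ w0] c assms(1) admissible_step)
  finally show ?thesis by (simp add: algebra_simps)
qed

text \<open>For \<open>Y k = Y (k + 1)\<close> the factor \<open>w\<^bsub>k+1\<^esub> - q w\<^sub>k\<close> makes the integrand
  antisymmetric in \<open>w\<^sub>k\<close> and \<open>w\<^bsub>k+1\<^esub>\<close>.\<close>

lemma bethe_term_antisymmetric:
  assumes k: "1 \<le> k" "k < n" and Y: "Y (Suc k) = Y k" and \<sigma>: "\<sigma> permutes {1..n}" and w: "w \<in> torus"
  defines "s \<equiv> Transposition.transpose k (Suc k)"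
  shows "(w k - of_real q * w (Suc k)) * bethe_term Y \<sigma> (w \<circ> s) = - ((w (Suc k) - of_real q * w k) * bethe_term Y (s \<circ> \<sigma>) w)"
proof -
  have s_perm: "s permutes {1..n}" unfolding s_def by (rule permutes_swap_id) (use k in auto)
  have ss: "s (s i) = i" "s \<circ> s = id" for i by (auto simp: s_def)
  have sk: "s k = Suc k" "s (Suc k) = k" by (auto simp: s_def)
  have "inv s = s" by (rule inv_unique_comp) (auto simp: ss)
  then have inv: "inv (s \<circ> \<sigma>) i = inv \<sigma> (s i)" for i
    using permutes_bij[OF \<sigma>] permutes_bij[OF s_perm] by (simp add: o_inv_distrib)
  \<comment> \<open>Here the coincidence of the two particles enters: exchanging the variables then
    amounts to exchanging their sites in \<open>X\<close>, that is, to passing from \<sigma> to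
    \<open>s \<circ> \<sigma>\<close>.\<close>
  have Ys: "Y (s m) = Y m" for m using Y by (auto simp: s_def Transposition.transpose_def)
  have sites: "(\<Prod>m=1..n. site_prod b (Y m) (X (inv (s \<circ> \<sigma>) m)) (w m)) =
    (\<Prod>m=1..n. site_prod b (Y m) (X (inv \<sigma> m)) ((w \<circ> s) m))"
    unfolding prod.permute[OF s_perm, of "\<lambda>m. site_prod b (Y m) (X (inv (s \<circ> \<sigma>) m)) (w m)"]
    by (intro prod.cong refl) (simp only: o_apply inv ss Ys)
  have bethe_term_A: "bethe_term Y \<tau> v = A_coeff q n \<tau> v * (\<Prod>m=1..n. site_prod b (Y m) (X (inv \<tau> m)) (v m))" for \<tau> v
    by (simp add: bethe_term_def bethe_prod_def A_coeff_def)
  have norm_w: "norm (w k) = R" "norm (w (Suc k)) = R" using w k by (auto simp: polycircle_def)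
  have nz: "of_real q * w k - w (Suc k) \<noteq> 0" "of_real q * w (Suc k) - w k \<noteq> 0"
    by (rule S_factor_denominator[OF q R]; simp add: norm_w)+
  \<comment> \<open>One of \<sigma> and \<open>s \<circ> \<sigma>\<close> has \<open>k\<close> to
    the left of \<open>Suc k\<close>, and the other has one more inversion, with its factor
    \<open>S_factor\<close>. The prefactor cancels the denominator of that factor; the second case
    is the first with \<open>s \<circ> \<sigma>\<close> and exchanged variables.\<close>
  have A: "(w k - of_real q * w (Suc k)) * A_coeff q n \<sigma> (w \<circ> s) =
    - ((w (Suc k) - of_real q * w k) * A_coeff q n (s \<circ> \<sigma>) w)"
  proof (cases "inv \<sigma> k < inv \<sigma> (Suc k)")
    case True
    from A_coeff_transpose[OF \<sigma> k this, of q w]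
    have "A_coeff q n (s \<circ> \<sigma>) w = S_factor q w (Suc k) k * A_coeff q n \<sigma> (w \<circ> s)"
      by (simp add: s_def)
    moreover have "(w (Suc k) - of_real q * w k) * S_factor q w (Suc k) k = of_real q * w (Suc k) - w k"
      using nz by (simp add: S_factor_def field_simps)
    ultimately show ?thesis by (simp flip: mult.assoc) (simp add: algebra_simps)
  next
    case False
    have "inv \<sigma> k \<noteq> inv \<sigma> (Suc k)"
      using inj_eq[OF permutes_inj[OF permutes_inv[OF \<sigma>]], of k "Suc k"] by simp
    with False have less: "inv (s \<circ> \<sigma>) k < inv (s \<circ> \<sigma>) (Suc k)" by (simp add: inv sk)
    have "s \<circ> (s \<circ> \<sigma>) = \<sigma>" "w \<circ> s \<circ> s = w" by (simp_all add: ss o_assoc[symmetric]) (simp add: o_assoc ss)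
    with A_coeff_transpose[OF permutes_compose[OF \<sigma> s_perm] k less, of q "w \<circ> s"]
    have "A_coeff q n \<sigma> (w \<circ> s) = S_factor q (w \<circ> s) (Suc k) k * A_coeff q n (s \<circ> \<sigma>) w"
      by (simp add: s_def)
    moreover have "(w k - of_real q * w (Suc k)) * S_factor q (w \<circ> s) (Suc k) k = of_real q * w k - w (Suc k)"
      using nz by (simp add: S_factor_def sk field_simps)
    ultimately show ?thesis by (simp flip: mult.assoc) (simp add: algebra_simps)
  qed
  show ?thesis
    unfolding bethe_term_A sites using A by (simp flip: mult.assoc mult_minus_left)
qed

text \<open>Single terms are only mapped to each other; antisymmetry appears after summation, since
  \<sigma> and \<open>s \<circ> \<sigma>\<close> run through the same set. The factor
  \<open>decay\<close> is symmetric.\<close>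

lemma \<Phi>_antisymmetric:
  assumes k: "1 \<le> k" "k < n" and Y: "Y (Suc k) = Y k" and w: "w \<in> torus"
  defines "s \<equiv> Transposition.transpose k (Suc k)"
  shows "(w k - of_real q * w (Suc k)) * (\<Phi> Y (w \<circ> s) * decay t (w \<circ> s)) =
    - ((w (Suc k) - of_real q * w k) * (\<Phi> Y w * decay t w))"
proof -
  have s_perm: "s permutes {1..n}" unfolding s_def by (rule permutes_swap_id) (use k in auto)
  have ss: "s \<circ> (s \<circ> \<sigma>) = \<sigma>" for \<sigma> :: "nat \<Rightarrow> nat" by (auto simp: s_def fun_eq_iff)
  have "decay t (w \<circ> s) = decay t w"
    using sum.permute[OF s_perm, of w] by (simp add: decay_def o_def)
  moreover have "(w k - of_real q * w (Suc k)) * \<Phi> Y (w \<circ> s) =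
     - ((w (Suc k) - of_real q * w k) * (\<Sum>\<sigma> | \<sigma> permutes {1..n}. bethe_term Y (s \<circ> \<sigma>) w))"
    unfolding \<Phi>_def sum_distrib_left sum_negf[symmetric] s_def
    by (intro sum.cong refl bethe_term_antisymmetric k Y w) auto
  moreover have "(\<Sum>\<sigma> | \<sigma> permutes {1..n}. bethe_term Y (s \<circ> \<sigma>) w) = \<Phi> Y w"
    unfolding \<Phi>_def
    by (rule sum.reindex_bij_witness[of _ "\<lambda>\<sigma>. s \<circ> \<sigma>" "\<lambda>\<sigma>. s \<circ> \<sigma>"])
       (use s_perm in \<open>auto simp: ss intro!: permutes_compose\<close>)
  ultimately show ?thesis by (simp flip: mult.assoc)
qed

text \<open>The difference of the two sides is minus the integral of \<open>H\<close>. Exchanging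
  the two variables leaves that integral unchanged but turns \<open>H\<close> into an integrand that
  may be replaced by \<open>- H\<close>, so it is 0.\<close>

lemma weighted_stack:
  assumes "admissible Y" and k: "1 \<le> k" "k < n" and Y: "Y (Suc k) = Y k"
  shows "weighted Y t (Suc k) = of_real q * weighted Y t k"
proof -
  let ?s = "Transposition.transpose k (Suc k)"
  define H where "H w = (w (Suc k) - of_real q * w k) * (\<Phi> Y w * decay t w)" for w
  have w0: "(\<lambda>_. 0) \<in> polycircle R {}" by simp
  have H: "continuous_on torus H"
    unfolding H_def by (intro continuous_intros continuous_on_\<Phi> continuous_on_decay assms)
  have H': "continuous_on (polycircle R ({} \<union> set [1..<Suc n])) H"
    unfolding polycircle_upt by (rule H)
  have "integral_torus H = integral_torus (\<lambda>w. H (w \<circ> ?s))"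
    using circ_int_transpose_adjacent[OF R _ H, of k "\<lambda>_. 0"] k by (simp add: o_def)
  also have "\<dots> = integral_torus (\<lambda>w. (- 1) * H w)"
  proof (rule circ_int_cong[OF R _ w0])
    fix w assume "w \<in> polycircle R ({} \<union> set [1..<Suc n])"
    then have w: "w \<in> torus" unfolding polycircle_upt .
    have "H (w \<circ> ?s) = (w k - of_real q * w (Suc k)) * (\<Phi> Y (w \<circ> ?s) * decay t (w \<circ> ?s))"
      by (simp add: H_def)
    also have "\<dots> = (- 1) * H w"
      unfolding H_def using \<Phi>_antisymmetric[where Y = Y and t = t, OF k Y w] by simp
    finally show "H (w \<circ> ?s) = (- 1) * H w" .
  qed
  also have "\<dots> = (- 1) * integral_torus H"
    by (rule circ_int_cmult[OF R H' w0])
  finally have H0: "integral_torus H = 0" by simp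
  let ?G = "\<lambda>k w. - w k * (\<Phi> Y w * decay t w)"
  have G: "continuous_on (polycircle R ({} \<union> set [1..<Suc n])) (?G k)" for k
    unfolding polycircle_upt by (rule cont_w\<Phi>[OF assms(1)])
  have "weighted Y t (Suc k) = integral_torus (\<lambda>w. of_real q * ?G k w + (- 1) * H w)"
    unfolding weighted_def H_def by (simp add: algebra_simps)
  also have "\<dots> = integral_torus (\<lambda>w. of_real q * ?G k w) + integral_torus (\<lambda>w. (- 1) * H w)"
    by (rule circ_int_add[OF R _ _ w0]) (intro continuous_on_mult continuous_on_const G H')+
  also have "integral_torus (\<lambda>w. of_real q * ?G k w) = of_real q * weighted Y t k"
    unfolding weighted_def by (rule circ_int_cmult[OF R G w0])
  also have "integral_torus (\<lambda>w. (- 1) * H w) = (- 1) * integral_torus H"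
    by (rule circ_int_cmult[OF R H' w0])
  finally show ?thesis unfolding H0 by simp
qed

definition tops :: "(nat \<Rightarrow> int) \<Rightarrow> nat set" where
  "tops Y = {k. k \<in> {1..n} \<and> (k = 1 \<or> Y (k - 1) > Y k)}"

lemma solution_backward:
  assumes "admissible Y" "Y \<in> Weyl n"
  shows "(solution Y has_vector_derivative
    (\<Sum>k\<in>tops Y. of_real (a (Y k) * (1 - q ^ site_count n Y (Y k))) * (solution (Y(k := Y k + 1)) t - solution Y t))) (at t)"
proof -
  have "complex_of_real (1 - q) \<noteq> 0" using q by (simp only: of_real_eq_0_iff)
  then have q1: "1 - complex_of_real q \<noteq> 0" by simp
  \<comment> \<open>The telescoped weights are \<open>1 - q ^ j\<close>, and each
    \<open>weighted\<close> carries \<open>b = a * (1 - q)\<close>. Cancelling \<open>1 - q\<close>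
    leaves the jump rate \<open>a * (1 - q ^ j)\<close>.\<close>
  have "(1 - of_real q) * (\<Sum>k=1..n. weighted Y t k) =
    (\<Sum>k\<in>tops Y. (1 - of_real q ^ site_count n Y (Y k)) * weighted Y t k)"
    unfolding tops_def
    by (rule sum_stack_telescope[OF assms(2)]) (rule weighted_stack[OF assms(1)])
  also have "\<dots> = (1 - of_real q) *
    (\<Sum>k\<in>tops Y. of_real (a (Y k) * (1 - q ^ site_count n Y (Y k))) * (solution (Y(k := Y k + 1)) t - solution Y t))"
    unfolding sum_distrib_left
    by (intro sum.cong refl) (auto simp: tops_def weighted_eq[OF assms(1)] b_of_def mult_ac)
  finally have "(\<Sum>k=1..n. weighted Y t k) =
    (\<Sum>k\<in>tops Y. of_real (a (Y k) * (1 - q ^ site_count n Y (Y k))) * (solution (Y(k := Y k + 1)) t - solution Y t))"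
    using q1 by simp
  with solution_deriv[OF assms(1), of t] show ?thesis by simp
qed

text \<open>Choosing the variable \<open>w\<^sub>p\<close> with \<open>p\<close> minimal makes its contour free of poles in the interior.\<close>

lemma integral_bethe_term_above:
  assumes "admissible Y" "Y \<in> Weyl n" "\<sigma> permutes {1..n}" "m \<in> {1..n}" "X (inv \<sigma> m) < Y m"
  shows "integral_torus (\<lambda>w. bethe_term Y \<sigma> w * decay t w) = 0"
proof -
  define p where "p = (LEAST m. m \<in> {1..n} \<and> X (inv \<sigma> m) < Y m)"
  have p: "p \<in> {1..n}" "X (inv \<sigma> p) < Y p"
    using LeastI[of "\<lambda>m. m \<in> {1..n} \<and> X (inv \<sigma> m) < Y m", OF conjI[OF assms(4,5)]] by (auto simp: p_def)
  have least: "p \<le> m" if "m \<in> {1..n}" "X (inv \<sigma> m) < Y m" for m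
    unfolding p_def by (rule Least_le) (use that in auto)
  \<comment> \<open>An inversion would give \<open>X (inv \<sigma> \<alpha>) \<le> X (inv \<sigma>
    p) < Y p \<le> Y \<alpha>\<close> with \<open>\<alpha> < p\<close>, against minimality of
    \<open>p\<close>.\<close>
  have no: "(p, \<alpha>) \<notin> inversions n \<sigma>" for \<alpha>
  proof
    assume "(p, \<alpha>) \<in> inversions n \<sigma>"
    then have \<alpha>: "\<alpha> \<in> {1..n}" "\<alpha> < p" "inv \<sigma> p < inv \<sigma> \<alpha>" by (auto simp: inversions_def)
    have "X (inv \<sigma> \<alpha>) \<le> X (inv \<sigma> p)"
      using X \<alpha> permutes_range[OF assms(3)] p by (auto simp: Weyl_def)
    moreover have "Y p \<le> Y \<alpha>" using assms(2) \<alpha> p by (auto simp: Weyl_def)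
    ultimately show False using least[of \<alpha>] \<alpha> p by auto
  qed
  show ?thesis
  proof (rule circ_int_eq_0[OF R distinct_upt, of p])
    show "p \<in> set [1..<Suc n]" using p by auto
    show "continuous_on (polycircle R (set [1..<Suc n])) (\<lambda>w. bethe_term Y \<sigma> w * decay t w)"
      unfolding polycircle_upt by (intro continuous_intros continuous_on_bethe_term continuous_on_decay assms)
    fix w assume "w \<in> polycircle R (set [1..<Suc n] - {p})"
    then have w: "w \<in> polycircle R ({1..n} - {p})" unfolding polycircle_upt .
    have "(\<lambda>z. decay t (w(p := z))) holomorphic_on cball 0 R"
    proof -
      have "(\<lambda>z. (w(p := z)) j) holomorphic_on cball 0 R" for j by (cases "j = p") auto
      then show ?thesis unfolding decay_def by (intro holomorphic_intros) auto
    qed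
    then have "(\<lambda>z. bethe_term Y \<sigma> (w(p := z)) * decay t (w(p := z))) holomorphic_on cball 0 R"
      unfolding bethe_term_def
      by (intro holomorphic_on_mult bethe_prod_interior[where p = p and x = "\<lambda>m. X (inv \<sigma> m)" and y = Y]
          q R inversions_subset p no w) auto
    then show "contour_integral (circlepath 0 R) (\<lambda>z. bethe_term Y \<sigma> (w(p := z)) * decay t (w(p := z))) = 0"
      by (rule contour_integral_circlepath_interior[OF R])
  qed
qed

text \<open>Dually, at time \<open>0\<close> the integrand has no poles in \<open>w\<^sub>p\<close> outside the contour for \<open>p\<close> maximal.\<close>

lemma integral_bethe_term_below:
  assumes "admissible Y" "Y \<in> Weyl n" "\<sigma> permutes {1..n}"
    and le: "\<And>m. m \<in> {1..n} \<Longrightarrow> Y m \<le> X (inv \<sigma> m)" and "m \<in> {1..n}" "Y m < X (inv \<sigma> m)"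
  shows "integral_torus (bethe_term Y \<sigma>) = 0"
proof -
  let ?P = "{m \<in> {1..n}. Y m < X (inv \<sigma> m)}"
  define p where "p = Max ?P"
  have "?P \<noteq> {}" using assms(5,6) by blast
  then have "p \<in> ?P" unfolding p_def by (intro Max_in) auto
  then have p: "p \<in> {1..n}" "Y p < X (inv \<sigma> p)" by auto
  have greatest: "m \<le> p" if "m \<in> {1..n}" "Y m < X (inv \<sigma> m)" for m
    unfolding p_def by (rule Max_ge) (use that in auto)
  \<comment> \<open>Dually, \<open>Y \<beta> \<le> Y p < X (inv \<sigma> p) \<le> X (inv \<sigma>
    \<beta>)\<close> with \<open>p < \<beta>\<close> would contradict maximality of
    \<open>p\<close>.\<close>
  have no: "(\<beta>, p) \<notin> inversions n \<sigma>" for \<beta>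
  proof
    assume "(\<beta>, p) \<in> inversions n \<sigma>"
    then have \<beta>: "\<beta> \<in> {1..n}" "p < \<beta>" "inv \<sigma> \<beta> < inv \<sigma> p" by (auto simp: inversions_def)
    have "X (inv \<sigma> p) \<le> X (inv \<sigma> \<beta>)"
      using X \<beta> permutes_range[OF assms(3)] p by (auto simp: Weyl_def)
    moreover have "Y \<beta> \<le> Y p" using assms(2) \<beta> p by (auto simp: Weyl_def)
    ultimately show False using greatest[of \<beta>] \<beta> p by auto
  qed
  show ?thesis
  proof (rule circ_int_eq_0[OF R distinct_upt, of p])
    show "p \<in> set [1..<Suc n]" using p by auto
    show "continuous_on (polycircle R (set [1..<Suc n])) (bethe_term Y \<sigma>)"
      unfolding polycircle_upt by (intro continuous_on_bethe_term assms)
    fix w assume "w \<in> polycircle R (set [1..<Suc n] - {p})"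
    then have w: "w \<in> polycircle R ({1..n} - {p})" unfolding polycircle_upt .
    have bR: "b k < R" if "Y p \<le> k" "k \<le> X (inv \<sigma> p)" for k
      using assms(1) p(1) permutes_range[OF assms(3) p(1)] that unfolding admissible_def by blast
    show "contour_integral (circlepath 0 R) (\<lambda>z. bethe_term Y \<sigma> (w(p := z))) = 0"
      unfolding bethe_term_def
      by (subst bethe_prod_exterior[where p = p and x = "\<lambda>m. X (inv \<sigma> m)" and y = Y and K = "{1..n}" and w = w])
         (use p q R b_pos le bR inversions_subset no w in auto)
  qed
qed

lemma integral_bethe_term_stationary:
  assumes "admissible X" "\<sigma> \<in> stabilizer n X"
  shows "integral_torus (bethe_term X \<sigma>) =
    (- 2 * of_real pi * \<i>) ^ n * (\<Prod>m=1..n. of_real (b (X m))) * of_real q ^ card (inversions n \<sigma>)"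
proof -
  have \<sigma>: "\<sigma> permutes {1..n}" "\<And>i. i \<in> {1..n} \<Longrightarrow> X (\<sigma> i) = X i"
    using assms(2) by (auto simp: stabilizer_def)
  have "X (inv \<sigma> m) = X m" if "m \<in> {1..n}" for m
    using \<sigma>(2)[OF permutes_range[OF \<sigma>(1) that]] by (simp add: permutes_inverses[OF \<sigma>(1)])
  then have "bethe_term X \<sigma> = bethe_prod q b (inversions n \<sigma>) {1..n} X X"
    by (auto simp: bethe_term_def bethe_prod_def fun_eq_iff)
  moreover have "b (X m) < R" if "m \<in> {1..n}" for m
    using assms(1) that unfolding admissible_def by blast
  ultimately show ?thesis
    using circ_int_bethe_prod_stationary[OF q R b_pos _ inversions_subset] by simp
qed

section \<open>Initial values and normalisation\<close>

lemma solution_initial: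
  assumes "admissible Y" "Y \<in> Weyl n"
  shows "solution Y 0 = (if Y = X then of_real (Wt q n X) * ((- 2 * of_real pi * \<i>) ^ n * (\<Prod>m=1..n. of_real (b (X m)))) else 0)"
proof -
  have zero: "integral_torus (bethe_term Y \<sigma>) = 0"
    if \<sigma>: "\<sigma> permutes {1..n}" and ne: "\<not> (Y = X \<and> \<sigma> \<in> stabilizer n X)" for \<sigma>
  proof (rule ccontr)
    assume nz: "integral_torus (bethe_term Y \<sigma>) \<noteq> 0"
    \<comment> \<open>A nonzero integral excludes \<open>Y m > X (inv \<sigma> m)\<close> through
      the interior and then strict inequality through the exterior. Hence \<open>Y\<close> is a
      rearrangement of \<open>X\<close>, and both being decreasing, it equals
      \<open>X\<close>.\<close>
    have le: "Y m \<le> X (inv \<sigma> m)" if "m \<in> {1..n}" for m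
      using integral_bethe_term_above[OF assms \<sigma> that, of 0] nz by (force simp: decay_def)
    have eq: "Y m = X (inv \<sigma> m)" if "m \<in> {1..n}" for m
      using integral_bethe_term_below[OF assms \<sigma> le that] nz le[OF that] by force
    have eq': "Y (\<sigma> i) = X i" if "i \<in> {1..n}" for i
      using eq[of "\<sigma> i"] permutes_in_image[OF \<sigma>, of i] that by (simp add: permutes_inverses[OF \<sigma>])
    have "X = Y" by (rule Weyl_permuted_eq[OF X assms(2) \<sigma> eq'])
    with eq' \<sigma> ne show False by (auto simp: stabilizer_def)
  qed
  have "solution Y 0 = (\<Sum>\<sigma> | \<sigma> permutes {1..n}. integral_torus (bethe_term Y \<sigma>))"
    using solution_sum[OF assms(1), of 0] by (simp add: decay_def)
  also have "\<dots> = (if Y = X then (\<Sum>\<sigma>\<in>stabilizer n X. integral_torus (bethe_term X \<sigma>)) else 0)"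
  proof (cases "Y = X")
    case True
    have "(\<Sum>\<sigma> | \<sigma> permutes {1..n}. integral_torus (bethe_term X \<sigma>)) = (\<Sum>\<sigma>\<in>stabilizer n X. integral_torus (bethe_term X \<sigma>))"
      by (rule sum.mono_neutral_right) (use zero[unfolded True] in \<open>auto simp: finite_permutations stabilizer_def\<close>)
    then show ?thesis using True by simp
  next
    case False
    then show ?thesis using zero by (simp add: sum.neutral)
  qed
  also have "\<dots> = (if Y = X then of_real (Wt q n X) * ((- 2 * of_real pi * \<i>) ^ n * (\<Prod>m=1..n. of_real (b (X m)))) else 0)"
  proof (cases "Y = X")
    case True
    have "(\<Sum>\<sigma>\<in>stabilizer n X. integral_torus (bethe_term X \<sigma>)) =
      (- 2 * of_real pi * \<i>) ^ n * (\<Prod>m=1..n. of_real (b (X m))) * of_real (\<Sum>\<sigma>\<in>stabilizer n X. q ^ card (inversions n \<sigma>))"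
      unfolding of_real_sum of_real_power sum_distrib_left
      by (intro sum.cong refl integral_bethe_term_stationary) (use assms(1) True in auto)
    also have "(\<Sum>\<sigma>\<in>stabilizer n X. q ^ card (inversions n \<sigma>)) = Wt q n X"
      using q X by (intro sum_stabilizer_inversions) (auto simp: Weyl_def)
    finally show ?thesis using True by (simp add: mult_ac)
  qed simp
  finally show ?thesis .
qed

text \<open>Pigeonhole: the numbers \<open>X (inv \<sigma> m)\<close> have the same total as
  \<open>X\<close>, so for each \<sigma> some \<open>Y m\<close> exceeds its partner.\<close>

lemma solution_above:
  assumes "admissible Y" "Y \<in> Weyl n" "(\<Sum>i=1..n. X i) < (\<Sum>i=1..n. Y i)"
  shows "solution Y t = 0"
proof -
  have "integral_torus (\<lambda>w. bethe_term Y \<sigma> w * decay t w) = 0" if \<sigma>: "\<sigma> permutes {1..n}" for \<sigma>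
  proof -
    have "(\<Sum>m=1..n. X (inv \<sigma> m)) = (\<Sum>i=1..n. X i)"
      using sum.permute[OF permutes_inv[OF \<sigma>], of X] by (simp add: o_def)
    then have "\<exists>m\<in>{1..n}. X (inv \<sigma> m) < Y m"
      using assms(3) sum_mono[of "{1..n}" Y "\<lambda>m. X (inv \<sigma> m)"] by force
    then show ?thesis using integral_bethe_term_above[OF assms(1,2) \<sigma>] by blast
  qed
  then show ?thesis by (simp add: solution_sum[OF assms(1)])
qed

definition norm_const :: complex where
  "norm_const = 1 / of_real (Wt q n X) * ((\<Prod>k=1..n. - 1 / of_real (b (X k))) * (1 / (2 * of_real pi * \<i>) ^ n))"

text \<open>The sign of each \<open>- 1 / b\<close> cancels the sign contributed by infinity in the
  exterior evaluation, and \<open>Wt\<close> cancels the sum over the stabilizer.\<close>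

lemma norm_const_eq:
  "norm_const * (of_real (Wt q n X) * ((- 2 * of_real pi * \<i>) ^ n * (\<Prod>m=1..n. of_real (b (X m))))) = 1"
proof -
  have "(\<Prod>k=1..n. - 1 / complex_of_real (b (X k))) * (\<Prod>m=1..n. of_real (b (X m))) = (\<Prod>k=1..n. - 1)"
    unfolding prod.distrib[symmetric]
    by (intro prod.cong refl) (use b_pos in \<open>simp add: less_imp_neq[symmetric]\<close>)
  also have "\<dots> = (- 1) ^ n" by simp
  finally have 1: "(\<Prod>k=1..n. - 1 / complex_of_real (b (X k))) * (\<Prod>m=1..n. of_real (b (X m))) = (- 1) ^ n" .
  have 2: "(- 2 * complex_of_real pi * \<i>) ^ n = (- 1) ^ n * (2 * of_real pi * \<i>) ^ n"
    unfolding power_mult_distrib[symmetric] by (intro arg_cong[of _ _ "\<lambda>z. z ^ n"]) simp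
  have 3: "(2 * complex_of_real pi * \<i>) ^ n \<noteq> 0" by simp
  have 4: "complex_of_real (Wt q n X) \<noteq> 0" using Wt_nonzero[OF q] by simp
  have "norm_const * (of_real (Wt q n X) * ((- 2 * of_real pi * \<i>) ^ n * (\<Prod>m=1..n. of_real (b (X m))))) =
    (- 1) ^ n * ((\<Prod>k=1..n. - 1 / complex_of_real (b (X k))) * (\<Prod>m=1..n. of_real (b (X m))))"
    unfolding norm_const_def 2 using 3 4 by (simp add: field_simps)
  also have "\<dots> = 1" unfolding 1 power_mult_distrib[symmetric] by simp
  finally show ?thesis .
qed

lemma sum_\<Lambda>:
  assumes "admissible Y"
  shows "1 / of_real (Wt q n X) * (\<Sum>\<sigma> | \<sigma> permutes {1..n}. \<Lambda> q a n R Y X t \<sigma>) = norm_const * solution Y t"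
proof -
  have "\<Lambda> q a n R Y X t \<sigma> = ((\<Prod>k=1..n. - 1 / of_real (b (X k))) * (1 / (2 * of_real pi * \<i>) ^ n)) *
    integral_torus (\<lambda>w. bethe_term Y \<sigma> w * decay t w)" if "\<sigma> permutes {1..n}" for \<sigma>
    unfolding \<Lambda>_def integrand_eq[OF that] ..
  then show ?thesis
    unfolding solution_sum[OF assms] norm_const_def by (simp add: sum_distrib_left mult.assoc)
qed

section \<open>Jumps of the q-TAZRP as successors in a graded chain\<close>

lemma tops_Weyl:
  assumes "Y \<in> Weyl n" "k \<in> tops Y"
  shows "Y(k := Y k + 1) \<in> Weyl n"
proof -
  have anti: "Y j \<le> Y i" if "i \<in> {1..n}" "j \<in> {1..n}" "i \<le> j" for i j
    using assms(1) that by (auto simp: Weyl_def)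
  have k: "k \<in> {1..n}" using assms(2) by (simp add: tops_def)
  have top: "Y k < Y i" if "i \<in> {1..n}" "i < k" for i
  proof -
    have "Y (k - 1) \<le> Y i" by (rule anti) (use that k in auto)
    moreover have "Y k < Y (k - 1)" using assms(2) that by (auto simp: tops_def)
    ultimately show ?thesis by simp
  qed
  have "(Y(k := Y k + 1)) j \<le> (Y(k := Y k + 1)) i" if "i \<in> {1..n}" "j \<in> {1..n}" "i \<le> j" for i j
    using anti[OF that] top[of i] that by auto
  moreover have "Y(k := Y k + 1) \<in> {1..n} \<rightarrow>\<^sub>E UNIV"
    using assms(1) k by (auto simp: Weyl_def PiE_iff extensional_def)
  ultimately show ?thesis by (auto simp: Weyl_def)
qed

lemma tazrp_rate_eq:
  "tazrp_rate q a n Y Y' = (\<Sum>k\<in>tops Y. if Y' = Y(k := Y k + 1) then a (Y k) * (1 - q ^ site_count n Y (Y k)) else 0)"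
proof -
  have "tazrp_rate q a n Y Y' = (\<Sum>k\<in>{1..n}. if k = 1 \<or> Y (k - 1) > Y k then
      if Y' = Y(k := Y k + 1) then a (Y k) * (1 - q ^ site_count n Y (Y k)) else 0 else 0)"
    unfolding tazrp_rate_def by (intro sum.cong refl) auto
  also have "\<dots> = (\<Sum>k\<in>tops Y. if Y' = Y(k := Y k + 1) then a (Y k) * (1 - q ^ site_count n Y (Y k)) else 0)"
    unfolding tops_def by (rule sum.inter_filter[symmetric]) simp
  finally show ?thesis .
qed

lemma finite_tops: "finite (tops Y)"
  by (simp add: tops_def)

lemma jump_inj: "Y(k := Y k + 1) = Y(j := Y j + 1) \<longleftrightarrow> k = (j :: nat)" for Y :: "nat \<Rightarrow> int"
  by (metis add_cancel_left_right fun_upd_other fun_upd_same zero_neq_one)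

lemma tazrp_rate_top:
  assumes "k \<in> tops Y"
  shows "tazrp_rate q a n Y (Y(k := Y k + 1)) = a (Y k) * (1 - q ^ site_count n Y (Y k))"
  unfolding tazrp_rate_eq jump_inj using assms finite_tops by simp

end

theorem theorem1p1:
  fixes n :: nat and q :: real and a :: "int \<Rightarrow> real" and X Y :: "nat \<Rightarrow> int"
    and t R :: real
    and M :: "'w measure" and Z :: "nat \<Rightarrow> 'w \<Rightarrow> nat \<Rightarrow> int" and S :: "nat \<Rightarrow> 'w \<Rightarrow> real"
  assumes "n \<ge> 1" and "0 < q" and "q < 1" and "\<And>i. a i > 0"
    and "X \<in> Weyl n" and "Y \<in> Weyl n" and "t > 0"
    and "is_tazrp M q a n Y Z S"
    and "R > 0"
    and "\<And>i j k. i \<in> {1..n} \<Longrightarrow> j \<in> {1..n} \<Longrightarrow> Y i \<le> k \<Longrightarrow> k \<le> X j \<Longrightarrow> b_of q a k < R"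
  shows "complex_of_real (measure M (in_state_at M Z S t X)) =
    1 / of_real (Wt q n X) * (\<Sum>\<sigma> | \<sigma> permutes {1..n}. \<Lambda> q a n R Y X t \<sigma>)"
proof -
  interpret tazrp_formula n q a X R
    by standard (use assms in auto)
  define succ where "succ V = (\<lambda>k. V(k := V k + 1)) ` tops V" for V :: "nat \<Rightarrow> int"
  have site_pos: "site_count n V (V k) > 0" if "k \<in> tops V" for V k
    using that by (auto simp: site_count_def tops_def card_gt_0_iff)
  interpret graded_chain M "Weyl n" "tazrp_rate q a n" Y Z S succ "\<lambda>V. \<Sum>i=1..n. V i"
  proof
    show "jump_hold_chain M (Weyl n) (tazrp_rate q a n) Y Z S"
      using assms(8) by (simp add: is_tazrp_def)
    fix V V' assume V: "V \<in> Weyl n"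
    show "finite (succ V)" by (simp add: succ_def finite_tops)
    have "1 \<in> tops V" using n by (simp add: tops_def)
    then show "succ V \<noteq> {}" by (auto simp: succ_def)
    show "succ V \<subseteq> Weyl n" using tops_Weyl[OF V] by (auto simp: succ_def)
    {
      assume "V' \<in> succ V"
      then obtain k where k: "k \<in> tops V" "V' = V(k := V k + 1)" by (auto simp: succ_def)
      have "q ^ site_count n V (V k) < 1"
        using power_strict_decreasing[OF site_pos[OF k(1)] q] by simp
      then show "tazrp_rate q a n V V' > 0"
        using a unfolding k(2) tazrp_rate_top[OF k(1)] by simp
      have "k \<in> {1..n}" using k by (simp add: tops_def)
      then show "(\<Sum>i=1..n. V' i) = (\<Sum>i=1..n. V i) + 1"
        unfolding k(2) by (simp add: sum.remove[of _ k])
    }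
    show "tazrp_rate q a n V V' = 0" if "V' \<in> Weyl n - {V} - succ V"
      using that unfolding tazrp_rate_eq succ_def by (intro sum.neutral) auto
  qed (use assms in auto)
  have "complex_of_real (prob (in_state_at M Z S t X)) = norm_const * solution Y t"
  \<comment> \<open>\<open>norm_const\<close> depends on \<open>X\<close> only, so linearity carries
    it through the backward equation in the starting state. One radius serves all states visited: a
    jump raises one coordinate and thus only shrinks the ranges of sites in
    \<open>admissible\<close>, which makes it an invariant.\<close>
  proof (rule prob_in_state_at_unique[where P = admissible and u = "\<lambda>V t. norm_const * solution V t"])
    show "admissible Y" using assms(10) by (auto simp: admissible_def)
    show "t \<ge> 0" using assms(7) by simp
    fix V assume V: "V \<in> Weyl n" "admissible V"
    show "admissible V'" if "V' \<in> succ V" for V'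
      using that admissible_step[OF V(2)] by (auto simp: succ_def)
    show "norm_const * solution V t = 0" if "(\<Sum>i=1..n. X i) < (\<Sum>i=1..n. V i)" for t
      using solution_above[OF V(2,1) that] by simp
    show "norm_const * solution V 0 = (if V = X then 1 else 0)"
      using solution_initial[OF V(2,1)] norm_const_eq by simp
    fix t
    have "((\<lambda>t. norm_const * solution V t) has_vector_derivative norm_const *
      (\<Sum>k\<in>tops V. of_real (a (V k) * (1 - q ^ site_count n V (V k))) * (solution (V(k := V k + 1)) t - solution V t))) (at t)"
      by (rule has_vector_derivative_mult_right[OF solution_backward[OF V(2,1)]])
    also have "norm_const *
      (\<Sum>k\<in>tops V. of_real (a (V k) * (1 - q ^ site_count n V (V k))) * (solution (V(k := V k + 1)) t - solution V t)) =
      (\<Sum>V'\<in>succ V. of_real (tazrp_rate q a n V V') * (norm_const * solution V' t - norm_const * solution V t))"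
      unfolding succ_def sum_distrib_left
      by (subst sum.reindex) (auto simp: inj_on_def jump_inj tazrp_rate_top right_diff_distrib mult_ac intro!: sum.cong)
    finally show "((\<lambda>t. norm_const * solution V t) has_vector_derivative
      (\<Sum>V'\<in>succ V. of_real (tazrp_rate q a n V V') * (norm_const * solution V' t - norm_const * solution V t))) (at t)" .
  qed
  also have "\<dots> = 1 / of_real (Wt q n X) * (\<Sum>\<sigma> | \<sigma> permutes {1..n}. \<Lambda> q a n R Y X t \<sigma>)"
    using sum_\<Lambda>[of Y t] assms(10) by (auto simp: admissible_def)
  finally show ?thesis .
qed

end
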